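(* Under elliptic-curve addition, $\mathcal V$ is an abelian group isomorphic to $\mathbb Z\oplus\mathbb Z\oplus\mathbb Z/3\mathbb Z$. The generators of infinite order may be taken to be $h_1=(x,y)$ and $h_2=(\omega x,\omega y)$; the element of order $3$ is $h_0=(1:-\omega:0)$. Further, for all $m,n\in\mathbb Z$ and $t\in\{0,1,2\}$, $d(mh_1+nh_2+th_0)=m^2-mn+n^2$. Moreover, the subgroup $\mathcal V_1=\{mh_1+nh_2: m,n\in\mathbb Z\}$ is ring-isomorphic to $\mathbb Z[\omega]$ under the identification $R(mh_1+nh_2)=m+n\omega$, with addition on the curve and composition $\circ$ in $\mathcal V_1$ corresponding respectively to addition and multiplication in $\mathbb Z[\omega]$.
   Context: Let $\omega=e^{2\pi i/3}$. A form is a homogeneous polynomial in $\mathbb C[x,y]$. $\mathcal V$ is the set of points $v=(p:q:r)$, where $p,q,r$ are forms, not all zero, with $p^3+q^3=(x^3+y^3)r^3$ (and $\deg p=\deg q=1+\deg r$ when $r\ne0$), taken up to multiplication by a common nonzero homogeneous rational function. Representatives are normalized so that $p,q,r$ have no common factor (then no two of them have a common factor unless $r=0$, in which case $p,q$ are constants), and the degree is $d(v)=\deg p=\deg q$ for such a representative. If $r\neq 0$ one writes $v=(f,g)$ with $f=p/r$, $g=q/r$, so $f^3+g^3=x^3+y^3$. The elements with $r=0$ (points at infinity) are $(1:-1:0),(1:-\omega:0),(1:-\omega^2:0)$, of degree $0$. Addition on $\mathcal V$ is the chord-tangent addition on the elliptic curve $X^3+Y^3=(x^3+y^3)Z^3$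 over $\mathbb C(x,y)$ with identity $0=(1:-1:0)$: three points on a line (with multiplicity) sum to $0$; in particular $-(p:q:r)=(q:p:r)$. Composition: for $v=(p:q:r)$ and $v'=(p':q':r')$ in $\mathcal V$, $v\circ v'=(p(p',q'):q(p',q'):r'\cdot r(p',q'))\in\mathcal V$; for $v=(f,g)$, $v'=(f',g')$ with nonzero third coordinates this is $(f(f',g'),g(f',g'))$. *)

theory Defs
  imports
    Complex_Main
    "HOL-Algebra.Elementary_Groups"
    "HOL-Algebra.Multiplicative_Group"
    "HOL-Algebra.QuotRing"
    "HOL-Computational_Algebra.Polynomial"
    "HOL-Computational_Algebra.Polynomial_Factorial"
begin

text \<open>
  \<open>\<complex>[x,y]\<close> is \<open>(\<complex>[x])[y]\<close>: the coefficient of \<open>x\<^sup>i y\<^sup>j\<close> in \<open>P\<close> is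
  \<open>coeff (coeff P j) i\<close>. Its fraction field \<open>\<complex>(x,y)\<close> is \<open>ratfun\<close>.
\<close>

type_synonym bipoly = "complex poly poly"
type_synonym ratfun = "bipoly fract"

definition bconst :: "complex \<Rightarrow> bipoly" where
  "bconst z = [:[:z:]:]"

definition bvx :: bipoly where
  "bvx = [:[:0, 1:]:]"

definition bvy :: bipoly where
  "bvy = [:0, 1:]"

definition omega :: complex where
  "omega = exp (2 * complex_of_real pi * \<i> / 3)"

text \<open>The zero polynomial is homogeneous of every degree.\<close>

definition homogeneous :: "nat \<Rightarrow> bipoly \<Rightarrow> bool" where
  "homogeneous n P \<longleftrightarrow>
     (\<forall>i j. Polynomial.coeff (Polynomial.coeff P j) i \<noteq> 0 \<longrightarrow> i + j = n)"

definition is_form :: "bipoly \<Rightarrow> bool" where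
  "is_form P \<longleftrightarrow> (\<exists>n. homogeneous n P)"

text \<open>Meaningful for nonzero forms only.\<close>

definition form_degree :: "bipoly \<Rightarrow> nat" where
  "form_degree P = (THE n. homogeneous n P)"

text \<open>\<open>bsubst P a b = P(a,b)\<close>\<close>

definition bsubst :: "bipoly \<Rightarrow> bipoly \<Rightarrow> bipoly \<Rightarrow> bipoly" where
  "bsubst P a b =
     (\<Sum>j\<le>Polynomial.degree P. \<Sum>i\<le>Polynomial.degree (Polynomial.coeff P j).
        bconst (Polynomial.coeff (Polynomial.coeff P j) i) * a ^ i * b ^ j)"


subsection \<open>The set of points\<close>

type_synonym triple = "bipoly \<times> bipoly \<times> bipoly"

definition V_triples :: "triple set" where
  "V_triples = {(p, q, r).
     is_form p \<and> is_form q \<and> is_form r \<and> (p, q, r) \<noteq> (0, 0, 0) \<and>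
     p ^ 3 + q ^ 3 = (bvx ^ 3 + bvy ^ 3) * r ^ 3 \<and>
     (r \<noteq> 0 \<longrightarrow> (\<exists>n. homogeneous n r \<and> homogeneous (n + 1) p \<and> homogeneous (n + 1) q))}"

text \<open>Proportionality by the homogeneous rational function \<open>a/b\<close>, denominators cleared.\<close>

definition V_rel :: "triple rel" where
  "V_rel = {((p, q, r), (p', q', r')).
     (p, q, r) \<in> V_triples \<and> (p', q', r') \<in> V_triples \<and>
     (\<exists>a b. is_form a \<and> a \<noteq> 0 \<and> is_form b \<and> b \<noteq> 0 \<and>
        b * p' = a * p \<and> b * q' = a * q \<and> b * r' = a * r)}"

type_synonym point = "triple set"

definition V :: "point set" where
  "V = V_triples // V_rel"

definition pt :: "bipoly \<Rightarrow> bipoly \<Rightarrow> bipoly \<Rightarrow> point" where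
  "pt p q r = V_rel `` {(p, q, r)}"

definition normalized :: "triple \<Rightarrow> bool" where
  "normalized = (\<lambda>(p, q, r). \<forall>c. c dvd p \<and> c dvd q \<and> c dvd r \<longrightarrow> is_unit c)"

text \<open>A normalized representative; it is unique up to a nonzero constant.\<close>

definition rep :: "point \<Rightarrow> triple" where
  "rep v = (SOME t. t \<in> v \<and> normalized t)"

definition d :: "point \<Rightarrow> nat" where
  "d v = (case rep v of (p, q, r) \<Rightarrow> form_degree p)"


subsection \<open>Chord-tangent addition\<close>

definition lin_comb ::
  "'a::comm_ring_1 \<Rightarrow> 'a \<times> 'a \<times> 'a \<Rightarrow> 'a \<Rightarrow> 'a \<times> 'a \<times> 'a \<Rightarrow> 'a \<times> 'a \<times> 'a" where
  "lin_comb s u t v =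
     (case (u, v) of ((u1, u2, u3), (v1, v2, v3)) \<Rightarrow>
        (s * u1 + t * v1, s * u2 + t * v2, s * u3 + t * v3))"

definition to_ratfun3 :: "triple \<Rightarrow> ratfun \<times> ratfun \<times> ratfun" where
  "to_ratfun3 = (\<lambda>(p, q, r). (to_fract p, to_fract q, to_fract r))"

definition cubic :: "ratfun \<times> ratfun \<times> ratfun \<Rightarrow> ratfun" where
  "cubic = (\<lambda>(X, Y, Z). X ^ 3 + Y ^ 3 - to_fract (bvx ^ 3 + bvy ^ 3) * Z ^ 3)"

text \<open>
  Homogeneous coordinate vectors \<open>P\<close>, \<open>Q\<close>, \<open>R\<close> form the intersection of the cubic with some
  line, counted with multiplicity: in coordinates \<open>(s : t)\<close> on the line spanned by \<open>u\<close> and \<open>v\<close>,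
  the cubic restricts to a nonzero binary form whose three zeros are \<open>P\<close>, \<open>Q\<close>, \<open>R\<close>. As
  \<open>ratfun\<close> is infinite, equality for all \<open>s\<close>, \<open>t\<close> is equality of binary forms.
\<close>

definition line_section ::
  "ratfun \<times> ratfun \<times> ratfun \<Rightarrow> ratfun \<times> ratfun \<times> ratfun \<Rightarrow> ratfun \<times> ratfun \<times> ratfun \<Rightarrow> bool"
  where
  "line_section P Q R \<longleftrightarrow>
     (\<exists>u v c s1 t1 s2 t2 s3 t3.
        (\<forall>a b. lin_comb a u b v = (0, 0, 0) \<longrightarrow> a = 0 \<and> b = 0) \<and> c \<noteq> 0 \<and>
        P = lin_comb s1 u t1 v \<and> Q = lin_comb s2 u t2 v \<and> R = lin_comb s3 u t3 v \<and>
        (\<forall>s t. cubic (lin_comb s u t v) =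
           c * (s * t1 - t * s1) * (s * t2 - t * s2) * (s * t3 - t * s3)))"

definition third_point :: "point \<Rightarrow> point \<Rightarrow> point" where
  "third_point v w = (THE z. z \<in> V \<and>
     (\<exists>P \<in> v. \<exists>Q \<in> w. \<exists>R \<in> z. line_section (to_ratfun3 P) (to_ratfun3 Q) (to_ratfun3 R)))"

definition V_zero :: point where
  "V_zero = pt 1 (- 1) 0"

text \<open>
  The chord-tangent law with identity \<open>V_zero\<close>. As \<open>V_zero\<close> is a flex (the line
  \<open>X + Y = 0\<close> meets the cubic there three times), \<open>third_point V_zero\<close> is negation and
  three points on a line sum to zero.
\<close>

definition V_add :: "point \<Rightarrow> point \<Rightarrow> point" where
  "V_add v w = third_point V_zero (third_point v w)"

definition V_group :: "point monoid" where
  "V_group = \<lparr>carrier = V, monoid.mult = V_add, one = V_zero\<rparr>"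

definition h0 :: point where
  "h0 = pt 1 (- bconst omega) 0"

definition h1 :: point where
  "h1 = pt bvx bvy 1"

definition h2 :: point where
  "h2 = pt (bconst omega * bvx) (bconst omega * bvy) 1"


subsection \<open>Composition and the ring on \<open>V1\<close>\<close>

text \<open>
  The left factor has to be normalized: for \<open>r' = 0\<close> a common factor of \<open>p, q, r\<close> may
  vanish at \<open>(p', q')\<close>.
\<close>

definition V_comp :: "point \<Rightarrow> point \<Rightarrow> point" where
  "V_comp v v' = (case rep v of (p, q, r) \<Rightarrow> case rep v' of (p', q', r') \<Rightarrow>
     pt (bsubst p p' q') (bsubst q p' q') (r' * bsubst r p' q'))"

text \<open>\<open>V_lin m n = m h1 + n h2\<close>; integer multiples are powers in the (multiplicatively
  written) HOL-Algebra group.\<close>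

definition V_lin :: "int \<Rightarrow> int \<Rightarrow> point" where
  "V_lin m n = (h1 [^]\<^bsub>V_group\<^esub> m) \<otimes>\<^bsub>V_group\<^esub> (h2 [^]\<^bsub>V_group\<^esub> n)"

definition V1 :: "point set" where
  "V1 = {V_lin m n | m n. True}"

definition V1_ring :: "point ring" where
  "V1_ring = \<lparr>carrier = V1, monoid.mult = V_comp, one = h1, zero = V_zero, add = V_add\<rparr>"

definition Eisenstein_ring :: "complex ring" where
  "Eisenstein_ring = \<lparr>carrier = {of_int m + of_int n * omega | m n. True},
     monoid.mult = (*), one = 1, zero = 0, add = (+)\<rparr>"

end

theory Submission
  imports
    Defs
    "HOL-Computational_Algebra.Field_as_Ring"
    "HOL-Computational_Algebra.Fundamental_Theorem_Algebra"
begin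

text \<open>
  Dehomogenizing a point of \<open>V\<close> gives a rational map of the curve \<open>E: x\<^sup>3 + y\<^sup>3 = 1\<close> to itself
  that commutes with \<open>(x, y) \<mapsto> (\<omega>x, \<omega>y)\<close>. Such a map is an endomorphism of \<open>E\<close>, that is,
  multiplication by an Eisenstein integer, followed by a translation by one of three points. The
  proof makes this picture algebraic by means of two numbers, both read off at the base point
  \<open>(x, y) = (1, -1)\<close>, where the cubic \<open>X\<^sup>3 + Y\<^sup>3 = (x\<^sup>3 + y\<^sup>3) Z\<^sup>3\<close> degenerates to three concurrent
  lines whose smooth part is the group \<open>\<complex> \<times> \<int>/3\<close>. The \<open>sheet\<close> of a point says on which line it
  lands, the \<open>slope\<close> is its coordinate on that line.

  \<^item> Group law. Nine forms of bidegree \<open>(2, 2)\<close> in the coordinates of two points \<open>v\<close>, \<open>w\<close> make up a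
    \<open>3 \<times> 3\<close> matrix of rank one whose rows are all proportional to \<open>v + w\<close> and whose columns are all
    proportional to \<open>v - w\<close> (\<open>law_rows_proportional\<close>); the chord-tangent construction yields these
    rows (\<open>collinear_iff\<close>). Evaluated at the base point they show that the pair (slope, sheet)
    is additive (\<open>slope_sheet_add\<close>). The slope is also the constant by which the point, as a map
    of \<open>E\<close>, multiplies the invariant differential, so a point of slope \<open>0\<close> lies at infinity
    (\<open>vanishing_slope\<close>). Hence (slope, sheet) embeds \<open>V\<close> into \<open>\<complex> \<times> \<complex>\<^sup>*\<close>, and associativity
    is inherited without any computation with three points.

  \<^item> Degree. The matrix above vanishes at no place (\<open>law_complete\<close>), so comparing degrees gives the
    parallelogram law \<open>d (v + w) + d (v - w) = 2 d v + 2 d w\<close> (\<open>parallelogram\<close>). Composition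
    multiplies degrees, and it multiplies slopes of points of sheet \<open>1\<close>. So the degree is a positive
    definite quadratic form on a subring of \<open>\<complex>\<close> that is also multiplicative, which forces it to be
    the squared modulus (\<open>form_is_norm\<close>): \<open>d v = |slope v|\<^sup>2\<close>.

  \<^item> Generators. The slopes of \<open>h1\<close> and \<open>h2\<close> are \<open>1\<close> and the conjugate of \<open>\<omega>\<close>. Subtracting from
    \<open>v\<close> the combination of \<open>h1\<close>, \<open>h2\<close> whose slope is an Eisenstein integer nearest to that of \<open>v\<close>
    leaves a point of degree less than \<open>1\<close>, so of slope \<open>0\<close>, so a multiple of \<open>h0\<close>
    (\<open>combination_surj\<close>). The ring isomorphism is the conjugate of the slope.
\<close>

section \<open>Forms in two variables\<close>

definition ev :: "bipoly \<Rightarrow> complex \<Rightarrow> complex \<Rightarrow> complex" where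
  "ev P x y = poly (poly P [:y:]) x"

lemma ev_simps [simp]:
  "ev (P + Q) x y = ev P x y + ev Q x y"
  "ev (P - Q) x y = ev P x y - ev Q x y"
  "ev (- P) x y = - ev P x y"
  "ev (P * Q) x y = ev P x y * ev Q x y"
  "ev (P ^ n) x y = ev P x y ^ n"
  "ev 0 x y = 0"
  "ev 1 x y = 1"
  "ev (numeral k) x y = numeral k"
  "ev (bconst c) x y = c"
  "ev bvx x y = x"
  "ev bvy x y = y"
  by (simp_all add: ev_def bconst_def bvx_def bvy_def)

lemma ev_sum: "ev (sum f S) x y = (\<Sum>i\<in>S. ev (f i) x y)"
  by (induction S rule: infinite_finite_induct) auto

lemma ev_altdef:
  "ev P x y = (\<Sum>j\<le>Polynomial.degree P. \<Sum>i\<le>Polynomial.degree (Polynomial.coeff P j).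
      Polynomial.coeff (Polynomial.coeff P j) i * x ^ i * y ^ j)"
proof -
  have "ev P x y = (\<Sum>j\<le>Polynomial.degree P. poly (Polynomial.coeff P j) x * y ^ j)"
    unfolding ev_def by (subst poly_altdef) (simp add: poly_sum)
  then show ?thesis
    by (simp add: poly_altdef sum_distrib_right)
qed

lemma ev_bsubst [simp]: "ev (bsubst P a b) x y = ev P (ev a x y) (ev b x y)"
  unfolding bsubst_def ev_altdef[of P] by (simp add: ev_sum)

text \<open>
  A polynomial in \<open>y\<close> over \<open>\<complex>[x]\<close> that vanishes at all constants \<open>y\<close> is zero. Identities between
  polynomials, and statements about \<open>bsubst\<close> in particular, thereby reduce to identities between
  complex numbers.
\<close>

lemma bipoly_eqI:
  assumes "\<And>x y. ev P x y = ev Q x y"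
  shows "P = Q"
proof (rule ccontr)
  assume "P \<noteq> Q"
  then have *: "P - Q \<noteq> 0" by simp
  have "poly P [:y:] = poly Q [:y:]" for y
    using assms unfolding ev_def poly_eq_poly_eq_iff[symmetric] by (intro ext)
  then have "range (\<lambda>y. [:y:]) \<subseteq> {z. poly (P - Q) z = 0}"
    by auto
  then have "finite (range (\<lambda>y::complex. [:y:]))"
    using finite_subset poly_roots_finite[OF *] by blast
  moreover have "inj (\<lambda>y::complex. [:y:])"
    by (rule injI) simp
  ultimately show False
    using infinite_UNIV_char_0[where ?'a = complex] by (simp only: finite_image_iff)
qed

text \<open>
  Homogeneity with an integer degree: a point of degree \<open>k\<close> has a third coordinate of degree
  \<open>k - 1\<close>, and for \<open>k = 0\<close> degree \<open>-1\<close> correctly says that this coordinate is zero.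
\<close>

definition homog :: "int \<Rightarrow> bipoly \<Rightarrow> bool" where
  "homog k P \<longleftrightarrow>
     (\<forall>i j. Polynomial.coeff (Polynomial.coeff P j) i \<noteq> 0 \<longrightarrow> int i + int j = k)"

lemma homog_iff: "homog (int n) P \<longleftrightarrow> homogeneous n P"
  unfolding homog_def homogeneous_def by (metis of_nat_add of_nat_eq_iff)

lemma homog_zero [simp]: "homog k 0"
  by (simp add: homog_def)

lemma homog_add: "homog k P \<Longrightarrow> homog k Q \<Longrightarrow> homog k (P + Q)"
  unfolding homog_def by (metis add.right_neutral coeff_add)

lemma homog_minus: "homog k P \<Longrightarrow> homog k (- P)"
  unfolding homog_def by simp

lemma homog_diff: "homog k P \<Longrightarrow> homog k Q \<Longrightarrow> homog k (P - Q)"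
  using homog_add[of k P "- Q"] homog_minus by simp

lemma homog_sum: "(\<And>i. i \<in> S \<Longrightarrow> homog k (f i)) \<Longrightarrow> homog k (sum f S)"
  by (induction S rule: infinite_finite_induct) (auto intro: homog_add)

lemma homog_mult:
  assumes "homog k P" "homog l Q"
  shows "homog (k + l) (P * Q)"
  unfolding homog_def
proof (intro allI impI)
  fix i j
  assume "Polynomial.coeff (Polynomial.coeff (P * Q) j) i \<noteq> 0"
  then obtain j1 i1 where "j1 \<le> j" "i1 \<le> i"
    and "Polynomial.coeff (Polynomial.coeff P j1) i1 * Polynomial.coeff (Polynomial.coeff Q (j - j1)) (i - i1) \<noteq> 0"
    by (auto simp: coeff_mult coeff_sum elim!: sum.not_neutral_contains_not_neutral)
  with assms have "int i1 + int j1 = k" "int (i - i1) + int (j - j1) = l"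
    unfolding homog_def by (metis mult_eq_0_iff)+
  with \<open>j1 \<le> j\<close> \<open>i1 \<le> i\<close> show "int i + int j = k + l"
    by simp
qed

lemma homog_const: "homog 0 (bconst c)"
  by (auto simp: homog_def bconst_def coeff_pCons split: nat.splits)

lemma homog_one: "homog 0 1"
  using homog_const[of 1] by (simp add: bconst_def one_pCons)

lemma homog_x: "homog 1 bvx" and homog_y: "homog 1 bvy"
  by (auto simp: homog_def bvx_def bvy_def coeff_pCons split: nat.splits)

lemma homog_power: "homog k P \<Longrightarrow> homog (int n * k) (P ^ n)"
  by (induction n) (auto simp: homog_one algebra_simps dest: homog_mult[of k P])

lemma homog_unique: "homog k P \<Longrightarrow> homog l P \<Longrightarrow> P \<noteq> 0 \<Longrightarrow> k = l"
  unfolding homog_def by (metis coeff_0 poly_eqI)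

lemma homog_nonneg: "homog k P \<Longrightarrow> P \<noteq> 0 \<Longrightarrow> 0 \<le> k"
  unfolding homog_def by (metis coeff_0 poly_eqI of_nat_0_le_iff add_nonneg_nonneg)

lemma is_form_iff: "is_form P \<longleftrightarrow> (\<exists>k. homog k P)"
  unfolding is_form_def homog_iff[symmetric]
  by (metis homog_nonneg homog_zero zero_le_imp_eq_int)

lemma form_degree_eq: "homog k P \<Longrightarrow> P \<noteq> 0 \<Longrightarrow> int (form_degree P) = k"
  unfolding form_degree_def homog_iff[symmetric]
  by (smt (verit) homog_nonneg homog_unique the_equality zero_le_imp_eq_int of_nat_eq_iff)

lemma homog_ev_scale:
  assumes "homog (int n) P"
  shows "ev P (c * x) (c * y) = c ^ n * ev P x y"
proof -
  have "Polynomial.coeff (Polynomial.coeff P j) i * (c * x) ^ i * (c * y) ^ j =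
      c ^ n * (Polynomial.coeff (Polynomial.coeff P j) i * x ^ i * y ^ j)" for i j
  proof (cases "Polynomial.coeff (Polynomial.coeff P j) i = 0")
    case False
    with assms have "n = i + j"
      unfolding homog_def by (metis of_nat_add of_nat_eq_iff)
    then show ?thesis
      by (simp add: power_mult_distrib power_add)
  qed simp
  then show ?thesis
    unfolding ev_altdef sum_distrib_left by (intro sum.cong refl)
qed

lemma homog_bsubst:
  assumes "homog k P" "homog l a" "homog l b"
  shows "homog (k * l) (bsubst P a b)"
  unfolding bsubst_def
proof (intro homog_sum)
  fix i j
  show "homog (k * l) (bconst (Polynomial.coeff (Polynomial.coeff P j) i) * a ^ i * b ^ j)"
  proof (cases "Polynomial.coeff (Polynomial.coeff P j) i = 0")
    case True
    then show ?thesis by (simp add: bconst_def)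
  next
    case False
    with assms(1) have k: "k = int i + int j"
      by (auto simp: homog_def)
    show ?thesis
      using homog_mult[OF homog_mult[OF homog_const homog_power[OF assms(2)]] homog_power[OF assms(3)]]
      by (simp add: k ring_distribs)
  qed
qed

text \<open>
  The substitution \<open>P(xy, y)\<close> turns total degree into degree in \<open>y\<close>, so forms become monomials
  in \<open>y\<close> over \<open>\<complex>[x]\<close>.
\<close>

definition by_degree :: "bipoly \<Rightarrow> bipoly" where
  "by_degree P = bsubst P (bvx * bvy) bvy"

lemma by_degree_mult: "by_degree (P * Q) = by_degree P * by_degree Q"
  by (rule bipoly_eqI) (simp add: by_degree_def)

lemma by_degree_term: "bconst c * (bvx * bvy) ^ i * bvy ^ j = Polynomial.monom (Polynomial.monom c i) (i + j)"
proof -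
  have 1: "bconst c = Polynomial.monom (Polynomial.monom c 0) 0"
    by (simp add: bconst_def monom_0)
  have 2: "bvx * bvy = Polynomial.monom (Polynomial.monom 1 1) 1"
    by (simp add: bvx_def bvy_def monom_Suc monom_0)
  have 3: "bvy = Polynomial.monom 1 1"
    by (simp add: bvy_def monom_Suc monom_0)
  show ?thesis
    unfolding 1 2 unfolding 3 by (simp add: monom_power mult_monom)
qed

lemma coeff_by_degree:
  "Polynomial.coeff (Polynomial.coeff (by_degree P) m) i =
    (if i \<le> m then Polynomial.coeff (Polynomial.coeff P (m - i)) i else 0)"
proof -
  have *: "(\<Sum>i'\<le>Polynomial.degree (Polynomial.coeff P j). if i' + j = m then
        (if i' = i then Polynomial.coeff (Polynomial.coeff P j) i else 0) else 0)
      = (if i + j = m then Polynomial.coeff (Polynomial.coeff P j) i else 0)" for j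
  proof -
    have "(\<Sum>i'\<le>Polynomial.degree (Polynomial.coeff P j). if i' + j = m then
        (if i' = i then Polynomial.coeff (Polynomial.coeff P j) i else 0) else 0)
      = (\<Sum>i'\<le>Polynomial.degree (Polynomial.coeff P j). if i' = i then
          (if i + j = m then Polynomial.coeff (Polynomial.coeff P j) i else 0) else 0)"
      by (intro sum.cong) auto
    also have "\<dots> = (if i + j = m then Polynomial.coeff (Polynomial.coeff P j) i else 0)"
      by (auto simp: coeff_eq_0)
    finally show ?thesis .
  qed
  have "Polynomial.coeff (Polynomial.coeff (by_degree P) m) i =
     (\<Sum>j\<le>Polynomial.degree P. if i + j = m then Polynomial.coeff (Polynomial.coeff P j) i else 0)"
    unfolding by_degree_def bsubst_def by_degree_term
    by (simp add: coeff_sum if_distrib[of "\<lambda>p. Polynomial.coeff p _"] * cong: if_cong)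
  also have "\<dots> = (\<Sum>j\<le>Polynomial.degree P. if j = m - i then
      (if i \<le> m then Polynomial.coeff (Polynomial.coeff P (m - i)) i else 0) else 0)"
    by (intro sum.cong) auto
  also have "\<dots> = (if i \<le> m then Polynomial.coeff (Polynomial.coeff P (m - i)) i else 0)"
    by (auto simp: coeff_eq_0)
  finally show ?thesis .
qed

lemma homog_by_degree:
  "homog (int n) P \<longleftrightarrow> (\<forall>m. m \<noteq> n \<longrightarrow> Polynomial.coeff (by_degree P) m = 0)"
proof
  assume "homog (int n) P"
  then have "Polynomial.coeff (Polynomial.coeff (by_degree P) m) i = 0" if "m \<noteq> n" for m i
    using that unfolding coeff_by_degree homog_def
    by (metis le_add_diff_inverse of_nat_add of_nat_eq_iff)
  then show "\<forall>m. m \<noteq> n \<longrightarrow> Polynomial.coeff (by_degree P) m = 0"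
    by (simp add: poly_eq_iff)
next
  assume *: "\<forall>m. m \<noteq> n \<longrightarrow> Polynomial.coeff (by_degree P) m = 0"
  show "homog (int n) P"
    unfolding homog_def
  proof (intro allI impI)
    fix i j assume "Polynomial.coeff (Polynomial.coeff P j) i \<noteq> 0"
    then have "Polynomial.coeff (Polynomial.coeff (by_degree P) (i + j)) i \<noteq> 0"
      by (simp add: coeff_by_degree)
    with * show "int i + int j = int n"
      by (metis coeff_0 of_nat_add)
  qed
qed

text \<open>
  Factors of forms are forms: after the substitution \<open>P(xy, y)\<close> this says that a factor of a
  monomial in \<open>y\<close> is a monomial, because its order of vanishing at \<open>y = 0\<close> and its degree both add
  up under multiplication and agree for the product.
\<close>

lemma homog_factor:
  assumes "homog k (P * Q)" "P * Q \<noteq> 0"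
  shows "\<exists>l. homog l P"
proof -
  obtain n where k: "k = int n"
    using homog_nonneg[OF assms] zero_le_imp_eq_int by blast
  let ?R = "by_degree P" and ?S = "by_degree Q"
  have RS: "Polynomial.coeff (?R * ?S) m = 0" if "m \<noteq> n" for m
    using assms(1) that unfolding k homog_by_degree by_degree_mult by blast
  have "by_degree W = 0 \<Longrightarrow> W = 0" for W
    by (intro poly_eqI, metis coeff_0 coeff_by_degree diff_add_inverse le_add1)
  then have nz: "?R * ?S \<noteq> 0"
    using assms(2) by_degree_mult by metis
  have "Polynomial.degree (?R * ?S) \<le> n"
    using RS by (intro degree_le) auto
  moreover have "n \<le> Polynomial.order 0 (?R * ?S)"
    using RS nz by (subst monom_1_dvd_iff[symmetric]) (auto simp: monom_1_dvd_iff')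
  moreover have "Polynomial.order 0 ?R \<le> Polynomial.degree ?R" "Polynomial.order 0 ?S \<le> Polynomial.degree ?S"
    using nz by (auto intro!: order_degree)
  ultimately have "Polynomial.order 0 ?R = Polynomial.degree ?R"
    using nz by (simp add: order_mult degree_mult_eq)
  then have "Polynomial.coeff ?R m = 0" if "m < Polynomial.degree ?R" for m
    using that nz monom_1_dvd_iff[of ?R "Polynomial.degree ?R"] by (auto simp: monom_1_dvd_iff')
  then have "homog (int (Polynomial.degree ?R)) P"
    unfolding homog_by_degree by (metis coeff_eq_0 linorder_neqE_nat)
  then show ?thesis ..
qed

lemma homog_dvd: "homog k P \<Longrightarrow> P \<noteq> 0 \<Longrightarrow> Q dvd P \<Longrightarrow> \<exists>l. homog l Q"
  using homog_factor by (metis dvd_def)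

lemma homog_cofactor:
  assumes "homog (k + l) (P * Q)" "homog k P" "P \<noteq> 0"
  shows "homog l Q"
proof (cases "Q = 0")
  case False
  then obtain m where m: "homog m Q"
    using homog_factor[of "k + l" Q P] assms by (auto simp: mult.commute)
  have "k + m = k + l"
    by (rule homog_unique[OF homog_mult[OF assms(2) m] assms(1)]) (use assms False in auto)
  with m show ?thesis by simp
qed simp

section \<open>Zeros of forms\<close>

lemma homog_0_const:
  assumes "homog 0 P"
  obtains c where "P = bconst c"
proof
  show "P = bconst (Polynomial.coeff (Polynomial.coeff P 0) 0)"
  proof (intro poly_eqI)
    fix j i
    show "Polynomial.coeff (Polynomial.coeff P j) i =
        Polynomial.coeff (Polynomial.coeff (bconst (Polynomial.coeff (Polynomial.coeff P 0) 0)) j) i"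
      using assms by (cases j; cases i) (force simp: homog_def bconst_def)+
  qed
qed

lemma is_unit_bconst: "c \<noteq> 0 \<Longrightarrow> is_unit (bconst c)"
  by (simp add: bconst_def is_unit_const_poly_iff dvd_field_iff)

lemma poly_poly_eq_ev: "poly (poly P q) x = ev P x (poly q x)"
  by (simp add: ev_def poly_altdef[of P] poly_sum)

text \<open>
  On the line \<open>y = 1\<close> the form is a polynomial without zeros, so a constant \<open>c\<close> by the fundamental
  theorem of algebra. Then the form is \<open>c y\<^sup>n\<close>, which vanishes at \<open>(1, 0)\<close> unless \<open>n = 0\<close>.
\<close>

lemma form_without_zeros_degree:
  assumes "homog k P" and nz: "\<And>x y. (x, y) \<noteq> (0, 0) \<Longrightarrow> ev P x y \<noteq> 0"
  shows "k = 0"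
proof -
  have "P \<noteq> 0"
    using nz[of 1 0] by auto
  then obtain n where k: "k = int n"
    using homog_nonneg[OF assms(1)] zero_le_imp_eq_int by blast
  have "constant (poly (poly P [:1:]))"
    using fundamental_theorem_of_algebra[of "poly P [:1:]"] nz[of _ 1] by (auto simp: ev_def)
  then obtain c where c: "\<And>x. ev P x 1 = c"
    unfolding constant_def ev_def by blast
  \<comment> \<open>scaling determines the form only off the line \<open>y = 0\<close>; the factor \<open>bvy\<close> makes up for this\<close>
  have "bvy * P = bvy * (bconst c * bvy ^ n)"
  proof (rule bipoly_eqI)
    fix x y
    show "ev (bvy * P) x y = ev (bvy * (bconst c * bvy ^ n)) x y"
    proof (cases "y = 0")
      case False
      then have "ev P x y = y ^ n * ev P (x / y) 1"
        using homog_ev_scale[OF assms(1)[unfolded k], of y "x / y" 1] by simp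
      then show ?thesis
        by (simp add: c)
    qed simp
  qed
  moreover have "bvy \<noteq> 0"
    by (simp add: bvy_def)
  ultimately have "P = bconst c * bvy ^ n"
    by simp
  then have "ev P 1 0 = c * 0 ^ n"
    by simp
  with nz[of 1 0] have "n = 0"
    by (cases n) auto
  with k show ?thesis by simp
qed

definition line_through :: "complex \<Rightarrow> complex \<Rightarrow> bipoly" where
  "line_through a b = bconst b * bvx - bconst a * bvy"

lemma ev_line_through [simp]: "ev (line_through a b) x y = b * x - a * y"
  by (simp add: line_through_def)

lemma line_through_dvd:
  assumes P: "homog k P" and ab: "(a, b) \<noteq> (0, 0)" and z: "ev P a b = 0"
  shows "line_through a b dvd P"
proof (cases "P = 0")
  case False
  then obtain n where k: "k = int n"
    using homog_nonneg[OF P] zero_le_imp_eq_int by blast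
  show ?thesis
  proof (cases "a = 0")
    case a: False
    have "poly P [:0, b / a:] = 0"
    proof (rule poly_eq_poly_eq_iff[THEN iffD1])
      show "poly (poly P [:0, b / a:]) = poly 0"
        using homog_ev_scale[OF P[unfolded k], of "_ / a" a b] a z
        by (auto simp: poly_poly_eq_ev)
    qed
    then have "[:- [:0, b / a:], 1:] dvd P"
      by (simp add: poly_eq_0_iff_dvd)
    moreover have "line_through a b = bconst (- a) * [:- [:0, b / a:], 1:]"
      using a by (simp add: line_through_def bconst_def bvx_def bvy_def)
    ultimately show ?thesis
      using is_unit_bconst[of "- a"] a by (simp only: mult_unit_dvd_iff' neg_equal_0_iff_equal not_False_eq_True)
  next
    case True
    with ab have b: "b \<noteq> 0" by simp
    have 1: "Polynomial.coeff (Polynomial.coeff P j) 0 = 0" if "j \<noteq> n" for j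
      using P that unfolding k homog_def by fastforce
    have "ev P a b = (\<Sum>j\<le>Polynomial.degree P. Polynomial.coeff (Polynomial.coeff P j) 0 * b ^ j)"
      unfolding True ev_def by (subst poly_altdef[of P]) (simp add: poly_sum flip: poly_0_coeff_0)
    also have "\<dots> = (\<Sum>j\<le>Polynomial.degree P. if j = n then Polynomial.coeff (Polynomial.coeff P n) 0 * b ^ n else 0)"
      using 1 by (intro sum.cong) auto
    also have "\<dots> = Polynomial.coeff (Polynomial.coeff P n) 0 * b ^ n"
      by (auto simp: coeff_eq_0)
    finally have "Polynomial.coeff (Polynomial.coeff P n) 0 = 0"
      using b z by simp
    with 1 have "poly (Polynomial.coeff P j) 0 = 0" for j
      by (cases "j = n") (auto simp: poly_0_coeff_0)
    then have "bvx dvd P"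
      unfolding bvx_def const_poly_dvd_iff by (auto simp: poly_eq_0_iff_dvd)
    moreover have "line_through a b = bconst b * bvx"
      by (simp add: line_through_def True bconst_def)
    ultimately show ?thesis
      using is_unit_bconst[of b] b by (simp add: mult_unit_dvd_iff')
  qed
qed simp

text \<open>
  A common factor of two forms is a form, and it cannot have zeros other than the origin.
\<close>

lemma no_common_zero_coprime:
  assumes "homog k p" "p \<noteq> 0" "\<And>x y. (x, y) \<noteq> (0, 0) \<Longrightarrow> ev p x y \<noteq> 0 \<or> ev q x y \<noteq> 0"
  shows "coprime p q"
proof (rule coprimeI)
  fix c assume c: "c dvd p" "c dvd q"
  then obtain l where l: "homog l c"
    using homog_dvd assms by blast
  have "ev c x y \<noteq> 0" if "(x, y) \<noteq> (0, 0)" for x y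
    using assms(3)[OF that] c by (auto elim!: dvdE)
  then have "l = 0"
    using form_without_zeros_degree[OF l] by blast
  with l obtain z where z: "c = bconst z"
    using homog_0_const by blast
  with c \<open>p \<noteq> 0\<close> have "z \<noteq> 0"
    by (auto simp: bconst_def)
  then show "is_unit c"
    using z is_unit_bconst by blast
qed

abbreviation cubA :: bipoly where
  "cubA \<equiv> bvx ^ 3 + bvy ^ 3"

lemma homog_cubA: "homog 3 cubA"
  using homog_power[OF homog_x, of 3] homog_power[OF homog_y, of 3] by (auto intro: homog_add)

text \<open>
  The linear factors of \<open>x\<^sup>3 + y\<^sup>3\<close> are simple. The factor \<open>b\<^sup>3\<close> clears denominators in
  \<open>b\<^sup>3 (x\<^sup>3 + y\<^sup>3) = (bx)\<^sup>3 - (ay)\<^sup>3\<close>, which holds since \<open>a\<^sup>3 = -b\<^sup>3\<close>.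
\<close>

lemma cubA_simple_zero:
  assumes "ev cubA a b = 0" "(a, b) \<noteq> (0, 0)"
  obtains B where "bconst (b ^ 3) * cubA = line_through a b * B" "ev B a b \<noteq> 0"
proof
  let ?B = "bconst (b ^ 2) * bvx ^ 2 + bconst (a * b) * (bvx * bvy) + bconst (a ^ 2) * bvy ^ 2"
  have *: "a ^ 3 + b ^ 3 = 0" using assms by simp
  have **: "a \<noteq> 0" "b \<noteq> 0" using * assms(2) by auto
  then show "ev ?B a b \<noteq> 0"
    by (simp add: power2_eq_square)
  show "bconst (b ^ 3) * cubA = line_through a b * ?B"
  proof (rule bipoly_eqI)
    fix x y
    have "b ^ 3 * (x ^ 3 + y ^ 3) = (b * x - a * y) * (b ^ 2 * x ^ 2 + a * b * (x * y) + a ^ 2 * y ^ 2)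
         + (a ^ 3 + b ^ 3) * y ^ 3"
      by (simp add: power2_eq_square power3_eq_cube algebra_simps)
    with * show "ev (bconst (b ^ 3) * cubA) x y = ev (line_through a b * ?B) x y"
      by simp
  qed
qed

text \<open>
  The polynomial \<open>x\<^sup>3 + y\<^sup>3\<close> vanishes to order exactly \<open>1\<close> at \<open>y = -x\<close>, whereas the order of a cube
  is divisible by \<open>3\<close>. So neither of the first two coordinates of a point is zero, which is why
  proportionality of points can always be tested against the first coordinate.
\<close>

lemma cubA_not_cube:
  fixes q r :: bipoly
  assumes eq: "q ^ 3 = cubA * r ^ 3"
  shows "r = 0"
proof (rule ccontr)
  assume r: "r \<noteq> 0"
  define a :: "complex poly" where "a = [:0, - 1:]"
  \<comment> \<open>the cofactor \<open>x\<^sup>2 - x y + y\<^sup>2\<close> of \<open>x + y\<close>\<close>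
  define B :: bipoly where "B = [:[:0, 0, 1:], [:0, - 1:], 1:]"
  have A: "cubA = [:- a, 1:] * B"
    by (simp add: a_def B_def bvx_def bvy_def power3_eq_cube)
  have "poly B a = [:0, 0, 3:]"
    by (simp add: B_def a_def)
  then have B: "Polynomial.order a B = 0" "B \<noteq> 0"
    by (auto simp: order_0I)
  then have "Polynomial.order a cubA = 1" "cubA \<noteq> 0"
    unfolding A using order_power_n_n[of a 1] by (auto simp: order_mult simp del: mult_pCons_left)
  moreover from this r eq have "q \<noteq> 0" by auto
  ultimately have "3 * Polynomial.order a q = 1 + 3 * Polynomial.order a r"
    using arg_cong[OF eq, of "Polynomial.order a"] r by (simp add: order_mult power3_eq_cube)
  then show False by presburger
qed

section \<open>Points and their primitive representatives\<close>

definition on_curve :: "int \<Rightarrow> bipoly \<Rightarrow> bipoly \<Rightarrow> bipoly \<Rightarrow> bool" where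
  "on_curve k p q r \<longleftrightarrow> homog k p \<and> homog k q \<and> homog (k - 1) r \<and> p \<noteq> 0 \<and> q \<noteq> 0 \<and>
     p ^ 3 + q ^ 3 = cubA * r ^ 3"

lemma on_curveD:
  assumes "on_curve k p q r"
  shows "homog k p" "homog k q" "homog (k - 1) r" "p \<noteq> 0" "q \<noteq> 0" "p ^ 3 + q ^ 3 = cubA * r ^ 3"
  using assms by (auto simp: on_curve_def)

lemma on_curve_minus: "on_curve k p q r \<Longrightarrow> on_curve k q p r"
  by (auto simp: on_curve_def add.commute)

text \<open>
  The degree condition is automatic when \<open>r = 0\<close>, since then \<open>p\<^sup>3 = - q\<^sup>3\<close>; this makes the
  description by one degree \<open>k\<close> uniform.
\<close>

lemma V_triples_iff: "(p, q, r) \<in> V_triples \<longleftrightarrow> (\<exists>k. on_curve k p q r)"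
proof
  assume *: "(p, q, r) \<in> V_triples"
  then have eq: "p ^ 3 + q ^ 3 = cubA * r ^ 3" and nz: "(p, q, r) \<noteq> (0, 0, 0)"
    unfolding V_triples_def by blast+
  have "q = 0 \<and> r = 0" if "p = 0"
    using cubA_not_cube[of q r] eq that by (metis add.left_neutral mult_zero_right power_eq_0_iff zero_power zero_less_numeral)
  moreover have "p = 0 \<and> r = 0" if "q = 0"
    using cubA_not_cube[of p r] eq that by (metis add.right_neutral mult_zero_right power_eq_0_iff zero_power zero_less_numeral)
  ultimately have pq: "p \<noteq> 0 \<and> q \<noteq> 0"
    using nz by blast
  show "\<exists>k. on_curve k p q r"
  proof (cases "r = 0")
    case False
    with * obtain n where "homogeneous n r" "homogeneous (n + 1) p" "homogeneous (n + 1) q"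
      by (auto simp: V_triples_def)
    with eq pq show ?thesis
      unfolding on_curve_def homog_iff[symmetric] by (intro exI[of _ "int n + 1"]) (simp add: add.commute)
  next
    case True
    obtain k l where kl: "homog k p" "homog l q"
      using * unfolding V_triples_def is_form_iff by blast
    have "p ^ 3 = - (q ^ 3)"
      using eq True by (simp add: eq_neg_iff_add_eq_0)
    then have "3 * k = 3 * l"
      using homog_power[OF kl(1), of 3] homog_minus[OF homog_power[OF kl(2), of 3]] pq
      by (intro homog_unique[of _ "p ^ 3"]) auto
    with kl eq pq True show ?thesis
      by (auto simp: on_curve_def)
  qed
next
  assume "\<exists>k. on_curve k p q r"
  then obtain k where k: "on_curve k p q r" by blast
  then have "\<exists>n. homogeneous n r \<and> homogeneous (n + 1) p \<and> homogeneous (n + 1) q" if "r \<noteq> 0"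
    using homog_nonneg[OF _ that, of "k - 1"] that unfolding on_curve_def homog_iff[symmetric]
    by (intro exI[of _ "nat (k - 1)"]) simp
  with k show "(p, q, r) \<in> V_triples"
    by (auto simp: V_triples_def is_form_iff on_curve_def)
qed

text \<open>
  Two minors suffice: the third one follows after multiplication by \<open>p\<close>, which is never zero on the
  curve.
\<close>

definition same_pt :: "bipoly \<Rightarrow> bipoly \<Rightarrow> bipoly \<Rightarrow> bipoly \<Rightarrow> bipoly \<Rightarrow> bipoly \<Rightarrow> bool" where
  "same_pt p q r p' q' r' \<longleftrightarrow> p * q' = p' * q \<and> p * r' = p' * r"

lemma V_rel_iff:
  "((p, q, r), (p', q', r')) \<in> V_rel \<longleftrightarrow>
     (p, q, r) \<in> V_triples \<and> (p', q', r') \<in> V_triples \<and> same_pt p q r p' q' r'"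
proof (intro iffI conjI)
  assume *: "((p, q, r), (p', q', r')) \<in> V_rel"
  then show "(p, q, r) \<in> V_triples" "(p', q', r') \<in> V_triples"
    by (simp_all add: V_rel_def)
  from * obtain a b where ab: "a \<noteq> 0" "b \<noteq> 0" "b * p' = a * p" "b * q' = a * q" "b * r' = a * r"
    by (auto simp: V_rel_def)
  have "b * (p * q') = b * (p' * q)"
    unfolding mult.left_commute[of b p] ab(4) unfolding mult.assoc[symmetric] ab(3) by (simp add: mult.commute)
  moreover have "b * (p * r') = b * (p' * r)"
    unfolding mult.left_commute[of b p] ab(5) unfolding mult.assoc[symmetric] ab(3) by (simp add: mult.commute)
  ultimately show "same_pt p q r p' q' r'"
    using ab by (simp add: same_pt_def)
next
  assume *: "(p, q, r) \<in> V_triples \<and> (p', q', r') \<in> V_triples \<and> same_pt p q r p' q' r'"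
  then obtain k k' where "on_curve k p q r" "on_curve k' p' q' r'"
    unfolding V_triples_iff by blast
  then have "is_form p' \<and> p' \<noteq> 0 \<and> is_form p \<and> p \<noteq> 0 \<and> p * p' = p' * p \<and> p * q' = p' * q \<and> p * r' = p' * r"
    using * unfolding on_curve_def is_form_iff same_pt_def by (auto simp: mult.commute)
  with * show "((p, q, r), (p', q', r')) \<in> V_rel"
    unfolding V_rel_def by blast
qed

lemma same_pt_refl [simp]: "same_pt p q r p q r"
  by (simp add: same_pt_def)

lemma same_pt_sym: "same_pt p q r p' q' r' \<Longrightarrow> same_pt p' q' r' p q r"
  by (simp add: same_pt_def)

lemma same_pt_trans:
  assumes "same_pt p q r p' q' r'" "same_pt p' q' r' p'' q'' r''" "p' \<noteq> 0"
  shows "same_pt p q r p'' q'' r''"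
proof -
  have "p' * (p * z'') = p' * (p'' * z)" if "p * z' = p' * z" "p' * z'' = p'' * z'" for z z' z''
    using that by (metis mult.left_commute)
  then have "p' * (p * q'') = p' * (p'' * q)" "p' * (p * r'') = p' * (p'' * r)"
    using assms(1,2) unfolding same_pt_def by blast+
  with \<open>p' \<noteq> 0\<close> show ?thesis
    by (simp add: same_pt_def)
qed

lemma equiv_V_rel: "equiv V_triples V_rel"
proof (rule equivI)
  show "V_rel \<subseteq> V_triples \<times> V_triples"
    by (auto simp: V_rel_def)
  show "refl_on V_triples V_rel"
    unfolding refl_on_def by (auto simp: V_rel_iff)
  show "sym V_rel"
    unfolding sym_def by (auto simp: V_rel_iff same_pt_sym)
  show "trans V_rel"
  proof (rule transI, clarify)
    fix p q r p' q' r' p'' q'' r''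
    assume *: "((p, q, r), (p', q', r')) \<in> V_rel" "((p', q', r'), (p'', q'', r'')) \<in> V_rel"
    then have "p' \<noteq> 0"
      unfolding V_rel_iff V_triples_iff on_curve_def by blast
    with * show "((p, q, r), (p'', q'', r'')) \<in> V_rel"
      unfolding V_rel_iff using same_pt_trans by blast
  qed
qed

lemma pt_in_V: "on_curve k p q r \<Longrightarrow> pt p q r \<in> V"
  unfolding V_def pt_def by (rule quotientI) (auto simp: V_triples_iff)

lemma pt_eq_iff:
  assumes "on_curve k p q r" "on_curve k' p' q' r'"
  shows "pt p q r = pt p' q' r' \<longleftrightarrow> same_pt p q r p' q' r'"
proof -
  have "(p, q, r) \<in> V_triples" "(p', q', r') \<in> V_triples"
    using assms V_triples_iff by blast+
  then show ?thesis
    unfolding pt_def using eq_equiv_class_iff[OF equiv_V_rel] by (simp add: V_rel_iff)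
qed

lemma in_pt_iff:
  assumes "on_curve k p q r"
  shows "(p', q', r') \<in> pt p q r \<longleftrightarrow> (\<exists>k'. on_curve k' p' q' r') \<and> same_pt p q r p' q' r'"
  using assms V_triples_iff[of p q r] by (auto simp: pt_def V_rel_iff V_triples_iff)

lemma V_E:
  assumes "v \<in> V"
  obtains k p q r where "on_curve k p q r" "v = pt p q r"
  using assms unfolding V_def pt_def by (metis V_triples_iff prod_cases3 quotientE)

text \<open>
  For points this is the same as being normalized. Freedom from common zeros is the form of the
  condition that can be evaluated at places and that is stable under composition.
\<close>

definition primitive :: "int \<Rightarrow> bipoly \<Rightarrow> bipoly \<Rightarrow> bipoly \<Rightarrow> bool" where
  "primitive k p q r \<longleftrightarrow> on_curve k p q r \<and>
     (\<forall>x y. (x, y) \<noteq> (0, 0) \<longrightarrow> ev p x y \<noteq> 0 \<or> ev q x y \<noteq> 0)"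

lemma primitive_on_curve: "primitive k p q r \<Longrightarrow> on_curve k p q r"
  by (simp add: primitive_def)

lemma primitive_coprime: "primitive k p q r \<Longrightarrow> coprime p q"
  unfolding primitive_def on_curve_def by (intro no_common_zero_coprime) auto

lemma primitive_normalized: "primitive k p q r \<Longrightarrow> normalized (p, q, r)"
  using primitive_coprime unfolding normalized_def by (auto simp: coprime_def)

text \<open>
  If \<open>p\<close> and \<open>q\<close> vanish along a line, then so does \<open>r\<close>: the cube of the linear form divides
  \<open>(x\<^sup>3 + y\<^sup>3) r\<^sup>3\<close>, and at most one of the three factors is taken up by \<open>x\<^sup>3 + y\<^sup>3\<close>.
\<close>

lemma normalized_primitive:
  assumes c: "on_curve k p q r" and n: "normalized (p, q, r)"
  shows "primitive k p q r"
  unfolding primitive_def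
proof (intro conjI allI impI c, rule ccontr)
  note c = on_curveD[OF c]
  fix a b :: complex
  assume ab: "(a, b) \<noteq> (0, 0)" and "\<not> (ev p a b \<noteq> 0 \<or> ev q a b \<noteq> 0)"
  then have z: "ev p a b = 0" "ev q a b = 0" by auto
  let ?l = "line_through a b"
  obtain p1 q1 where pq: "p = ?l * p1" "q = ?l * q1"
    using line_through_dvd[OF c(1) ab z(1)] line_through_dvd[OF c(2) ab z(2)] by (auto elim!: dvdE)
  then have l0: "?l \<noteq> 0"
    using c by auto
  have eq: "?l ^ 3 * (p1 ^ 3 + q1 ^ 3) = cubA * r ^ 3"
    using c(6) unfolding pq by (simp add: power_mult_distrib ring_distribs)
  have "ev r a b = 0"
  proof (cases "ev cubA a b = 0")
    case False
    have "ev (?l ^ 3 * (p1 ^ 3 + q1 ^ 3)) a b = ev (cubA * r ^ 3) a b"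
      unfolding eq ..
    with False show ?thesis by simp
  next
    case True
    \<comment> \<open>one linear factor cancels against \<open>cubA\<close>, two remain\<close>
    then obtain B where B: "bconst (b ^ 3) * cubA = ?l * B" "ev B a b \<noteq> 0"
      using cubA_simple_zero ab by metis
    have "?l * (?l ^ 2 * (p1 ^ 3 + q1 ^ 3) * bconst (b ^ 3)) = bconst (b ^ 3) * (?l ^ 3 * (p1 ^ 3 + q1 ^ 3))"
      by (simp add: power2_eq_square power3_eq_cube ac_simps)
    also have "\<dots> = ?l * (B * r ^ 3)"
      unfolding eq using B(1) by (simp only: mult.assoc[symmetric])
    finally have "?l ^ 2 * (p1 ^ 3 + q1 ^ 3) * bconst (b ^ 3) = B * r ^ 3"
      using l0 by simp
    then have "ev (?l ^ 2 * (p1 ^ 3 + q1 ^ 3) * bconst (b ^ 3)) a b = ev (B * r ^ 3) a b"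
      by simp
    with B(2) show ?thesis by simp
  qed
  then have "?l dvd r"
    using line_through_dvd c(3) ab by blast
  with pq n have "is_unit ?l"
    unfolding normalized_def by auto
  then obtain s where "1 = ?l * s"
    by (auto elim: dvdE)
  then have "ev 1 a b = ev (?l * s) a b"
    by simp
  then show False by simp
qed

lemma primitive_exists:
  assumes "on_curve k p q r"
  shows "\<exists>k' p' q' r'. primitive k' p' q' r' \<and> same_pt p q r p' q' r'"
proof -
  note c = on_curveD[OF assms]
  define g where "g = gcd p (gcd q r)"
  have g0: "g \<noteq> 0"
    using c by (simp add: g_def)
  obtain p' q' r' where pqr: "p = g * p'" "q = g * q'" "r = g * r'"
    unfolding g_def by (meson dvdE dvd_trans gcd_dvd1 gcd_dvd2)
  obtain l where l: "homog l g"
    using homog_dvd[OF c(1,4), of g] pqr(1) by (metis dvd_triv_left)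
  have "homog (k - l) p'" "homog (k - l) q'" "homog (k - l - 1) r'"
    using homog_cofactor[of l _ g] c(1-3) l g0 pqr by (auto simp: algebra_simps)
  moreover have "g ^ 3 * (p' ^ 3 + q' ^ 3) = g ^ 3 * (cubA * r' ^ 3)"
    using c(6) unfolding pqr by (simp add: power_mult_distrib algebra_simps)
  then have "p' ^ 3 + q' ^ 3 = cubA * r' ^ 3"
    using g0 by simp
  ultimately have "on_curve (k - l) p' q' r'"
    using c(4,5) pqr by (auto simp: on_curve_def)
  moreover have "normalized (p', q', r')"
    unfolding normalized_def
  proof (clarify)
    fix s assume "s dvd p'" "s dvd q'" "s dvd r'"
    then have "g * s dvd g"
      by (subst (2) g_def) (simp add: pqr mult_dvd_mono)
    with g0 show "is_unit s"
      by simp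
  qed
  moreover have "same_pt p q r p' q' r'"
    by (simp add: same_pt_def pqr)
  ultimately show ?thesis
    using normalized_primitive by blast
qed

text \<open>
  Proportional primitive representatives divide each other, so the degree does not depend on the
  choice of the representative.
\<close>

lemma primitive_degree_le:
  assumes "primitive k p q r" "primitive l p' q' r'" "same_pt p q r p' q' r'"
  shows "k \<le> l"
proof -
  note c = on_curveD[OF primitive_on_curve[OF assms(1)]] and c' = on_curveD[OF primitive_on_curve[OF assms(2)]]
  have "p dvd p' * q"
    using assms(3) by (metis dvd_triv_left same_pt_def)
  then have "p dvd p'"
    using primitive_coprime[OF assms(1)] by (simp add: coprime_dvd_mult_left_iff)
  then obtain s where s: "p' = p * s" ..
  with c' have "homog (k + (l - k)) (p * s)" "s \<noteq> 0" by auto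
  from homog_nonneg[OF homog_cofactor[OF this(1) c(1,4)] this(2)] show ?thesis
    by simp
qed

text \<open>
  All arguments about a single point start from here: the representative chosen by \<open>rep\<close> is
  primitive of degree \<open>d v\<close>.
\<close>

lemma V_repE:
  assumes "v \<in> V"
  obtains p q r where "primitive (int (d v)) p q r" "v = pt p q r" "rep v = (p, q, r)"
proof -
  obtain k0 p0 q0 r0 where v: "on_curve k0 p0 q0 r0" "v = pt p0 q0 r0"
    using V_E assms by blast
  obtain p q r where rep: "rep v = (p, q, r)"
    using prod_cases3 by blast
  have "\<exists>t. t \<in> v \<and> normalized t"
    using primitive_exists[OF v(1)] in_pt_iff[OF v(1)] primitive_normalized primitive_on_curve v(2) by blast
  then have "rep v \<in> v \<and> normalized (rep v)"
    unfolding rep_def by (rule someI_ex)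
  then obtain k where k: "on_curve k p q r" "same_pt p0 q0 r0 p q r" and n: "normalized (p, q, r)"
    using in_pt_iff[OF v(1), of p q r] rep v(2) by auto
  have "primitive k p q r"
    using k n normalized_primitive by blast
  moreover have "int (d v) = k"
    using on_curveD(1,4)[OF k(1)] by (simp add: d_def rep form_degree_eq)
  moreover have "v = pt p q r"
    using pt_eq_iff[OF v(1) k(1)] k(2) v(2) by simp
  ultimately show thesis
    using that rep by blast
qed

lemma d_pt:
  assumes "primitive k p q r"
  shows "int (d (pt p q r)) = k"
proof -
  note c = primitive_on_curve[OF assms]
  obtain p' q' r' where *: "primitive (int (d (pt p q r))) p' q' r'" "pt p q r = pt p' q' r'"
    using V_repE[OF pt_in_V[OF c]] by metis
  then have "same_pt p q r p' q' r'"
    using pt_eq_iff[OF c primitive_on_curve] by blast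
  then show ?thesis
    using primitive_degree_le[OF assms *(1)] primitive_degree_le[OF *(1) assms] same_pt_sym
    by (simp add: order_antisym)
qed

section \<open>Addition laws on a twisted Fermat cubic\<close>

text \<open>
  The cubic \<open>X\<^sup>3 + Y\<^sup>3 = A Z\<^sup>3\<close> is a twisted Hessian curve. For points \<open>v = (p, q, r)\<close> and
  \<open>w = (a, b, c)\<close> the entries of the \<open>3 \<times> 3\<close> matrix \<open>law_rows\<close>, with rows and columns labelled by
  the coordinates, are bihomogeneous of bidegree \<open>(2, 2)\<close>; the letters in a name give the row and
  the column. The remaining entries come from these four by the symmetries \<open>p \<leftrightarrow> q\<close> and \<open>a \<leftrightarrow> b\<close>, which
  are the negations of the two points. The first row is the standard addition law, the last one
  is the rotated addition law, and the matrix represents \<open>(v - w) \<otimes> (v + w)\<close>.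
\<close>

definition law_RR :: "'a::comm_ring_1 \<Rightarrow> 'a \<Rightarrow> 'a \<Rightarrow> 'a \<Rightarrow> 'a \<Rightarrow> 'a \<Rightarrow> 'a" where
  "law_RR p q r a b c = r ^ 2 * a * b - c ^ 2 * p * q"

definition law_RP :: "'a::comm_ring_1 \<Rightarrow> 'a \<Rightarrow> 'a \<Rightarrow> 'a \<Rightarrow> 'a \<Rightarrow> 'a \<Rightarrow> 'a" where
  "law_RP p q r a b c = q ^ 2 * c * a - b ^ 2 * r * p"

definition law_PP :: "'a::comm_ring_1 \<Rightarrow> 'a \<Rightarrow> 'a \<Rightarrow> 'a \<Rightarrow> 'a \<Rightarrow> 'a \<Rightarrow> 'a \<Rightarrow> 'a" where
  "law_PP A p q r a b c = A * c ^ 2 * r * q + p ^ 2 * a * b"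

definition law_PQ :: "'a::comm_ring_1 \<Rightarrow> 'a \<Rightarrow> 'a \<Rightarrow> 'a \<Rightarrow> 'a \<Rightarrow> 'a \<Rightarrow> 'a \<Rightarrow> 'a" where
  "law_PQ A p q r a b c = - (b ^ 2 * p * q + A * r ^ 2 * c * a)"

text \<open>
  The value \<open>F(v, w, w)\<close> of the symmetric trilinear form belonging to the cubic form
  \<open>F = X\<^sup>3 + Y\<^sup>3 - A Z\<^sup>3\<close>.
\<close>

definition polar :: "'a::comm_ring_1 \<Rightarrow> 'a \<Rightarrow> 'a \<Rightarrow> 'a \<Rightarrow> 'a \<Rightarrow> 'a \<Rightarrow> 'a \<Rightarrow> 'a" where
  "polar A p q r a b c = p * a ^ 2 + q * b ^ 2 - A * r * c ^ 2"

definition law_rows :: "'a::comm_ring_1 \<Rightarrow> 'a \<Rightarrow> 'a \<Rightarrow> 'a \<Rightarrow> 'a \<Rightarrow> 'a \<Rightarrow> 'a \<Rightarrow> ('a \<times> 'a \<times> 'a) set" where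
  "law_rows A p q r a b c =
    {(law_RP p q r a b c, law_RP q p r b a c, law_RR p q r a b c),
     (law_PP A p q r a b c, law_PQ A p q r a b c, law_RP p q r b a c),
     (law_PQ A p q r b a c, law_PP A q p r b a c, law_RP q p r a b c)}"

lemmas law_defs = law_RR_def law_RP_def law_PP_def law_PQ_def polar_def

lemma law_swap:
  "law_RR q p r b a c = law_RR p q r a b c"
  "law_RR p q r b a c = law_RR p q r a b c"
  "law_PP A p q r b a c = law_PP A p q r a b c"
  "law_PQ A q p r b a c = law_PQ A p q r b a c"
  by (simp_all add: law_defs mult_ac add_ac)

text \<open>
  Each identity in this locale holds modulo the two curve equations. The multipliers of the
  equations are the quotients of the division by \<open>q\<^sup>3\<close> and \<open>b\<^sup>3\<close>. The minors are named by their
  two rows and their two columns; those listed here yield all others by symmetry.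
\<close>

locale two_points =
  fixes A p q r a b c :: "'a::comm_ring_1"
  assumes curve: "p ^ 3 + q ^ 3 = A * r ^ 3" "a ^ 3 + b ^ 3 = A * c ^ 3"
begin

lemma minor_RP_RP:
  "law_RR p q r a b c * law_PP A p q r a b c = law_RP p q r a b c * law_RP p q r b a c"
proof -
  have "law_RR p q r a b c * law_PP A p q r a b c - (law_RP p q r a b c * law_RP p q r b a c) =
      (- (q * a * b * c ^ 2)) * (p ^ 3 + q ^ 3 - A * r ^ 3) + (p * q ^ 2 * r * c) * (a ^ 3 + b ^ 3 - A * c ^ 3)"
    by (simp add: law_defs algebra_simps eval_nat_numeral)
  then show ?thesis
    by (simp add: curve)
qed

lemma minor_RP_RQ:
  "law_RR p q r a b c * law_PQ A p q r a b c = law_RP q p r b a c * law_RP p q r b a c"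
proof -
  have "law_RR p q r a b c * law_PQ A p q r a b c - (law_RP q p r b a c * law_RP p q r b a c) =
      (r * a ^ 2 * b * c) * (p ^ 3 + q ^ 3 - A * r ^ 3) + (- (p * q * r ^ 2 * a)) * (a ^ 3 + b ^ 3 - A * c ^ 3)"
    by (simp add: law_defs algebra_simps eval_nat_numeral)
  then show ?thesis
    by (simp add: curve)
qed

lemma minor_RP_PQ:
  "law_RP p q r a b c * law_PQ A p q r a b c = law_RP q p r b a c * law_PP A p q r a b c"
proof -
  have "law_RP p q r a b c * law_PQ A p q r a b c - (law_RP q p r b a c * law_PP A p q r a b c) =
      (- (p * a * b ^ 2 * c)) * (p ^ 3 + q ^ 3 - A * r ^ 3) + (p ^ 2 * q * r * b) * (a ^ 3 + b ^ 3 - A * c ^ 3)"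
    by (simp add: law_defs algebra_simps eval_nat_numeral)
  then show ?thesis
    by (simp add: curve)
qed

lemma minor_PQ_PQ:
  "law_PP A p q r a b c * law_PP A q p r b a c = law_PQ A p q r a b c * law_PQ A p q r b a c"
proof -
  have "law_PP A p q r a b c * law_PP A q p r b a c - (law_PQ A p q r a b c * law_PQ A p q r b a c) =
      (A * r * a * b * c ^ 2) * (p ^ 3 + q ^ 3 - A * r ^ 3) + (- (A * p * q * r ^ 2 * c)) * (a ^ 3 + b ^ 3 - A * c ^ 3)"
    by (simp add: law_defs algebra_simps eval_nat_numeral)
  then show ?thesis
    by (simp add: curve)
qed

lemma row_R_curve:
  "(law_RP p q r a b c) ^ 3 + (law_RP q p r b a c) ^ 3 = A * (law_RR p q r a b c) ^ 3"
proof -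
  have "(law_RP p q r a b c) ^ 3 + (law_RP q p r b a c) ^ 3 - (A * (law_RR p q r a b c) ^ 3) =
      (A * p ^ 3 * c ^ 6 + A * r ^ 3 * a ^ 3 * c ^ 3 + q ^ 3 * a ^ 3 * c ^ 3 - p ^ 3 * a ^ 3 * c ^ 3 - 3 * p * q * r * a ^ 2 * b ^ 2 * c ^ 2 - r ^ 3 * a ^ 6) * (p ^ 3 + q ^ 3 - A * r ^ 3) + (p ^ 6 * c ^ 3 + p ^ 3 * r ^ 3 * a ^ 3 + 3 * p ^ 2 * q ^ 2 * r ^ 2 * a * b * c - A * p ^ 3 * r ^ 3 * c ^ 3 - A * r ^ 6 * a ^ 3 - p ^ 3 * r ^ 3 * b ^ 3) * (a ^ 3 + b ^ 3 - A * c ^ 3)"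
    by (simp add: law_defs algebra_simps eval_nat_numeral)
  then show ?thesis
    by (simp add: curve)
qed

lemma row_P_curve:
  "(law_PP A p q r a b c) ^ 3 + (law_PQ A p q r a b c) ^ 3 = A * (law_RP p q r b a c) ^ 3"
proof -
  have "(law_PP A p q r a b c) ^ 3 + (law_PQ A p q r a b c) ^ 3 - (A * (law_RP p q r b a c) ^ 3) =
      (A ^ 3 * r ^ 3 * c ^ 6 + A * p ^ 3 * b ^ 3 * c ^ 3 + 3 * A * p * q * r * a ^ 2 * b ^ 2 * c ^ 2 - A ^ 2 * r ^ 3 * b ^ 3 * c ^ 3 - A * q ^ 3 * b ^ 3 * c ^ 3 - p ^ 3 * b ^ 6) * (p ^ 3 + q ^ 3 - A * r ^ 3) + (A ^ 2 * p ^ 3 * r ^ 3 * c ^ 3 + A * p ^ 3 * r ^ 3 * a ^ 3 + p ^ 6 * b ^ 3 - A ^ 3 * r ^ 6 * c ^ 3 - A * p ^ 3 * r ^ 3 * b ^ 3 - 3 * A * p ^ 2 * q ^ 2 * r ^ 2 * a * b * c) * (a ^ 3 + b ^ 3 - A * c ^ 3)"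
    by (simp add: law_defs algebra_simps eval_nat_numeral)
  then show ?thesis
    by (simp add: curve)
qed

lemma chord_R_P:
  "(polar A p q r a b c * p - polar A a b c p q r * a) * law_RP p q r a b c = law_RP q p r b a c * (polar A p q r a b c * q - polar A a b c p q r * b)"
proof -
  have "(polar A p q r a b c * p - polar A a b c p q r * a) * law_RP p q r a b c - (law_RP q p r b a c * (polar A p q r a b c * q - polar A a b c p q r * b)) =
      (p * a * b ^ 2 * c - q * a ^ 2 * b * c) * (p ^ 3 + q ^ 3 - A * r ^ 3) + (p * q ^ 2 * r * a - p ^ 2 * q * r * b) * (a ^ 3 + b ^ 3 - A * c ^ 3)"
    by (simp add: law_defs algebra_simps eval_nat_numeral)
  then show ?thesis
    by (simp add: curve)
qed

lemma chord_R_R: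
  "(polar A p q r a b c * p - polar A a b c p q r * a) * law_RR p q r a b c = law_RP q p r b a c * (polar A p q r a b c * r - polar A a b c p q r * c)"
proof -
  have "(polar A p q r a b c * p - polar A a b c p q r * a) * law_RR p q r a b c - (law_RP q p r b a c * (polar A p q r a b c * r - polar A a b c p q r * c)) =
      (p * a * b * c ^ 2 - r * a ^ 2 * b * c) * (p ^ 3 + q ^ 3 - A * r ^ 3) + (p * q * r ^ 2 * a - p ^ 2 * q * r * c) * (a ^ 3 + b ^ 3 - A * c ^ 3)"
    by (simp add: law_defs algebra_simps eval_nat_numeral)
  then show ?thesis
    by (simp add: curve)
qed

lemma chord_P_P:
  "(polar A p q r a b c * p - polar A a b c p q r * a) * law_PP A p q r a b c = law_PQ A p q r a b c * (polar A p q r a b c * q - polar A a b c p q r * b)"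
proof -
  have "(polar A p q r a b c * p - polar A a b c p q r * a) * law_PP A p q r a b c - (law_PQ A p q r a b c * (polar A p q r a b c * q - polar A a b c p q r * b)) =
      (- (A * r * a * b * c ^ 2)) * (p ^ 3 + q ^ 3 - A * r ^ 3) + (A * p * q * r ^ 2 * c) * (a ^ 3 + b ^ 3 - A * c ^ 3)"
    by (simp add: law_defs algebra_simps eval_nat_numeral)
  then show ?thesis
    by (simp add: curve)
qed

lemma chord_P_R:
  "(polar A p q r a b c * p - polar A a b c p q r * a) * law_RP p q r b a c = law_PQ A p q r a b c * (polar A p q r a b c * r - polar A a b c p q r * c)"
proof -
  have "(polar A p q r a b c * p - polar A a b c p q r * a) * law_RP p q r b a c - (law_PQ A p q r a b c * (polar A p q r a b c * r - polar A a b c p q r * c)) =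
      (- (q * a * b ^ 2 * c)) * (p ^ 3 + q ^ 3 - A * r ^ 3) + (p * q ^ 2 * r * b) * (a ^ 3 + b ^ 3 - A * c ^ 3)"
    by (simp add: law_defs algebra_simps eval_nat_numeral)
  then show ?thesis
    by (simp add: curve)
qed

lemma chord_Q_P:
  "(polar A p q r a b c * p - polar A a b c p q r * a) * law_PQ A p q r b a c = law_PP A q p r b a c * (polar A p q r a b c * q - polar A a b c p q r * b)"
proof -
  have "(polar A p q r a b c * p - polar A a b c p q r * a) * law_PQ A p q r b a c - (law_PP A q p r b a c * (polar A p q r a b c * q - polar A a b c p q r * b)) =
      (A * r * a * b * c ^ 2) * (p ^ 3 + q ^ 3 - A * r ^ 3) + (- (A * p * q * r ^ 2 * c)) * (a ^ 3 + b ^ 3 - A * c ^ 3)"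
    by (simp add: law_defs algebra_simps eval_nat_numeral)
  then show ?thesis
    by (simp add: curve)
qed

lemma chord_Q_R:
  "(polar A p q r a b c * p - polar A a b c p q r * a) * law_RP q p r a b c = law_PP A q p r b a c * (polar A p q r a b c * r - polar A a b c p q r * c)"
proof -
  have "(polar A p q r a b c * p - polar A a b c p q r * a) * law_RP q p r a b c - (law_PP A q p r b a c * (polar A p q r a b c * r - polar A a b c p q r * c)) =
      (q * a * b ^ 2 * c) * (p ^ 3 + q ^ 3 - A * r ^ 3) + (- (p * q ^ 2 * r * b)) * (a ^ 3 + b ^ 3 - A * c ^ 3)"
    by (simp add: law_defs algebra_simps eval_nat_numeral)
  then show ?thesis
    by (simp add: curve)
qed


end

lemma two_points_swap: "two_points A p q r a b c \<Longrightarrow> two_points A q p r b a c"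
  by (simp add: two_points_def add.commute)

lemma two_points_minus: "two_points A p q r a b c \<Longrightarrow> two_points A p q r b a c"
  by (simp add: two_points_def add.commute)

lemma (in two_points) minor_PQ_RP:
  "law_PQ A p q r b a c * law_RP p q r b a c = law_PP A p q r a b c * law_RP q p r a b c"
  using two_points.minor_RP_PQ[OF two_points_minus[OF two_points_axioms]] by (simp add: law_swap mult_ac)

lemma (in two_points) minor_RQ_PQ:
  "law_RP q p r b a c * law_PQ A p q r b a c = law_RP p q r a b c * law_PP A q p r b a c"
  using two_points.minor_RP_PQ[OF two_points_swap[OF two_points_axioms]] by (simp add: law_swap)

lemma (in two_points) minor_RQ_RP:
  "law_RR p q r a b c * law_PQ A p q r b a c = law_RP p q r a b c * law_RP q p r a b c"
  using two_points.minor_RP_RQ[OF two_points_swap[OF two_points_axioms]] by (simp add: law_swap)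

lemma (in two_points) law_rows_proportional:
  assumes "(X, Y, Z) \<in> law_rows A p q r a b c" "(X', Y', Z') \<in> law_rows A p q r a b c"
  shows "X * Y' = X' * Y" "X * Z' = X' * Z"
  using assms minor_RP_RP minor_RP_PQ minor_PQ_PQ minor_PQ_RP minor_RQ_PQ minor_RQ_RP
  unfolding law_rows_def by (auto simp: mult_ac)

lemma (in two_points) law_rows_curve:
  assumes "(X, Y, Z) \<in> law_rows A p q r a b c"
  shows "X ^ 3 + Y ^ 3 = A * Z ^ 3"
  using assms row_R_curve row_P_curve two_points.row_P_curve[OF two_points_swap[OF two_points_axioms]]
  unfolding law_rows_def by (auto simp: law_swap add.commute)

lemma (in two_points) law_rows_chord:
  assumes "(X, Y, Z) \<in> law_rows A p q r a b c"
    and "k = polar A p q r a b c" "l = polar A a b c p q r"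
  shows "(k * p - l * a) * X = Y * (k * q - l * b)" "(k * p - l * a) * Z = Y * (k * r - l * c)"
  using assms chord_R_P chord_R_R chord_P_P chord_P_R chord_Q_P chord_Q_R
  unfolding law_rows_def by auto

text \<open>
  The four entries that involve only the first two coordinates never vanish together, even where
  \<open>A = 0\<close>. If they did, then \<open>a\<^sup>3 = b\<^sup>3\<close> and \<open>p\<^sup>3 = q\<^sup>3\<close> (unless some coordinate is zero, which is
  easily excluded), and the cube of \<open>a\<^sup>2 p q = - A r\<^sup>2 b c\<close> becomes \<open>p\<^sup>6 a\<^sup>6 = - 8 p\<^sup>6 a\<^sup>6\<close>.
\<close>

lemma law_complete:
  fixes A p q r a b c :: "'a::{idom,ring_char_0}"
  assumes "two_points A p q r a b c" "p \<noteq> 0 \<or> q \<noteq> 0" "a \<noteq> 0 \<or> b \<noteq> 0"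
  shows "law_PP A p q r a b c \<noteq> 0 \<or> law_PQ A p q r a b c \<noteq> 0 \<or>
     law_PQ A p q r b a c \<noteq> 0 \<or> law_PP A q p r b a c \<noteq> 0"
proof (rule ccontr)
  assume "\<not> ?thesis"
  then have z: "A * c ^ 2 * r * q = - (p ^ 2 * a * b)" "b ^ 2 * p * q = - (A * r ^ 2 * c * a)"
      "a ^ 2 * p * q = - (A * r ^ 2 * c * b)" "A * c ^ 2 * r * p = - (q ^ 2 * b * a)"
    by (auto simp: law_defs eq_neg_iff_add_eq_0 neg_eq_iff_add_eq_0)
  note e = two_points.curve[OF assms(1)]
  have "b ^ 3 * (p * q) = b * (b ^ 2 * p * q)"
    by (simp add: power2_eq_square power3_eq_cube ac_simps)
  also have "\<dots> = a * (a ^ 2 * p * q)"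
    unfolding z(2,3) by (simp add: ac_simps)
  also have "\<dots> = a ^ 3 * (p * q)"
    by (simp add: power2_eq_square power3_eq_cube ac_simps)
  finally have 1: "b ^ 3 * (p * q) = a ^ 3 * (p * q)" .
  have "p ^ 3 * (a * b) = p * (p ^ 2 * a * b)"
    by (simp add: power2_eq_square power3_eq_cube ac_simps)
  also have "\<dots> = - (p * (A * c ^ 2 * r * q))"
    unfolding z(1) by simp
  also have "\<dots> = - (q * (A * c ^ 2 * r * p))"
    by (simp add: ac_simps)
  also have "\<dots> = q * (q ^ 2 * b * a)"
    unfolding z(4) by simp
  also have "\<dots> = q ^ 3 * (a * b)"
    by (simp add: power2_eq_square power3_eq_cube ac_simps)
  finally have "p ^ 3 * (a * b) = q ^ 3 * (a * b)" .
  with 1 have dich:  "p * q = 0 \<or> a ^ 3 = b ^ 3" "a * b = 0 \<or> p ^ 3 = q ^ 3"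
    by auto
  show False
  proof (cases "p * q = 0")
    case True
    have "a = 0 \<or> b = 0"
    proof (cases "p = 0")
      case True
      then have "q ^ 2 * b * a = 0" "q \<noteq> 0"
        using z(4) assms(2) by simp_all
      then show ?thesis by auto
    next
      case False
      with True have "p ^ 2 * a * b = 0"
        using z(1) by simp
      with False show ?thesis by simp
    qed
    have "q ^ 3 \<noteq> 0 \<or> p ^ 3 \<noteq> 0" "a ^ 3 \<noteq> 0 \<or> b ^ 3 \<noteq> 0"
      using assms(2,3) by auto
    then have "A * r ^ 3 \<noteq> 0" "A * c ^ 3 \<noteq> 0"
      using True \<open>a = 0 \<or> b = 0\<close> unfolding e[symmetric] by auto
    moreover have "A * r ^ 2 * c * a = 0" "A * r ^ 2 * c * b = 0"
      using z(2,3) True by (simp_all add: mult.assoc)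
    ultimately show False
      using assms(3) by auto
  next
    case False
    with dich(1) assms(3) have ab: "a ^ 3 = b ^ 3" "a \<noteq> 0" "b \<noteq> 0" by auto
    with dich(2) have pq: "p ^ 3 = q ^ 3" by simp
    have "(a ^ 2 * p * q) ^ 3 = - ((A * r ^ 3) ^ 2 * (A * c ^ 3) * b ^ 3)"
      unfolding z by (simp add: power_mult_distrib eval_nat_numeral ac_simps)
    also have "\<dots> = - 8 * (p ^ 3 * p ^ 3 * a ^ 3 * a ^ 3)"
      unfolding e[symmetric] pq[symmetric] ab(1)[symmetric] by (simp add: power2_eq_square algebra_simps)
    also have "(a ^ 2 * p * q) ^ 3 = a ^ 3 * a ^ 3 * p ^ 3 * q ^ 3"
      by (simp add: power2_eq_square power_mult_distrib ac_simps)
    finally have "9 * (p ^ 3 * p ^ 3 * a ^ 3 * a ^ 3) = 0"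
      unfolding pq[symmetric] by (simp add: algebra_simps)
    with False ab show False by simp
  qed
qed

lemma law_scale_left:
  "law_RR (s * p) (s * q) (s * r) a b c = s ^ 2 * law_RR p q r a b c"
  "law_RP (s * p) (s * q) (s * r) a b c = s ^ 2 * law_RP p q r a b c"
  "law_PP A (s * p) (s * q) (s * r) a b c = s ^ 2 * law_PP A p q r a b c"
  "law_PQ A (s * p) (s * q) (s * r) a b c = s ^ 2 * law_PQ A p q r a b c"
  by (simp_all add: law_defs power2_eq_square algebra_simps)

lemma law_scale_right:
  "law_RR p q r (s * a) (s * b) (s * c) = s ^ 2 * law_RR p q r a b c"
  "law_RP p q r (s * a) (s * b) (s * c) = s ^ 2 * law_RP p q r a b c"
  "law_PP A p q r (s * a) (s * b) (s * c) = s ^ 2 * law_PP A p q r a b c"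
  "law_PQ A p q r (s * a) (s * b) (s * c) = s ^ 2 * law_PQ A p q r a b c"
  by (simp_all add: law_defs power2_eq_square algebra_simps)

lemma law_rows_scale:
  "law_rows A (s * p) (s * q) (s * r) a b c = (\<lambda>(X, Y, Z). (s ^ 2 * X, s ^ 2 * Y, s ^ 2 * Z)) ` law_rows A p q r a b c"
  "law_rows A p q r (s * a) (s * b) (s * c) = (\<lambda>(X, Y, Z). (s ^ 2 * X, s ^ 2 * Y, s ^ 2 * Z)) ` law_rows A p q r a b c"
  by (simp_all only: law_rows_def law_scale_left law_scale_right image_insert image_empty prod.case)

text \<open>
  Proportionality to all three rows, some of which may vanish. By \<open>law_complete\<close> at least one
  row is a point, so the sum is determined.
\<close>

definition is_sum ::
  "bipoly \<Rightarrow> bipoly \<Rightarrow> bipoly \<Rightarrow> bipoly \<Rightarrow> bipoly \<Rightarrow> bipoly \<Rightarrow> bipoly \<Rightarrow> bipoly \<Rightarrow> bipoly \<Rightarrow> bool" where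
  "is_sum p q r a b c P Q R \<longleftrightarrow> (\<forall>(X, Y, Z) \<in> law_rows cubA p q r a b c. same_pt P Q R X Y Z)"

lemma same_pt_scale:
  assumes "s \<noteq> 0" "same_pt P Q R (s * X) (s * Y) (s * Z)"
  shows "same_pt P Q R X Y Z"
  using assms unfolding same_pt_def by (metis mult.assoc mult.left_commute mult_left_cancel)

lemma same_pt_scale': "same_pt P Q R X Y Z \<Longrightarrow> same_pt P Q R (s * X) (s * Y) (s * Z)"
  unfolding same_pt_def by (metis mult.assoc mult.left_commute)

lemma same_pt_E:
  assumes "same_pt p q r p' q' r'"
  shows "p * p' = p' * p" "p * q' = p' * q" "p * r' = p' * r"
  using assms by (auto simp: same_pt_def)

lemma is_sum_cong_left:
  assumes sum: "is_sum p q r a b c P Q R" and s: "same_pt p q r p' q' r'" and nz: "p \<noteq> 0"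
  shows "is_sum p' q' r' a b c P Q R"
proof -
  have "\<forall>(X, Y, Z) \<in> law_rows cubA (p * p') (p * q') (p * r') a b c. same_pt P Q R X Y Z"
    using sum unfolding same_pt_E[OF s] law_rows_scale is_sum_def by (auto intro: same_pt_scale')
  then show ?thesis
    unfolding law_rows_scale is_sum_def using same_pt_scale[of "p ^ 2"] nz by fastforce
qed

lemma is_sum_cong_right:
  assumes sum: "is_sum p q r a b c P Q R" and s: "same_pt a b c a' b' c'" and nz: "a \<noteq> 0"
  shows "is_sum p q r a' b' c' P Q R"
proof -
  have "\<forall>(X, Y, Z) \<in> law_rows cubA p q r (a * a') (a * b') (a * c'). same_pt P Q R X Y Z"
    using sum unfolding same_pt_E[OF s] law_rows_scale is_sum_def by (auto intro: same_pt_scale')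
  then show ?thesis
    unfolding law_rows_scale is_sum_def using same_pt_scale[of "a ^ 2"] nz by fastforce
qed

lemma homog_law:
  assumes "homog k p" "homog k q" "homog (k - 1) r" "homog l a" "homog l b" "homog (l - 1) c"
  shows "homog (2 * k + 2 * l - 2) (law_RR p q r a b c)"
    "homog (2 * k + 2 * l - 1) (law_RP p q r a b c)"
    "homog (2 * k + 2 * l) (law_PP cubA p q r a b c)"
    "homog (2 * k + 2 * l) (law_PQ cubA p q r a b c)"
proof -
  have *: "homog m P \<Longrightarrow> homog n Q \<Longrightarrow> m + n = i \<Longrightarrow> homog i (P * Q)" for m n i P Q
    using homog_mult by blast
  have sq: "homog m P \<Longrightarrow> homog (2 * m) (P ^ 2)" for m P
    using homog_power[of m P 2] by simp
  note m = homog_mult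
  show "homog (2 * k + 2 * l - 2) (law_RR p q r a b c)"
    unfolding law_defs
    by (intro homog_diff *[OF m[OF sq[OF assms(6)] assms(1)] assms(2)] *[OF m[OF sq[OF assms(3)] assms(4)] assms(5)]) simp_all
  show "homog (2 * k + 2 * l - 1) (law_RP p q r a b c)"
    unfolding law_defs
    by (intro homog_diff *[OF m[OF sq[OF assms(2)] assms(6)] assms(4)]
        *[OF m[OF sq[OF assms(5)] assms(3)] assms(1)]) simp_all
  show "homog (2 * k + 2 * l) (law_PP cubA p q r a b c)"
    unfolding law_defs
    by (intro homog_add *[OF m[OF m[OF homog_cubA sq[OF assms(6)]] assms(3)] assms(2)]
        *[OF m[OF sq[OF assms(1)] assms(4)] assms(5)]) simp_all
  show "homog (2 * k + 2 * l) (law_PQ cubA p q r a b c)"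
    unfolding law_defs
    by (intro homog_minus homog_add *[OF m[OF m[OF homog_cubA sq[OF assms(3)]] assms(6)] assms(4)]
        *[OF m[OF sq[OF assms(5)] assms(1)] assms(2)]) simp_all
qed

lemma on_curve_two_points:
  "on_curve k p q r \<Longrightarrow> on_curve l a b c \<Longrightarrow> two_points cubA p q r a b c"
  by (simp add: on_curve_def two_points_def)

lemma nonzero_curve:
  fixes X Y Z :: bipoly
  assumes "X ^ 3 + Y ^ 3 = cubA * Z ^ 3" "X \<noteq> 0 \<or> Y \<noteq> 0"
  shows "X \<noteq> 0 \<and> Y \<noteq> 0"
proof (intro conjI notI)
  assume "X = 0"
  with assms cubA_not_cube[of Y Z] show False
    by auto
next
  assume "Y = 0"
  with assms cubA_not_cube[of X Z] show False
    by auto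
qed

lemma is_sum_exists:
  assumes "on_curve k p q r" "on_curve l a b c"
  obtains X Y Z where "on_curve (2 * k + 2 * l) X Y Z" "(X, Y, Z) \<in> law_rows cubA p q r a b c"
    "is_sum p q r a b c X Y Z"
proof -
  interpret two_points cubA p q r a b c
    by (rule on_curve_two_points[OF assms])
  note h = on_curveD[OF assms(1)] on_curveD[OF assms(2)]
  obtain X Y Z where XYZ: "(X, Y, Z) \<in> law_rows cubA p q r a b c" "X \<noteq> 0 \<or> Y \<noteq> 0"
    "homog (2 * k + 2 * l) X" "homog (2 * k + 2 * l) Y" "homog (2 * k + 2 * l - 1) Z"
  proof (cases "law_PP cubA p q r a b c \<noteq> 0 \<or> law_PQ cubA p q r a b c \<noteq> 0")
    case True
    show ?thesis
      by (rule that[of "law_PP cubA p q r a b c" "law_PQ cubA p q r a b c" "law_RP p q r b a c"])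
        (use True h in \<open>auto simp: law_rows_def intro!: homog_law\<close>)
  next
    case False
    then have *: "law_PQ cubA p q r b a c \<noteq> 0 \<or> law_PP cubA q p r b a c \<noteq> 0"
      using law_complete[OF two_points_axioms] h by blast
    show ?thesis
      by (rule that[of "law_PQ cubA p q r b a c" "law_PP cubA q p r b a c" "law_RP q p r a b c"])
        (use * h in \<open>auto simp: law_rows_def intro!: homog_law\<close>)
  qed
  then have "on_curve (2 * k + 2 * l) X Y Z"
    using nonzero_curve[OF law_rows_curve] law_rows_curve by (auto simp: on_curve_def)
  moreover have "is_sum p q r a b c X Y Z"
    using law_rows_proportional[OF XYZ(1)] by (auto simp: is_sum_def same_pt_def)
  ultimately show ?thesis
    using that XYZ(1) by blast
qed

section \<open>Chords and tangents over a field\<close>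

text \<open>
  A line through the points \<open>P\<close>, \<open>Q\<close>, \<open>R\<close> of the cubic, parametrized by \<open>(s, t) \<mapsto> s u + t v\<close>. The
  linear forms \<open>L1\<close>, \<open>L2\<close>, \<open>L3\<close> vanish at the parameters of the three points, and the cubic restricts
  to their product.
\<close>

locale line_cut =
  fixes A c u1 u2 u3 v1 v2 v3 s1 t1 s2 t2 s3 t3 :: "'a::field"
  assumes two: "(2::'a) \<noteq> 0" and three: "(3::'a) \<noteq> 0" and c: "c \<noteq> 0"
    and indep: "\<And>a b. a * u1 + b * v1 = 0 \<Longrightarrow> a * u2 + b * v2 = 0 \<Longrightarrow> a * u3 + b * v3 = 0 \<Longrightarrow> a = 0 \<and> b = 0"
    and cut: "\<And>s t. (s * u1 + t * v1) ^ 3 + (s * u2 + t * v2) ^ 3 - A * (s * u3 + t * v3) ^ 3 =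
        c * (s * t1 - t * s1) * (s * t2 - t * s2) * (s * t3 - t * s3)"
begin

abbreviation "L1 x y \<equiv> x * t1 - y * s1"
abbreviation "L2 x y \<equiv> x * t2 - y * s2"
abbreviation "L3 x y \<equiv> x * t3 - y * s3"

abbreviation "pol g h x y \<equiv> polar A (g * u1 + h * v1) (g * u2 + h * v2) (g * u3 + h * v3)
    (x * u1 + y * v1) (x * u2 + y * v2) (x * u3 + y * v3)"

text \<open>
  Polarization of the product \<open>c L1 L2 L3\<close>, from the identity
  \<open>F(X + U) - F(X - U) - 2 F(U) = 6 F(U, X, X)\<close>.
\<close>

lemma polar_on_line:
  "3 * pol g h x y = c * (L1 g h * L2 x y * L3 x y + L1 x y * L2 g h * L3 x y + L1 x y * L2 x y * L3 g h)"
proof -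
  have F: "(X + U) ^ 3 - (X - U) ^ 3 - 2 * U ^ 3 = 2 * (3 * (U * X ^ 2))" for X U :: 'a
    by (simp add: eval_nat_numeral algebra_simps)
  have G: "c * ((a + a') * (b + b') * (d + d')) - c * ((a - a') * (b - b') * (d - d')) - 2 * (c * (a' * b' * d'))
      = 2 * (c * (a' * b * d + a * b' * d + a * b * d'))" for a b d a' b' d' :: 'a
    by (simp add: algebra_simps)
  have sp: "(x + g) * k + (y + h) * l = (x * k + y * l) + (g * k + h * l)"
      "(x - g) * k + (y - h) * l = (x * k + y * l) - (g * k + h * l)"
      "(x + g) * k - (y + h) * l = (x * k - y * l) + (g * k - h * l)"
      "(x - g) * k - (y - h) * l = (x * k - y * l) - (g * k - h * l)" for k l
    by (simp_all add: algebra_simps)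
  let ?X = "\<lambda>w z. x * w + y * z" and ?U = "\<lambda>w z. g * w + h * z"
  have "2 * (3 * pol g h x y) =
      ((?X u1 v1 + ?U u1 v1) ^ 3 - (?X u1 v1 - ?U u1 v1) ^ 3 - 2 * ?U u1 v1 ^ 3)
      + ((?X u2 v2 + ?U u2 v2) ^ 3 - (?X u2 v2 - ?U u2 v2) ^ 3 - 2 * ?U u2 v2 ^ 3)
      - A * ((?X u3 v3 + ?U u3 v3) ^ 3 - (?X u3 v3 - ?U u3 v3) ^ 3 - 2 * ?U u3 v3 ^ 3)"
    unfolding F polar_def by (simp add: algebra_simps)
  also have "\<dots> = ((?X u1 v1 + ?U u1 v1) ^ 3 + (?X u2 v2 + ?U u2 v2) ^ 3 - A * (?X u3 v3 + ?U u3 v3) ^ 3)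
      - ((?X u1 v1 - ?U u1 v1) ^ 3 + (?X u2 v2 - ?U u2 v2) ^ 3 - A * (?X u3 v3 - ?U u3 v3) ^ 3)
      - 2 * (?U u1 v1 ^ 3 + ?U u2 v2 ^ 3 - A * ?U u3 v3 ^ 3)"
    by (simp add: right_diff_distrib distrib_left)
  also have "\<dots> = 2 * (c * (L1 g h * L2 x y * L3 x y + L1 x y * L2 g h * L3 x y + L1 x y * L2 x y * L3 g h))"
    using cut[of "x + g" "y + h"] cut[of "x - g" "y - h"] cut[of g h]
    unfolding sp G[symmetric] by (simp only: mult.assoc)
  finally show ?thesis
    using two by (simp only: mult_cancel_left) simp
qed

text \<open>
  The classical formula \<open>R = F(P, Q, Q) P - F(P, P, Q) Q\<close> for the third point on a chord, with its
  exact scalar factor; the factor is nonzero precisely if \<open>P\<close> and \<open>Q\<close> differ.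
\<close>

lemma chord_third_point:
  defines "k \<equiv> 3 * pol s1 t1 s2 t2" and "l \<equiv> 3 * pol s2 t2 s1 t1" and "D \<equiv> s1 * t2 - s2 * t1"
  shows "k * (s1 * w + t1 * z) - l * (s2 * w + t2 * z) = c * D ^ 3 * (s3 * w + t3 * z)"
  unfolding k_def l_def D_def polar_on_line by (simp add: eval_nat_numeral algebra_simps)

text \<open>
  If \<open>P = Q\<close>, then any second point \<open>W\<close> on the line yields the third intersection as
  \<open>F(W) P - 3 F(P, W, W) W\<close>.
\<close>

lemma tangent_third_point:
  assumes "s1 * t2 = s2 * t1"
  shows "(c * L1 x y * L2 x y * L3 x y) * (s1 * w + t1 * z) - (3 * pol s1 t1 x y) * (x * w + y * z)
    = c * L1 x y ^ 2 * L2 x y * (s3 * w + t3 * z)"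
proof -
  have "L1 s1 t1 = 0" "L2 s1 t1 = 0"
    using assms by (simp_all add: mult.commute)
  then have "3 * pol s1 t1 x y = c * (L1 x y * L2 x y * L3 s1 t1)"
    unfolding polar_on_line by simp
  then show ?thesis
    by (simp only:) (simp add: eval_nat_numeral algebra_simps)
qed

lemma tangent_line:
  assumes "s1 * t2 = s2 * t1"
  shows "3 * pol x y s1 t1 = 0"
  using assms unfolding polar_on_line by (simp add: mult.commute)

text \<open>
  The tangent line consists of all vectors annihilated by the gradient \<open>g\<close>; two independent such
  vectors span it.
\<close>

lemma in_line:
  assumes "g1 * u1 + g2 * u2 + g3 * u3 = 0" "g1 * v1 + g2 * v2 + g3 * v3 = 0"
    "g1 * w1 + g2 * w2 + g3 * w3 = 0" "g1 \<noteq> 0"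
  obtains x y where "w1 = x * u1 + y * v1" "w2 = x * u2 + y * v2" "w3 = x * u3 + y * v3"
proof -
  have first: "z1 = - (g2 * z2 + g3 * z3) / g1" if "g1 * z1 + g2 * z2 + g3 * z3 = 0" for z1 z2 z3
    using that \<open>g1 \<noteq> 0\<close> by (simp add: field_simps add_eq_0_iff)
  define D where "D = u2 * v3 - u3 * v2"
  have D: "D \<noteq> 0"
  proof
    assume "D = 0"
    then have zero: "v2 * u2 + (- u2) * v2 = 0" "v2 * u3 + (- u2) * v3 = 0"
       "v3 * u2 + (- u3) * v2 = 0" "v3 * u3 + (- u3) * v3 = 0"
      by (simp_all add: D_def algebra_simps)
    have lin: "g1 * (a * u1 + b * v1) + g2 * (a * u2 + b * v2) + g3 * (a * u3 + b * v3) =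
        a * (g1 * u1 + g2 * u2 + g3 * u3) + b * (g1 * v1 + g2 * v2 + g3 * v3)" for a b
      by (simp add: algebra_simps)
    have "v2 * u1 + (- u2) * v1 = 0" "v3 * u1 + (- u3) * v1 = 0"
      using lin[of v2 "- u2"] lin[of v3 "- u3"] zero assms(1,2,4) by simp_all
    with zero indep have "v2 = 0" "u2 = 0" "v3 = 0" "u3 = 0"
      by (metis neg_equal_0_iff_equal)+
    with assms indep[of 1 0] show False
      by simp
  qed
  define x y where "x = (w2 * v3 - w3 * v2) / D" and "y = (u2 * w3 - u3 * w2) / D"
  have "D * (x * u2 + y * v2) = D * w2" "D * (x * u3 + y * v3) = D * w3"
    using D by (simp_all add: x_def y_def field_simps) (simp_all add: D_def algebra_simps)
  then have w: "w2 = x * u2 + y * v2" "w3 = x * u3 + y * v3"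
    using D by simp_all
  moreover have "w1 = x * u1 + y * v1"
    unfolding first[OF assms(1)] first[OF assms(2)] first[OF assms(3)] w
    using \<open>g1 \<noteq> 0\<close> by (simp add: field_simps)
  ultimately show thesis
    using that by blast
qed

end

text \<open>
  The vector \<open>W = (A r\<^sup>2, 0, p\<^sup>2)\<close> lies on the tangent line at \<open>P = (p, q, r)\<close>, and it differs from \<open>P\<close>
  whenever \<open>q \<noteq> 0\<close>. With it the tangent construction gives the second row of the addition law, up
  to the factor \<open>A q\<^sup>3\<close> and negation.
\<close>

lemma tangent_law:
  fixes p q r A :: "'a::comm_ring_1"
  assumes "p ^ 3 + q ^ 3 = A * r ^ 3"
  shows "(A * r ^ 2) ^ 3 + 0 ^ 3 - A * (p ^ 2) ^ 3 = A * q ^ 3 * (A * r ^ 3 + p ^ 3)"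
    "polar A p q r (A * r ^ 2) 0 (p ^ 2) = A * q ^ 3 * (p * r)"
    "(A * r ^ 3 + p ^ 3) * p - 3 * (p * r) * (A * r ^ 2) = law_PQ A p q r p q r"
    "(A * r ^ 3 + p ^ 3) * q = law_PP A p q r p q r"
    "(A * r ^ 3 + p ^ 3) * r - 3 * (p * r) * p ^ 2 = law_RP p q r q p r"
proof -
  have q: "q ^ 3 = A * r ^ 3 - p ^ 3"
    using assms by (simp add: algebra_simps)
  have q': "p * (p * p) = A * (r * (r * r)) - q * (q * q)"
    using assms by (simp add: eval_nat_numeral algebra_simps)
  show "(A * r ^ 2) ^ 3 + 0 ^ 3 - A * (p ^ 2) ^ 3 = A * q ^ 3 * (A * r ^ 3 + p ^ 3)"
    unfolding q by (simp add: eval_nat_numeral algebra_simps)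
  show "polar A p q r (A * r ^ 2) 0 (p ^ 2) = A * q ^ 3 * (p * r)"
    unfolding q by (simp add: polar_def eval_nat_numeral algebra_simps)
  have "(A * r ^ 3 + p ^ 3) * p - 3 * (p * r) * (A * r ^ 2) - law_PQ A p q r p q r =
     p * (p ^ 3 + q ^ 3 - A * r ^ 3)"
    by (simp add: law_defs eval_nat_numeral algebra_simps)
  then show "(A * r ^ 3 + p ^ 3) * p - 3 * (p * r) * (A * r ^ 2) = law_PQ A p q r p q r"
    using assms by simp
  show "(A * r ^ 3 + p ^ 3) * q = law_PP A p q r p q r"
    by (simp add: law_defs eval_nat_numeral algebra_simps)
  have "(A * r ^ 3 + p ^ 3) * r - 3 * (p * r) * p ^ 2 - law_RP p q r q p r =
     - r * (p ^ 3 + q ^ 3 - A * r ^ 3)"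
    by (simp add: law_defs eval_nat_numeral algebra_simps)
  then show "(A * r ^ 3 + p ^ 3) * r - 3 * (p * r) * p ^ 2 = law_RP p q r q p r"
    using assms by simp
qed

text \<open>
  Uniqueness of the third point: whether the line is a chord or a tangent, \<open>R\<close> is
  proportional to the negative of every row of the addition law.
\<close>

lemma (in line_cut) third_point_law:
  assumes P: "p = s1 * u1 + t1 * v1" "q = s1 * u2 + t1 * v2" "r = s1 * u3 + t1 * v3"
    and Q: "p' = s2 * u1 + t2 * v1" "q' = s2 * u2 + t2 * v2" "r' = s2 * u3 + t2 * v3"
    and R: "x = s3 * u1 + t3 * v1" "y = s3 * u2 + t3 * v2" "z = s3 * u3 + t3 * v3"
    and nz: "p \<noteq> 0" "q \<noteq> 0" "p' \<noteq> 0" "q' \<noteq> 0" "y \<noteq> 0"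
    and row: "(X, Y, Z) \<in> law_rows A p q r p' q' r'"
  shows "x * X = Y * y \<and> x * Z = Y * z"
proof -
  have zero: "p ^ 3 + q ^ 3 = A * r ^ 3" "p' ^ 3 + q' ^ 3 = A * r' ^ 3"
    using cut[of s1 t1] cut[of s2 t2] unfolding P Q by (simp_all add: algebra_simps)
  then interpret two_points A p q r p' q' r'
    by unfold_locales
  show ?thesis
  proof (cases "s1 * t2 = s2 * t1")
    case False
    define k l where "k = polar A p q r p' q' r'" and "l = polar A p' q' r' p q r"
    define e where "e = c * (s1 * t2 - s2 * t1) ^ 3"
    have e: "e \<noteq> 0"
      using False c by (simp add: e_def)
    have R': "e * x = 3 * (k * p - l * p')" "e * y = 3 * (k * q - l * q')" "e * z = 3 * (k * r - l * r')"
      using chord_third_point[of u1 v1] chord_third_point[of u2 v2] chord_third_point[of u3 v3]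
      unfolding e_def P Q R k_def l_def by (simp_all only: right_diff_distrib mult.assoc)
    have "e * x * X = 3 * ((k * p - l * p') * X)" "e * x * Z = 3 * ((k * p - l * p') * Z)"
      unfolding R' by simp_all
    then have "e * (x * X) = e * (Y * y)" "e * (x * Z) = e * (Y * z)"
      unfolding law_rows_chord[OF row k_def l_def] using R'(2,3) by (simp_all add: ac_simps)
    with e show ?thesis by simp
  next
    case True
    define f where "f = A * r ^ 3 + p ^ 3"
    have par: "p * q' = p' * q" "p * r' = p' * r"
    proof -
      have "p * q' - p' * q = (s1 * t2 - s2 * t1) * (u1 * v2 - u2 * v1)"
        "p * r' - p' * r = (s1 * t2 - s2 * t1) * (u1 * v3 - u3 * v1)"
        unfolding P Q by (simp_all add: algebra_simps)
      with True show "p * q' = p' * q" "p * r' = p' * r" by simp_all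
    qed
    have plane: "p ^ 2 * w1 + q ^ 2 * w2 + (- A * r ^ 2) * w3 = polar A w1 w2 w3 p q r" for w1 w2 w3
      by (simp add: polar_def algebra_simps)
    have "polar A u1 u2 u3 p q r = 0" "polar A v1 v2 v3 p q r = 0"
      using tangent_line[OF True, of 1 0] tangent_line[OF True, of 0 1] three unfolding P by simp_all
    moreover have "p ^ 2 * (A * r ^ 2) + q ^ 2 * 0 + (- A * r ^ 2) * p ^ 2 = 0" "p ^ 2 \<noteq> 0"
      using nz by simp_all
    ultimately obtain g h where W: "A * r ^ 2 = g * u1 + h * v1" "0 = g * u2 + h * v2" "p ^ 2 = g * u3 + h * v3"
      using in_line[of "p ^ 2" "q ^ 2" "- A * r ^ 2" "A * r ^ 2" 0 "p ^ 2"] unfolding plane by metis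
    \<comment> \<open>\<open>W\<close> is neither \<open>P\<close> nor \<open>Q\<close>: compare the last two coordinates\<close>
    have "- (p ^ 2) * q = L1 g h * (u2 * v3 - u3 * v2)" "- (p ^ 2) * q' = L2 g h * (u2 * v3 - u3 * v2)"
    proof -
      have "0 * r - p ^ 2 * q = L1 g h * (u2 * v3 - u3 * v2)"
        unfolding W(2,3) P(2,3) by (simp add: algebra_simps)
      then show "- (p ^ 2) * q = L1 g h * (u2 * v3 - u3 * v2)" by simp
      have "0 * r' - p ^ 2 * q' = L2 g h * (u2 * v3 - u3 * v2)"
        unfolding W(2,3) Q(2,3) by (simp add: algebra_simps)
      then show "- (p ^ 2) * q' = L2 g h * (u2 * v3 - u3 * v2)" by simp
    qed
    then have L: "L1 g h \<noteq> 0" "L2 g h \<noteq> 0"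
      using nz by auto
    define e m where "e = c * L1 g h ^ 2 * L2 g h" and "m = A * q ^ 3"
    note tl = tangent_law[OF zero(1)]
    have F: "c * L1 g h * L2 g h * L3 g h = m * f"
      using cut[of g h] unfolding W[symmetric] tl m_def f_def by simp
    have T: "3 * pol s1 t1 g h = 3 * (m * (p * r))"
      unfolding W[symmetric] P[symmetric] tl m_def ..
    note tp = tangent_third_point[OF True, of g h, unfolded F T, folded e_def]
    define X0 Y0 Z0 where "X0 = law_PP A p q r p q r" and "Y0 = law_PQ A p q r p q r"
      and "Z0 = law_RP p q r q p r"
    have ex: "e * x = m * Y0"
      using tp[of u1 v1] unfolding W[symmetric] P[symmetric] R[symmetric] Y0_def tl(3)[symmetric] f_def
      by (simp add: algebra_simps)
    have ey: "e * y = m * X0"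
      using tp[of u2 v2] unfolding W[symmetric] P[symmetric] R[symmetric] X0_def tl(4)[symmetric] f_def
      by (simp add: algebra_simps)
    have ez: "e * z = m * Z0"
      using tp[of u3 v3] unfolding W[symmetric] P[symmetric] R[symmetric] Z0_def tl(5)[symmetric] f_def
      by (simp add: algebra_simps)
    have e: "e \<noteq> 0"
      using L c by (simp add: e_def)
    have X0: "X0 \<noteq> 0"
      using e nz(5) ey by auto
    have par': "p * p' = p' * p" "p * q' = p' * q" "p * r' = p' * r"
      using par by simp_all
    have "(p ^ 2 * X, p ^ 2 * Y, p ^ 2 * Z) \<in> law_rows A p q r (p * p') (p * q') (p * r')"
      unfolding law_rows_scale using row by (auto intro!: image_eqI)
    then obtain X1 Y1 Z1 where one: "(X1, Y1, Z1) \<in> law_rows A p q r p q r"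
      "p ^ 2 * X = p' ^ 2 * X1" "p ^ 2 * Y = p' ^ 2 * Y1" "p ^ 2 * Z = p' ^ 2 * Z1"
      unfolding par' law_rows_scale by auto
    interpret PP: two_points A p q r p q r
      using zero by unfold_locales
    have "(X0, Y0, Z0) \<in> law_rows A p q r p q r"
      by (simp add: law_rows_def X0_def Y0_def Z0_def)
    note ratios = PP.law_rows_proportional[OF this one(1)]
    have "X0 * (Y0 * Z1) = X0 * (Y1 * Z0)"
      using ratios by (metis mult.left_commute mult.commute)
    with X0 have ratio3: "Y0 * Z1 = Y1 * Z0" by simp
    have "(e * p ^ 2) * (x * X) = (e * x) * (p ^ 2 * X)" "(e * p ^ 2) * (Y * y) = (e * y) * (p ^ 2 * Y)"
      "(e * p ^ 2) * (x * Z) = (e * x) * (p ^ 2 * Z)" "(e * p ^ 2) * (Y * z) = (e * z) * (p ^ 2 * Y)"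
      by (simp_all add: ac_simps)
    moreover have "(e * x) * (p ^ 2 * X) = (e * y) * (p ^ 2 * Y)"
      unfolding ex ey one using ratios(1) by (simp add: ac_simps)
    moreover have "(e * x) * (p ^ 2 * Z) = (e * z) * (p ^ 2 * Y)"
      unfolding ex ez one using ratio3 by (simp add: ac_simps)
    ultimately show ?thesis
      using e nz(1) by (metis mult_cancel_left mult_eq_0_iff power_eq_0_iff)
  qed
qed

section \<open>Chord-tangent addition of points\<close>

lemma to_fract_power [simp]: "to_fract (x ^ n) = to_fract x ^ n"
  by (induction n) simp_all

lemma ratfun_numerals: "(2::ratfun) \<noteq> 0" "(3::ratfun) \<noteq> 0"
proof -
  have "(2::ratfun) = to_fract (1 + 1)" "(3::ratfun) = to_fract (1 + 1 + 1)"
    by (simp_all only: to_fract_add to_fract_1) simp_all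
  moreover have "(1 + 1 :: bipoly) \<noteq> 0" "(1 + 1 + 1 :: bipoly) \<noteq> 0"
    by simp_all
  ultimately show "(2::ratfun) \<noteq> 0" "(3::ratfun) \<noteq> 0"
    by (simp_all only: to_fract_eq_0_iff not_False_eq_True)
qed

lemma to_fract_law_rows:
  assumes "(X, Y, Z) \<in> law_rows A p q r a b c"
  shows "(to_fract X, to_fract Y, to_fract Z) \<in>
    law_rows (to_fract A) (to_fract p) (to_fract q) (to_fract r) (to_fract a) (to_fract b) (to_fract c)"
  using assms unfolding law_rows_def law_defs by auto

lemma line_section_law:
  assumes "p \<noteq> 0" "q \<noteq> 0" "a \<noteq> 0" "b \<noteq> 0" "y \<noteq> 0"
    and line: "line_section (to_ratfun3 (p, q, r)) (to_ratfun3 (a, b, c)) (to_ratfun3 (x, y, z))"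
    and row: "(X, Y, Z) \<in> law_rows cubA p q r a b c"
  shows "same_pt x y z Y X Z"
proof -
  obtain u v g s1 t1 s2 t2 s3 t3 where uv:
      "\<forall>h k. lin_comb h u k v = (0, 0, 0) \<longrightarrow> h = 0 \<and> k = 0"
      "g \<noteq> 0"
      "to_ratfun3 (p, q, r) = lin_comb s1 u t1 v" "to_ratfun3 (a, b, c) = lin_comb s2 u t2 v"
      "to_ratfun3 (x, y, z) = lin_comb s3 u t3 v"
      "\<forall>s t. cubic (lin_comb s u t v) = g * (s * t1 - t * s1) * (s * t2 - t * s2) * (s * t3 - t * s3)"
    using line unfolding line_section_def by (elim exE conjE) (rule that; assumption)
  obtain u1 u2 u3 where u: "u = (u1, u2, u3)"
    by (rule prod_cases3)
  obtain v1 v2 v3 where v: "v = (v1, v2, v3)"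
    by (rule prod_cases3)
  note uv = uv[unfolded u v]
  note indep = uv(1) and g = uv(2) and P = uv(3) and Q = uv(4) and R = uv(5) and cut = uv(6)
  interpret line_cut "to_fract cubA" g u1 u2 u3 v1 v2 v3 s1 t1 s2 t2 s3 t3
  proof
    show "h = 0 \<and> k = 0" if "h * u1 + k * v1 = 0" "h * u2 + k * v2 = 0" "h * u3 + k * v3 = 0" for h k
      using that indep unfolding lin_comb_def prod.case by metis
    show "(s * u1 + t * v1) ^ 3 + (s * u2 + t * v2) ^ 3 - to_fract cubA * (s * u3 + t * v3) ^ 3 =
        g * (s * t1 - t * s1) * (s * t2 - t * s2) * (s * t3 - t * s3)" for s t
      using cut unfolding lin_comb_def cubic_def prod.case by blast
  qed (use g ratfun_numerals in blast)+
  have "to_fract x * to_fract X = to_fract Y * to_fract y \<and> to_fract x * to_fract Z = to_fract Y * to_fract z"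
    using P Q R assms
    by (intro third_point_law[OF _ _ _ _ _ _ _ _ _ _ _ _ _ _ to_fract_law_rows[OF row]])
      (auto simp: lin_comb_def to_ratfun3_def)
  then show ?thesis
    unfolding same_pt_def to_fract_mult[symmetric] to_fract_eq_iff .
qed

lemma homog_polar:
  assumes "homog k p" "homog k q" "homog (k - 1) r" "homog l a" "homog l b" "homog (l - 1) c"
  shows "homog (k + 2 * l) (polar cubA p q r a b c)"
proof -
  have *: "homog m P \<Longrightarrow> homog n Q \<Longrightarrow> m + 2 * n = i \<Longrightarrow> homog i (P * Q ^ 2)" for m n i P Q
    using homog_mult[OF _ homog_power[of n Q 2]] by auto
  show ?thesis
    unfolding polar_def
    by (intro homog_diff homog_add *[OF assms(1,4)] *[OF assms(2,5)]
        *[OF homog_mult[OF homog_cubA assms(3)] assms(6)]) simp_all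
qed

lemma polar_expand:
  "(s * p + t * a) ^ 3 + (s * q + t * b) ^ 3 - A * (s * r + t * c) ^ 3 =
    s ^ 3 * (p ^ 3 + q ^ 3 - A * r ^ 3) + t ^ 3 * (a ^ 3 + b ^ 3 - A * c ^ 3)
    + 3 * s * t * (s * polar A a b c p q r + t * polar A p q r a b c)"
  for A p q r a b c s t :: "'a::comm_ring_1"
  by (simp add: polar_def eval_nat_numeral algebra_simps)

text \<open>
  The cubic contains no line. If it contained the line through two distinct points, it would
  contain the point of that line with first coordinate \<open>0\<close>, against \<open>cubA_not_cube\<close>.
\<close>

lemma same_pt_of_polar_zero:
  assumes "on_curve k p q r" "on_curve l a b c"
    and "polar cubA p q r a b c = 0" "polar cubA a b c p q r = 0"
  shows "same_pt p q r a b c"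
proof -
  note h = on_curveD[OF assms(1)] on_curveD[OF assms(2)]
  \<comment> \<open>\<open>p w - a v\<close> is the point of the line with first coordinate zero\<close>
  have "(- a * p + p * a) ^ 3 + (- a * q + p * b) ^ 3 - cubA * (- a * r + p * c) ^ 3 = 0"
    unfolding polar_expand assms(3,4) using h by simp
  then have *: "(- a * q + p * b) ^ 3 = cubA * (- a * r + p * c) ^ 3"
    by (simp add: mult.commute)
  then have "- a * r + p * c = 0"
    by (rule cubA_not_cube)
  with * show ?thesis
    by (simp add: same_pt_def)
qed

text \<open>
  The two given points are the basis of the line, so the cubic restricts to \<open>3 s t\<close> times a linear
  form with coefficients \<open>n\<close>, \<open>m\<close>.
\<close>

lemma line_section_chord:
  assumes "on_curve k p q r" "on_curve l a b c" "\<not> same_pt p q r a b c"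
    and "m = polar cubA p q r a b c" "n = polar cubA a b c p q r"
  shows "line_section (to_ratfun3 (p, q, r)) (to_ratfun3 (a, b, c))
      (to_ratfun3 (m * p - n * a, m * q - n * b, m * r - n * c))" (is ?line)
    and "on_curve (2 * k + 2 * l) (m * p - n * a) (m * q - n * b) (m * r - n * c)"
proof -
  note h = on_curveD[OF assms(1)] on_curveD[OF assms(2)]
  have mn: "m \<noteq> 0 \<or> n \<noteq> 0"
    using same_pt_of_polar_zero[OF assms(1,2)] assms(3-5) by auto
  have cross: "p * b - a * q \<noteq> 0 \<or> p * c - a * r \<noteq> 0"
    using assms(3) by (auto simp: same_pt_def)
  let ?f = "to_fract"
  have indep: "g = 0 \<and> h = 0" if "g * ?f p + h * ?f a = 0" "g * ?f q + h * ?f b = 0" "g * ?f r + h * ?f c = 0" for g h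
  proof -
    have "h * (?f p * ?f b - ?f a * ?f q) = ?f p * (g * ?f q + h * ?f b) - ?f q * (g * ?f p + h * ?f a)"
      "h * (?f p * ?f c - ?f a * ?f r) = ?f p * (g * ?f r + h * ?f c) - ?f r * (g * ?f p + h * ?f a)"
      by (simp_all add: algebra_simps)
    then have "h * ?f (p * b - a * q) = 0" "h * ?f (p * c - a * r) = 0"
      using that by simp_all
    with cross have "h = 0"
      unfolding mult_eq_0_iff to_fract_eq_0_iff by blast
    with that h show ?thesis by simp
  qed
  have exp: "cubic (lin_comb s (?f p, ?f q, ?f r) t (?f a, ?f b, ?f c)) =
      3 * (s * 0 - t * 1) * (s * 1 - t * 0) * (s * (- ?f n) - t * ?f m)" for s t
  proof -
    have "?f p ^ 3 + ?f q ^ 3 - ?f cubA * ?f r ^ 3 = ?f (p ^ 3 + q ^ 3 - cubA * r ^ 3)"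
      "?f a ^ 3 + ?f b ^ 3 - ?f cubA * ?f c ^ 3 = ?f (a ^ 3 + b ^ 3 - cubA * c ^ 3)"
      by (simp_all only: to_fract_power to_fract_mult to_fract_add to_fract_diff)
    then have on: "?f p ^ 3 + ?f q ^ 3 - ?f cubA * ?f r ^ 3 = 0" "?f a ^ 3 + ?f b ^ 3 - ?f cubA * ?f c ^ 3 = 0"
      unfolding h(6) h(12) by simp_all
    have pol: "polar (?f cubA) (?f p) (?f q) (?f r) (?f a) (?f b) (?f c) = ?f m"
      "polar (?f cubA) (?f a) (?f b) (?f c) (?f p) (?f q) (?f r) = ?f n"
      unfolding assms(4,5) polar_def
      by (simp_all only: to_fract_power to_fract_mult to_fract_add to_fract_diff)
    have "cubic (lin_comb s (?f p, ?f q, ?f r) t (?f a, ?f b, ?f c)) = 3 * s * t * (s * ?f n + t * ?f m)"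
      unfolding cubic_def lin_comb_def prod.case polar_expand on pol by simp
    then show ?thesis
      by (simp add: algebra_simps)
  qed
  have "\<forall>g h. lin_comb g (?f p, ?f q, ?f r) h (?f a, ?f b, ?f c) = (0, 0, 0) \<longrightarrow> g = 0 \<and> h = 0"
    using indep unfolding lin_comb_def prod.case prod.inject by blast
  moreover have "to_ratfun3 (p, q, r) = lin_comb 1 (?f p, ?f q, ?f r) 0 (?f a, ?f b, ?f c)"
    "to_ratfun3 (a, b, c) = lin_comb 0 (?f p, ?f q, ?f r) 1 (?f a, ?f b, ?f c)"
    "to_ratfun3 (m * p - n * a, m * q - n * b, m * r - n * c) =
      lin_comb (?f m) (?f p, ?f q, ?f r) (- ?f n) (?f a, ?f b, ?f c)"
    by (simp_all add: lin_comb_def to_ratfun3_def)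
  ultimately show ?line
    unfolding line_section_def using ratfun_numerals(2) exp by blast
  have "(m * p + (- n) * a) ^ 3 + (m * q + (- n) * b) ^ 3 - cubA * (m * r + (- n) * c) ^ 3 = 0"
    unfolding polar_expand assms(4,5)[symmetric] using h by (simp add: mult.commute)
  then have curve: "(m * p - n * a) ^ 3 + (m * q - n * b) ^ 3 = cubA * (m * r - n * c) ^ 3"
    by simp
  have "m * p - n * a \<noteq> 0 \<or> m * q - n * b \<noteq> 0"
  proof (rule ccontr)
    assume *: "\<not> ?thesis"
    with curve have "cubA * (m * r - n * c) ^ 3 = 0 ^ 3" by simp
    then have "m * r - n * c = 0"
      using cubA_not_cube[of 0 "m * r - n * c"] by metis
    with * have eq: "m * p = n * a" "m * q = n * b" "m * r = n * c" by simp_all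
    have "m * (p * b - a * q) = b * (m * p) - a * (m * q)" "m * (p * c - a * r) = c * (m * p) - a * (m * r)"
      by (simp_all add: algebra_simps)
    then have "m * (p * b - a * q) = 0" "m * (p * c - a * r) = 0"
      unfolding eq by (simp_all add: algebra_simps)
    with cross have "m = 0" by auto
    with eq h mn show False by simp
  qed
  moreover have deg: "homog (2 * k + 2 * l) (m * p - n * a)" "homog (2 * k + 2 * l) (m * q - n * b)"
    "homog (2 * k + 2 * l - 1) (m * r - n * c)"
  proof -
    have "homog (k + 2 * l) m" "homog (l + 2 * k) n"
      unfolding assms(4,5) using h by (auto intro: homog_polar)
    note mu = homog_mult[OF this(1)] homog_mult[OF this(2)]
    show "homog (2 * k + 2 * l) (m * p - n * a)" "homog (2 * k + 2 * l) (m * q - n * b)"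
      "homog (2 * k + 2 * l - 1) (m * r - n * c)"
      using homog_diff[OF mu(1)[OF h(1)]] mu(2)[OF h(7)] homog_diff[OF mu(1)[OF h(2)]] mu(2)[OF h(8)]
        homog_diff[OF mu(1)[OF h(3)]] mu(2)[OF h(9)] by (simp_all add: algebra_simps)
  qed
  ultimately show "on_curve (2 * k + 2 * l) (m * p - n * a) (m * q - n * b) (m * r - n * c)"
    unfolding on_curve_def using nonzero_curve[OF curve] curve by blast
qed

text \<open>
  The line is spanned by the point and the vector \<open>W\<close> of \<open>tangent_law\<close>.
\<close>

lemma line_section_tangent:
  assumes "on_curve k p q r"
  defines "X \<equiv> law_PP cubA p q r p q r" and "Y \<equiv> law_PQ cubA p q r p q r" and "Z \<equiv> law_RP p q r q p r"
  shows "line_section (to_ratfun3 (p, q, r)) (to_ratfun3 (p, q, r)) (to_ratfun3 (Y, X, Z))" (is ?line)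
    and "on_curve (4 * k) Y X Z"
proof -
  note h = on_curveD[OF assms(1)]
  let ?f = "to_fract"
  let ?A = "?f cubA" and ?p = "?f p" and ?q = "?f q" and ?r = "?f r"
  have e: "?p ^ 3 + ?q ^ 3 = ?A * ?r ^ 3"
    unfolding to_fract_power[symmetric] to_fract_mult[symmetric] to_fract_add[symmetric] to_fract_eq_iff by (rule h(6))
  note tl = tangent_law[OF e]
  let ?s = "?A * ?r ^ 3 + ?p ^ 3" and ?t = "- (3 * (?p * ?r))"
  have YXZ: "?s * ?p + ?t * (?A * ?r ^ 2) = ?f Y" "?s * ?q + ?t * 0 = ?f X" "?s * ?r + ?t * ?p ^ 2 = ?f Z"
    using tl(3,4,5) unfolding X_def Y_def Z_def law_defs by simp_all
  have indep: "g = 0 \<and> h = 0" if "g * ?p + h * (?A * ?r ^ 2) = 0" "g * ?q + h * 0 = 0" "g * ?r + h * ?p ^ 2 = 0" for g h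
    using that h by simp
  have "polar ?A (?A * ?r ^ 2) 0 (?p ^ 2) ?p ?q ?r = 0"
    by (simp add: polar_def)
  then have exp: "cubic (lin_comb s (?p, ?q, ?r) t (?A * ?r ^ 2, 0, ?p ^ 2)) =
      (- (?A * ?q ^ 3)) * (s * 0 - t * 1) * (s * 0 - t * 1) * (s * ?t - t * ?s)" for s t
    unfolding cubic_def lin_comb_def prod.case polar_expand tl(1,2) using e
    by (simp add: algebra_simps eval_nat_numeral)
  have "cubA \<noteq> 0"
    using cubA_not_cube[of 0 1] by (metis mult_zero_left one_neq_zero zero_power zero_less_numeral)
  then have "- (?A * ?q ^ 3) \<noteq> 0"
    using h(5) by (simp del: to_fract_add)
  moreover have "\<forall>g h. lin_comb g (?p, ?q, ?r) h (?A * ?r ^ 2, 0, ?p ^ 2) = (0, 0, 0) \<longrightarrow> g = 0 \<and> h = 0"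
    using indep unfolding lin_comb_def prod.case prod.inject by blast
  moreover have "to_ratfun3 (p, q, r) = lin_comb 1 (?p, ?q, ?r) 0 (?A * ?r ^ 2, 0, ?p ^ 2)"
    by (simp add: lin_comb_def to_ratfun3_def)
  moreover have "to_ratfun3 (Y, X, Z) = lin_comb ?s (?p, ?q, ?r) ?t (?A * ?r ^ 2, 0, ?p ^ 2)"
    using YXZ by (simp only: lin_comb_def to_ratfun3_def prod.case)
  ultimately show ?line
    unfolding line_section_def using exp by blast
  interpret two_points cubA p q r p q r
    by (rule on_curve_two_points[OF assms(1,1)])
  have curve: "Y ^ 3 + X ^ 3 = cubA * Z ^ 3"
    using row_P_curve unfolding X_def Y_def Z_def by (simp add: add.commute)
  have "X \<noteq> 0 \<or> Y \<noteq> 0"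
  proof -
    have "law_PQ cubA p q r q p r = - X" "law_PP cubA q p r q p r = - Y"
      by (simp_all add: X_def Y_def law_defs algebra_simps eval_nat_numeral)
    then show ?thesis
      using law_complete[OF two_points_axioms] h(4) unfolding X_def Y_def by auto
  qed
  then show "on_curve (4 * k) Y X Z"
    unfolding on_curve_def using nonzero_curve[OF curve] curve homog_law[OF h(1-3) h(1-3)]
      homog_law[OF h(1-3) h(2,1,3)] unfolding X_def Y_def Z_def by auto
qed

definition collinear :: "point \<Rightarrow> point \<Rightarrow> point \<Rightarrow> bool" where
  "collinear v w z \<longleftrightarrow>
    (\<exists>P \<in> v. \<exists>Q \<in> w. \<exists>R \<in> z. line_section (to_ratfun3 P) (to_ratfun3 Q) (to_ratfun3 R))"

lemma line_section_rotate: "line_section P Q R \<Longrightarrow> line_section Q R P"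
  unfolding line_section_def
proof (elim exE conjE)
  fix u v c s1 t1 s2 t2 s3 t3
  assume *: "\<forall>a b. lin_comb a u b v = (0, 0, 0) \<longrightarrow> a = 0 \<and> b = 0" "c \<noteq> 0"
    "P = lin_comb s1 u t1 v" "Q = lin_comb s2 u t2 v" "R = lin_comb s3 u t3 v"
    and eq: "\<forall>s t. cubic (lin_comb s u t v) = c * (s * t1 - t * s1) * (s * t2 - t * s2) * (s * t3 - t * s3)"
  have "\<forall>s t. cubic (lin_comb s u t v) = c * (s * t2 - t * s2) * (s * t3 - t * s3) * (s * t1 - t * s1)"
    unfolding eq[rule_format] by (simp only: ac_simps simp_thms)
  with * show "\<exists>u v c s1 t1 s2 t2 s3 t3.
        (\<forall>a b. lin_comb a u b v = (0, 0, 0) \<longrightarrow> a = 0 \<and> b = 0) \<and> c \<noteq> 0 \<and>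
        Q = lin_comb s1 u t1 v \<and> R = lin_comb s2 u t2 v \<and> P = lin_comb s3 u t3 v \<and>
        (\<forall>s t. cubic (lin_comb s u t v) =
           c * (s * t1 - t * s1) * (s * t2 - t * s2) * (s * t3 - t * s3))"
    by blast
qed

lemma collinear_rotate: "collinear v w z \<Longrightarrow> collinear w z v"
  unfolding collinear_def using line_section_rotate by blast

lemma same_pt_minus:
  assumes "same_pt p q r p' q' r'" "p \<noteq> 0"
  shows "same_pt q p r q' p' r'"
proof -
  have eq: "p * q' = p' * q" "p * r' = p' * r"
    using assms(1) by (simp_all add: same_pt_def)
  have "p * (q * r') = q * (p' * r)"
    unfolding eq(2)[symmetric] by (rule mult.left_commute)
  also have "\<dots> = (p' * q) * r"
    by (simp only: ac_simps)
  also have "\<dots> = p * (q' * r)"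
    unfolding eq(1)[symmetric] by (rule mult.assoc)
  finally have "p * (q * r') = p * (q' * r)" .
  with assms show ?thesis
    by (simp add: same_pt_def mult.commute)
qed

text \<open>
  Existence and uniqueness of the third point, identified through the addition law. The
  classes contain all representatives, so uniqueness has to be shown for arbitrary ones.
\<close>

lemma collinear_iff:
  assumes t: "on_curve k p q r" "on_curve l a b c" "on_curve m P Q R"
    and sum: "is_sum p q r a b c P Q R" and z: "z \<in> V"
  shows "collinear (pt p q r) (pt a b c) z \<longleftrightarrow> z = pt Q P R"
proof
  assume "collinear (pt p q r) (pt a b c) z"
  then obtain P0 Q0 R0 where mem: "P0 \<in> pt p q r" "Q0 \<in> pt a b c" "R0 \<in> z"
    and line: "line_section (to_ratfun3 P0) (to_ratfun3 Q0) (to_ratfun3 R0)"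
    unfolding collinear_def by blast
  obtain p' q' r' where P0: "P0 = (p', q', r')" by (rule prod_cases3)
  obtain a' b' c' where Q0: "Q0 = (a', b', c')" by (rule prod_cases3)
  obtain x y w where R0: "R0 = (x, y, w)" by (rule prod_cases3)
  note mem = mem[unfolded P0 Q0 R0] and line = line[unfolded P0 Q0 R0]
  note pa = mem(1,2) and x = mem(3)
  obtain k' l' where c': "on_curve k' p' q' r'" "on_curve l' a' b' c'"
    and s: "same_pt p q r p' q' r'" "same_pt a b c a' b' c'"
    using pa in_pt_iff t by blast
  obtain n x0 y0 w0 where z0: "on_curve n x0 y0 w0" "z = pt x0 y0 w0"
    using z V_E by blast
  obtain n' where z': "on_curve n' x y w" "same_pt x0 y0 w0 x y w"
    using x in_pt_iff[OF z0(1)] z0(2) by blast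
  have z_eq: "z = pt x y w"
    using pt_eq_iff[OF z0(1) z'(1)] z0(2) z'(2) by blast
  obtain X Y Z where row: "on_curve (2 * k' + 2 * l') X Y Z" "(X, Y, Z) \<in> law_rows cubA p' q' r' a' b' c'"
    using is_sum_exists[OF c'] by blast
  have "is_sum p' q' r' a' b' c' P Q R"
    using is_sum_cong_right[OF is_sum_cong_left[OF sum s(1)] s(2)] t by (simp add: on_curve_def)
  then have "same_pt P Q R X Y Z"
    using row(2) by (auto simp: is_sum_def)
  then have "same_pt Q P R Y X Z"
    using same_pt_minus t(3) by (auto simp: on_curve_def)
  moreover have "same_pt x y w Y X Z"
    using line_section_law[OF _ _ _ _ _ line row(2)] c' z'(1) by (simp add: on_curve_def)
  ultimately show "z = pt Q P R"
    unfolding z_eq pt_eq_iff[OF z'(1) on_curve_minus[OF t(3)]]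
    using same_pt_trans same_pt_sym on_curveD(5)[OF row(1)] by blast
next
  assume zeq: "z = pt Q P R"
  have in_z: "(y, x, w) \<in> z" if "on_curve n y x w" "(X, Y, Z) \<in> law_rows cubA p q r a b c" "on_curve n' X Y Z"
      "same_pt y x w Y X Z" for x y w n X Y Z n'
  proof -
    have "same_pt Q P R Y X Z"
      using sum that(2) t(3) same_pt_minus by (auto simp: is_sum_def on_curve_def)
    then have "same_pt Q P R y x w"
      using same_pt_trans same_pt_sym that(4) on_curveD(5)[OF that(3)] by blast
    then show ?thesis
      unfolding zeq in_pt_iff[OF on_curve_minus[OF t(3)]] using that(1) by blast
  qed
  interpret two_points cubA p q r a b c
    by (rule on_curve_two_points[OF t(1,2)])
  obtain X Y Z where row: "on_curve (2 * k + 2 * l) X Y Z" "(X, Y, Z) \<in> law_rows cubA p q r a b c"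
    using is_sum_exists[OF t(1,2)] by blast
  have P_in: "(p, q, r) \<in> pt p q r" "(a, b, c) \<in> pt a b c"
    using in_pt_iff t(1,2) by auto
  show "collinear (pt p q r) (pt a b c) z"
  proof (cases "same_pt p q r a b c")
    case False
    note ch = line_section_chord[OF t(1,2) False refl refl]
    note rc = law_rows_chord[OF row(2) refl refl]
    note R_in = in_z[OF ch(2) row(2,1)]
    show ?thesis
      unfolding collinear_def
      by (rule bexI, rule bexI, rule bexI, rule ch(1), rule R_in, unfold same_pt_def,
          intro conjI rc, rule P_in(2), rule P_in(1))
  next
    case True
    note ta = line_section_tangent[OF t(1)]
    define X Y Z where "X = law_PP cubA p q r p q r" and "Y = law_PQ cubA p q r p q r" and "Z = law_RP p q r q p r"
    have "(p, q, r) \<in> pt a b c"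
      using in_pt_iff[OF t(2)] t(1) same_pt_sym[OF True] by blast
    moreover have "(Y, X, Z) \<in> z"
    proof -
      have "is_sum p q r p q r P Q R"
        using is_sum_cong_right[OF sum same_pt_sym[OF True]] t(2) by (simp add: on_curve_def)
      then have "same_pt P Q R X Y Z"
        by (auto simp: is_sum_def law_rows_def X_def Y_def Z_def)
      then have "same_pt Q P R Y X Z"
        using same_pt_minus t(3) by (auto simp: on_curve_def)
      then show ?thesis
        unfolding zeq in_pt_iff[OF on_curve_minus[OF t(3)]] using ta(2) unfolding X_def Y_def Z_def by blast
    qed
    ultimately show ?thesis
      unfolding collinear_def
      by (intro bexI[OF _ P_in(1)] bexI[of _ "(p, q, r)" "pt a b c"] bexI[of _ "(Y, X, Z)" z])
        (simp_all only: X_def Y_def Z_def ta(1))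
  qed
qed

lemma third_point_eq:
  assumes "on_curve k p q r" "on_curve l a b c" "on_curve m P Q R" "is_sum p q r a b c P Q R"
  shows "third_point (pt p q r) (pt a b c) = pt Q P R"
  unfolding third_point_def collinear_def[symmetric]
  using collinear_iff[OF assms] pt_in_V[OF on_curve_minus[OF assms(3)]] by (intro the_equality) blast+

lemma on_curve_zero: "on_curve 0 1 (- 1) 0"
  by (simp add: on_curve_def homog_one homog_minus)

lemma is_sum_zero_left: "is_sum 1 (- 1) 0 a b c a b c"
  by (simp add: is_sum_def law_rows_def law_defs same_pt_def power2_eq_square)

lemma is_sum_zero_right: "is_sum a b c 1 (- 1) 0 a b c"
  by (simp add: is_sum_def law_rows_def law_defs same_pt_def power2_eq_square)

lemma V_add_pt:
  assumes "on_curve k p q r" "on_curve l a b c" "on_curve m P Q R" "is_sum p q r a b c P Q R"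
  shows "V_add (pt p q r) (pt a b c) = pt P Q R"
  unfolding V_add_def V_zero_def third_point_eq[OF assms]
  by (rule third_point_eq[OF on_curve_zero _ _ is_sum_zero_left]) (rule on_curve_minus[OF assms(3)])+

lemma V_add_closed:
  assumes "v \<in> V" "w \<in> V"
  shows "V_add v w \<in> V"
proof -
  obtain k p q r l a b c where t: "on_curve k p q r" "v = pt p q r" "on_curve l a b c" "w = pt a b c"
    using V_E[OF assms(1)] V_E[OF assms(2)] by metis
  obtain P Q R where "on_curve (2 * k + 2 * l) P Q R" "is_sum p q r a b c P Q R"
    using is_sum_exists[OF t(1,3)] by blast
  then show ?thesis
    unfolding t(2,4) using V_add_pt[OF t(1,3)] pt_in_V by simp
qed

text \<open>
  The cancellation law that does not need associativity: collinearity of \<open>v\<close>, \<open>-w\<close> and \<open>0\<close> is symmetric,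
  and the third point on the line through \<open>-w\<close> and \<open>0\<close> is \<open>w\<close>.
\<close>

lemma V_add_minus_eq_zero:
  assumes "on_curve k p q r" "on_curve l a b c" "V_add (pt p q r) (pt b a c) = V_zero"
  shows "pt p q r = pt a b c"
proof -
  obtain P Q R where sum: "on_curve (2 * k + 2 * l) P Q R" "is_sum p q r b a c P Q R"
    using is_sum_exists[OF assms(1) on_curve_minus[OF assms(2)]] by blast
  note t = assms(1) on_curve_minus[OF assms(2)] sum
  have "pt P Q R = V_zero"
    using V_add_pt[OF t] assms(3) by simp
  then have "same_pt P Q R 1 (- 1) 0"
    unfolding V_zero_def using pt_eq_iff[OF sum(1) on_curve_zero] by blast
  then have "same_pt Q P R 1 (- 1) 0"
    by (auto simp: same_pt_def)
  then have "pt Q P R = V_zero"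
    unfolding V_zero_def using pt_eq_iff[OF on_curve_minus[OF sum(1)] on_curve_zero] by blast
  then have "collinear (pt p q r) (pt b a c) V_zero"
    using collinear_iff[OF t] pt_in_V[OF on_curve_minus[OF sum(1)]] by simp
  then have "collinear (pt b a c) V_zero (pt p q r)"
    by (rule collinear_rotate)
  then show ?thesis
    unfolding V_zero_def
    using collinear_iff[OF t(2) on_curve_zero t(2) is_sum_zero_right] pt_in_V[OF assms(1)] by blast
qed

section \<open>The action on the invariant differential\<close>

lemma coprime_no_common_root:
  fixes P Q :: "complex poly"
  assumes "\<And>z. poly P z \<noteq> 0 \<or> poly Q z \<noteq> 0"
  shows "coprime P Q"
proof (rule coprimeI)
  fix c assume c: "c dvd P" "c dvd Q"
  then have "poly c z \<noteq> 0" for z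
    using assms[of z] by (auto elim!: dvdE)
  then have "constant (poly c)"
    using fundamental_theorem_of_algebra by blast
  then have "degree c = 0"
    by (simp add: constant_degree)
  moreover have "c \<noteq> 0"
    using c assms by auto
  ultimately show "is_unit c"
    by (simp add: is_unit_iff_degree)
qed

lemma degree_euler_operator:
  fixes F :: "complex poly"
  assumes "degree F \<le> n"
  shows "degree ([:0, 1:] * pderiv F - smult (of_nat n) F) \<le> n - 1"
proof (rule degree_le, intro allI impI)
  fix i assume i: "n - 1 < i"
  have "Polynomial.coeff ([:0, 1:] * pderiv F - smult (of_nat n) F) i = (of_nat i - of_nat n) * Polynomial.coeff F i"
    using i by (cases i) (auto simp: coeff_pderiv algebra_simps)
  also have "\<dots> = 0"
    using i assms by (cases "i = n") (auto simp: coeff_eq_0)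
  finally show "Polynomial.coeff ([:0, 1:] * pderiv F - smult (of_nat n) F) i = 0" .
qed

text \<open>
  Put \<open>y = 1\<close> and let \<open>P, Q, R\<close> be the dehomogenized coordinates of a point. The map \<open>(P/R, Q/R)\<close> of
  \<open>E\<close> pulls the invariant differential \<open>dX/Y\<^sup>2\<close> back to a multiple \<open>c\<close> of itself, which amounts to
  \<open>wronskian_form P R = c Q\<^sup>2\<close>; the second summand accounts for the homogeneous degree of \<open>P/R\<close>.
\<close>

definition wronskian_form :: "complex poly \<Rightarrow> complex poly \<Rightarrow> complex poly" where
  "wronskian_form F R = [:1, 0, 0, 1:] * (pderiv F * R - F * pderiv R) - [:0, 0, 1:] * F * R"

text \<open>
  Both summands have degree \<open>2n + 3\<close> in general. Their leading terms cancel, which becomes visible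
  after splitting off the multiples of \<open>F\<close> and \<open>R\<close> by which the operator \<open>t d/dt\<close> acts on leading
  terms.
\<close>

lemma degree_wronskian_form:
  assumes F: "degree F \<le> Suc n" and R: "degree R \<le> n"
  shows "degree (wronskian_form F R) \<le> 2 * Suc n"
proof -
  define t :: "complex poly" where "t = [:0, 1:]"
  \<comment> \<open>\<open>n\<close> and \<open>Suc n\<close> are the eigenvalues of \<open>t d/dt\<close> on the leading terms of \<open>R\<close> and \<open>F\<close>\<close>
  define G where "G = t * pderiv F - smult (of_nat (Suc n)) F"
  define H where "H = t * pderiv R - smult (of_nat n) R"
  have t: "[:0, 0, 1:] = t ^ 2" "[:1, 0, 0, 1:] = 1 + t ^ 3"
    by (simp_all add: t_def power2_eq_square power3_eq_cube one_pCons)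
  have "wronskian_form F R = (pderiv F * R - F * pderiv R) + t ^ 2 * (G * R - F * H)"
    unfolding wronskian_form_def t(2) unfolding t(1) G_def H_def by (simp add: algebra_simps power2_eq_square power3_eq_cube smult_add_left)
  moreover have "degree (pderiv F * R) \<le> 2 * Suc n" "degree (F * pderiv R) \<le> 2 * Suc n"
    using degree_mult_le[of "pderiv F" R] degree_mult_le[of F "pderiv R"] F R by (simp_all add: degree_pderiv)
  moreover have "degree (t ^ 2 * (G * R - F * H)) \<le> 2 * Suc n"
  proof -
    have G: "degree G \<le> n"
      using degree_euler_operator[OF F] by (simp add: G_def t_def)
    have "degree (F * H) \<le> 2 * n"
    proof (cases n)
      case 0
      then have "H = 0"
        using R by (auto simp: H_def elim!: degree_eq_zeroE)
      then show ?thesis by simp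
    next
      case (Suc m)
      have "degree H \<le> n - 1"
        using degree_euler_operator[OF R] by (simp add: H_def t_def)
      then show ?thesis
        using degree_mult_le[of F H] F Suc by simp
    qed
    moreover have "degree (G * R) \<le> 2 * n"
      using degree_mult_le[of G R] G R by simp
    ultimately have "degree (G * R - F * H) \<le> 2 * n"
      by (rule degree_diff_le[rotated])
    moreover have "degree (t ^ 2) \<le> 2"
      by (simp add: t_def power2_eq_square)
    ultimately show ?thesis
      using degree_mult_le[of "t ^ 2" "G * R - F * H"] unfolding mult_Suc_right by linarith
  qed
  ultimately show ?thesis
    by (metis degree_add_le degree_diff_le)
qed

text \<open>
  The hypothesis says that \<open>F\<^sup>3\<close> is a constant multiple of \<open>(1 + t\<^sup>3) R\<^sup>3\<close>. Comparing orders at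
  \<open>t = -1\<close> would give \<open>0 = 1 + 3 e\<close>, where \<open>e\<close> is the order of \<open>R\<close>.
\<close>

lemma wronskian_form_eq_0:
  assumes eq: "wronskian_form F R = 0" and F: "poly F (- 1) \<noteq> 0"
  shows "R = 0"
proof (rule ccontr)
  assume "R \<noteq> 0"
  define s :: "complex poly" where "s = [:1, 1:]"
  obtain e S where R: "R = s ^ e * S" and "\<not> s dvd S"
    using order_decomp[OF \<open>R \<noteq> 0\<close>, of "- 1"] unfolding s_def by auto
  then have S: "poly S (- 1) \<noteq> 0"
    unfolding s_def by (simp add: poly_eq_0_iff_dvd)
  have ds: "s * pderiv R = s ^ e * (smult (of_nat e) S + s * pderiv S)"
  proof -
    have "pderiv s = 1"
      by (simp add: s_def pderiv_pCons)
    then have "s * pderiv (s ^ e) = smult (of_nat e) (s ^ e)"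
      by (cases e) (simp_all add: pderiv_power_Suc del: power_Suc, simp add: algebra_simps)
    then have "S * (s * pderiv (s ^ e)) = S * smult (of_nat e) (s ^ e)"
      by simp
    then show ?thesis
      unfolding R by (simp add: pderiv_mult algebra_simps)
  qed
  define B T :: "complex poly" where "B = [:1, - 1, 1:]" and "T = [:0, 0, 1:]"
  define E where "E = smult (of_nat e) S + s * pderiv S"
  have A: "[:1, 0, 0, 1:] = s * B"
    by (simp add: s_def B_def)
  have "wronskian_form F R = B * (s * pderiv F * R - F * (s * pderiv R)) - T * F * R"
    unfolding wronskian_form_def A unfolding T_def[symmetric] by (simp add: algebra_simps)
  also have "\<dots> = s ^ e * (B * (s * pderiv F * S - F * E) - T * F * S)"
    unfolding ds E_def[symmetric] unfolding R by (simp add: algebra_simps)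
  finally have "B * (s * pderiv F * S - F * E) - T * F * S = 0"
    using eq by (simp add: s_def)
  then have "poly (B * (s * pderiv F * S - F * E) - T * F * S) (- 1) = 0"
    by simp
  then have "(3 * of_nat e + 1) * (poly F (- 1) * poly S (- 1)) = 0"
    by (simp add: s_def B_def T_def E_def algebra_simps neg_eq_iff_add_eq_0)
  moreover have "(3 * of_nat e + 1 :: complex) \<noteq> 0"
    using of_nat_eq_0_iff[of "3 * e + 1", where ?'a = complex] by (simp add: add.commute del: of_nat_eq_0_iff)
  ultimately show False
    using F S by simp
qed

text \<open>
  Differentiating the curve equation gives
  \<open>P\<^sup>2 wronskian_form P R = - Q\<^sup>2 wronskian_form Q R\<close>. As \<open>P\<close> and \<open>Q\<close> are coprime,
  \<open>wronskian_form P R\<close> is \<open>Q\<^sup>2 K\<close>, and \<open>K\<close> is a constant for reasons of degree. Its value can be read off at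
  \<open>t = -1\<close>, where it is zero because \<open>R\<close> vanishes there.
\<close>

lemma vanishing_slope_univariate:
  fixes P Q R :: "complex poly"
  assumes eq: "P ^ 3 + Q ^ 3 = [:1, 0, 0, 1:] * R ^ 3" and cop: "coprime P Q"
    and deg: "degree P \<le> Suc n" "degree Q \<le> Suc n" "degree R \<le> n"
    and top: "degree P = Suc n \<or> degree Q = Suc n"
    and P: "poly P (- 1) \<noteq> 0" "poly Q (- 1) \<noteq> 0" "poly R (- 1) = 0"
  shows "R = 0"
proof -
  define A :: "complex poly" where "A = [:1, 0, 0, 1:]"
  define T :: "complex poly" where "T = [:0, 0, 1:]"
  have "pderiv (P ^ 3 + Q ^ 3) = pderiv (A * R ^ 3)"
    using eq by (simp add: A_def)
  moreover have cube: "pderiv (X ^ 3) = 3 * (X ^ 2 * pderiv X)" for X :: "complex poly"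
    by (simp add: power3_eq_cube power2_eq_square pderiv_mult algebra_simps)
  moreover have "pderiv A = 3 * T"
    by (simp add: A_def T_def pderiv_pCons numeral_poly)
  ultimately have "3 * (P ^ 2 * pderiv P + Q ^ 2 * pderiv Q) = 3 * (T * R ^ 3 + A * R ^ 2 * pderiv R)"
    by (simp add: pderiv_add pderiv_mult algebra_simps)
  then have deq: "P ^ 2 * pderiv P + Q ^ 2 * pderiv Q = T * R ^ 3 + A * R ^ 2 * pderiv R"
    unfolding mult_cancel_left by simp
  have "P ^ 2 * wronskian_form P R + Q ^ 2 * wronskian_form Q R =
      A * R * (P ^ 2 * pderiv P + Q ^ 2 * pderiv Q) - (A * pderiv R + T * R) * (P ^ 3 + Q ^ 3)"
    unfolding wronskian_form_def A_def[symmetric] unfolding T_def[symmetric]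
    by (simp add: power2_eq_square power3_eq_cube algebra_simps)
  also have "\<dots> = 0"
    unfolding deq eq[folded A_def] by (simp add: power2_eq_square power3_eq_cube algebra_simps)
  finally have sum: "P ^ 2 * wronskian_form P R + Q ^ 2 * wronskian_form Q R = 0" .
  then have "P ^ 2 * wronskian_form P R = Q ^ 2 * (- wronskian_form Q R)"
    by (simp add: eq_neg_iff_add_eq_0)
  then have "Q ^ 2 dvd P ^ 2 * wronskian_form P R"
    by (metis dvd_triv_left)
  moreover have "coprime (Q ^ 2) (P ^ 2)"
    using cop by (simp add: coprime_commute)
  ultimately have "Q ^ 2 dvd wronskian_form P R"
    by (simp add: coprime_dvd_mult_right_iff)
  then obtain K where K: "wronskian_form P R = Q ^ 2 * K" ..
  with sum have "Q ^ 2 * (P ^ 2 * K + wronskian_form Q R) = 0"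
    by (simp add: algebra_simps)
  moreover have nz: "P \<noteq> 0" "Q \<noteq> 0"
    using P by auto
  ultimately have K': "wronskian_form Q R = - (P ^ 2 * K)"
    by (simp add: eq_neg_iff_add_eq_0 add.commute)
  have "degree K = 0"
  proof (cases "K = 0")
    case False
    have "degree (Q ^ 2 * K) \<le> 2 * Suc n" "degree (P ^ 2 * K) \<le> 2 * Suc n"
      using degree_wronskian_form[OF deg(1,3)] degree_wronskian_form[OF deg(2,3)] unfolding K K' by simp_all
    with top False nz show ?thesis
      by (auto simp: degree_mult_eq degree_power_eq)
  qed simp
  then obtain z where z: "K = [:z:]"
    by (rule degree_eq_zeroE)
  have "poly (wronskian_form P R) (- 1) = 0"
    using P(3) by (simp add: wronskian_form_def)
  with P(2) have "K = 0"
    unfolding K z by simp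
  then show ?thesis
    using wronskian_form_eq_0 P(1) K by simp
qed

lemma homog_dehomogenize:
  assumes "homog (int n) P"
  shows "degree (poly P 1) \<le> n" "Polynomial.coeff (poly P 1) n = ev P 1 0"
proof -
  have P: "poly P 1 = (\<Sum>j\<le>degree P. Polynomial.coeff P j)"
    by (simp add: poly_altdef)
  have c: "Polynomial.coeff (Polynomial.coeff P j) i = 0" if "i + j \<noteq> n" for i j
    using assms that unfolding homog_def by (metis of_nat_add of_nat_eq_iff)
  show "degree (poly P 1) \<le> n"
    unfolding P by (intro degree_sum_le degree_le) (auto intro!: c)
  have "Polynomial.coeff (poly P 1) n = (\<Sum>j\<le>degree P. if j = 0 then Polynomial.coeff (Polynomial.coeff P 0) n else 0)"
    unfolding P coeff_sum by (intro sum.cong) (auto intro!: c)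
  also have "\<dots> = (\<Sum>i\<le>degree (Polynomial.coeff P 0). if i = n then Polynomial.coeff (Polynomial.coeff P 0) n else 0)"
    by (auto simp: coeff_eq_0)
  also have "\<dots> = (\<Sum>i\<le>degree (Polynomial.coeff P 0). Polynomial.coeff (Polynomial.coeff P 0) i)"
    using c[of _ 0] by (intro sum.cong) auto
  also have "\<dots> = ev P 1 0"
    by (simp add: ev_def poly_altdef[of "Polynomial.coeff P 0"] poly_0_coeff_0)
  finally show "Polynomial.coeff (poly P 1) n = ev P 1 0" .
qed

section \<open>Slope, sheet and the group structure\<close>

text \<open>
  Modulo the factor \<open>x + y\<close> of \<open>x\<^sup>3 + y\<^sup>3\<close> the cubic becomes \<open>X\<^sup>3 + Y\<^sup>3 = 0\<close>, three lines through
  \<open>(0 : 0 : 1)\<close>, and on its smooth part \<open>\<complex> \<times> \<int>/3\<close> the coordinates are \<open>ZX/Y\<^sup>2\<close> and \<open>-Y/X\<close>.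
\<close>

definition slope :: "point \<Rightarrow> complex" where
  "slope v = (case rep v of (p, q, r) \<Rightarrow> ev r 1 (- 1) * ev p 1 (- 1) / ev q 1 (- 1) ^ 2)"

definition sheet :: "point \<Rightarrow> complex" where
  "sheet v = (case rep v of (p, q, r) \<Rightarrow> - ev q 1 (- 1) / ev p 1 (- 1))"

lemma eq_minus_of_quotient: "- y / x = 1 \<Longrightarrow> x \<noteq> 0 \<Longrightarrow> y = - x" for x y :: complex
  by (metis nonzero_divide_eq_eq mult_1 minus_minus)

lemma ev_curve:
  assumes "on_curve k p q r"
  shows "ev p x y ^ 3 + ev q x y ^ 3 = (x ^ 3 + y ^ 3) * ev r x y ^ 3"
proof -
  have "ev (p ^ 3 + q ^ 3) x y = ev (cubA * r ^ 3) x y"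
    using on_curveD(6)[OF assms] by simp
  then show ?thesis by simp
qed

lemma base_values:
  assumes "on_curve k p q r" "ev p 1 (- 1) \<noteq> 0 \<or> ev q 1 (- 1) \<noteq> 0"
  shows "ev p 1 (- 1) ^ 3 = - (ev q 1 (- 1) ^ 3)" "ev p 1 (- 1) \<noteq> 0" "ev q 1 (- 1) \<noteq> 0"
proof -
  have "ev p 1 (- 1) ^ 3 + ev q 1 (- 1) ^ 3 = 0"
    using ev_curve[OF assms(1), of 1 "- 1"] by simp
  then show "ev p 1 (- 1) ^ 3 = - (ev q 1 (- 1) ^ 3)"
    by (simp add: eq_neg_iff_add_eq_0)
  with assms(2) show "ev p 1 (- 1) \<noteq> 0" "ev q 1 (- 1) \<noteq> 0"
    by auto
qed

lemma primitive_base: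
  assumes "primitive k p q r"
  shows "ev p 1 (- 1) ^ 3 = - (ev q 1 (- 1) ^ 3)" "ev p 1 (- 1) \<noteq> 0" "ev q 1 (- 1) \<noteq> 0"
proof -
  have "ev p 1 (- 1) \<noteq> 0 \<or> ev q 1 (- 1) \<noteq> 0"
    using assms by (auto simp: primitive_def)
  then show "ev p 1 (- 1) ^ 3 = - (ev q 1 (- 1) ^ 3)" "ev p 1 (- 1) \<noteq> 0" "ev q 1 (- 1) \<noteq> 0"
    using base_values[OF primitive_on_curve[OF assms]] by blast+
qed

lemma slope_sheet_pt:
  assumes c: "on_curve k p q r" and nz: "ev p 1 (- 1) \<noteq> 0 \<or> ev q 1 (- 1) \<noteq> 0"
  shows "slope (pt p q r) = ev r 1 (- 1) * ev p 1 (- 1) / ev q 1 (- 1) ^ 2"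
    and "sheet (pt p q r) = - ev q 1 (- 1) / ev p 1 (- 1)"
proof -
  obtain p' q' r' where rep: "primitive (int (d (pt p q r))) p' q' r'" "pt p q r = pt p' q' r'"
      "rep (pt p q r) = (p', q', r')"
    using V_repE[OF pt_in_V[OF c]] by blast
  let ?e = "\<lambda>P. ev P 1 (- 1)"
  have "same_pt p q r p' q' r'"
    using rep(2) pt_eq_iff[OF c primitive_on_curve[OF rep(1)]] by blast
  then have "?e (p * q') = ?e (p' * q)" "?e (p * r') = ?e (p' * r)"
    by (simp_all add: same_pt_def)
  then have eq: "?e q' = ?e p' * ?e q / ?e p" "?e r' = ?e p' * ?e r / ?e p"
    using base_values(2)[OF c nz] by (simp_all add: field_simps)
  show "slope (pt p q r) = ?e r * ?e p / ?e q ^ 2" "sheet (pt p q r) = - ?e q / ?e p"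
    unfolding slope_def sheet_def rep(3) prod.case eq
    using base_values[OF c nz] primitive_base[OF rep(1)] by (simp_all add: field_simps power2_eq_square)
qed

lemma V_add_row:
  assumes t: "on_curve k p q r" "on_curve l a b c"
    and row: "(X, Y, Z) \<in> law_rows cubA p q r a b c" "on_curve m X Y Z"
  shows "V_add (pt p q r) (pt a b c) = pt X Y Z"
proof -
  interpret two_points cubA p q r a b c
    by (rule on_curve_two_points[OF t])
  have "is_sum p q r a b c X Y Z"
    using law_rows_proportional[OF row(1)] by (auto simp: is_sum_def same_pt_def)
  then show ?thesis
    by (rule V_add_pt[OF t row(2)])
qed

text \<open>
  The last row of the addition law, evaluated where \<open>A = 0\<close>. That row does not vanish at the base
  point, so it may serve as a representative of the sum.
\<close>

lemma slope_sheet_add: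
  assumes "v \<in> V" "w \<in> V"
  shows "slope (V_add v w) = slope v + slope w" "sheet (V_add v w) = sheet v * sheet w"
proof -
  obtain p q r where v: "primitive (int (d v)) p q r" "v = pt p q r" "rep v = (p, q, r)"
    using V_repE[OF assms(1)] by blast
  obtain a b c where w: "primitive (int (d w)) a b c" "w = pt a b c" "rep w = (a, b, c)"
    using V_repE[OF assms(2)] by blast
  let ?e = "\<lambda>P. ev P 1 (- 1)"
  note t = primitive_on_curve[OF v(1)] primitive_on_curve[OF w(1)]
  note b = primitive_base[OF v(1)] primitive_base[OF w(1)]
  define X Y Z where "X = law_PQ cubA p q r b a c" and "Y = law_PP cubA q p r b a c" and "Z = law_RP q p r a b c"
  have row: "(X, Y, Z) \<in> law_rows cubA p q r a b c"
    by (simp add: law_rows_def X_def Y_def Z_def)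
  interpret two_points cubA p q r a b c
    by (rule on_curve_two_points[OF t])
  have val: "?e X = - (?e a ^ 2 * ?e p * ?e q)" "?e Y = ?e q ^ 2 * ?e b * ?e a"
    "?e Z = ?e p ^ 2 * ?e c * ?e a - ?e b ^ 2 * ?e r * ?e q"
    by (simp_all add: X_def Y_def Z_def law_defs)
  then have nz: "?e X \<noteq> 0" "?e Y \<noteq> 0"
    using b by simp_all
  then have "X \<noteq> 0" "Y \<noteq> 0"
    by auto
  then have on: "on_curve (2 * int (d v) + 2 * int (d w)) X Y Z"
    using law_rows_curve[OF row] t unfolding on_curve_def X_def Y_def Z_def by (auto intro: homog_law)
  have sum: "V_add v w = pt X Y Z"
    unfolding v(2) w(2) by (rule V_add_row[OF t row on])
  have "(?e p ^ 2 * ?e c * ?e a - ?e b ^ 2 * ?e r * ?e q) * - (?e a ^ 2 * ?e p * ?e q) / (?e q ^ 2 * ?e b * ?e a) ^ 2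
      = ?e r * ?e p / ?e q ^ 2 - ?e p ^ 3 * (?e c * ?e a / ?e b ^ 2) / ?e q ^ 3"
    using b by (simp add: field_simps power2_eq_square power3_eq_cube)
  also have "\<dots> = ?e r * ?e p / ?e q ^ 2 + ?e c * ?e a / ?e b ^ 2"
    unfolding b(1) using b(3) by simp
  finally show "slope (V_add v w) = slope v + slope w"
    unfolding sum slope_sheet_pt(1)[OF on disjI1[OF nz(1)]] val unfolding slope_def v(3) w(3) prod.case .
  show "sheet (V_add v w) = sheet v * sheet w"
    unfolding sum slope_sheet_pt(2)[OF on disjI1[OF nz(1)]] val
    using b by (simp add: sheet_def v(3) w(3) field_simps power2_eq_square)
qed

lemma vanishing_slope:
  assumes prim: "primitive k p q r" and z: "ev r 1 (- 1) = 0"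
  shows "r = 0"
proof (rule ccontr)
  assume r: "r \<noteq> 0"
  note h = on_curveD[OF primitive_on_curve[OF prim]]
  obtain n where n: "k - 1 = int n"
    using homog_nonneg[OF h(3) r] zero_le_imp_eq_int by blast
  then have k: "k = int (Suc n)" by simp
  note deg = homog_dehomogenize[OF h(1)[unfolded k]] homog_dehomogenize[OF h(2)[unfolded k]]
    homog_dehomogenize[OF h(3)[unfolded n]]
  have one: "poly (poly P 1) x = ev P x 1" for P x
    by (simp add: ev_def one_pCons)
  have "poly (p ^ 3 + q ^ 3) 1 = poly (cubA * r ^ 3) 1"
    unfolding h(6) ..
  moreover have "poly cubA 1 = [:1, 0, 0, 1:]"
    by (simp add: bvx_def bvy_def power3_eq_cube one_pCons)
  ultimately have eq: "poly p 1 ^ 3 + poly q 1 ^ 3 = [:1, 0, 0, 1:] * poly r 1 ^ 3"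
    by (simp only: poly_add poly_mult poly_power)
  have no_zero: "ev p x y \<noteq> 0 \<or> ev q x y \<noteq> 0" if "(x, y) \<noteq> (0, 0)" for x y
    using prim that by (auto simp: primitive_def)
  have cop: "coprime (poly p 1) (poly q 1)"
    by (rule coprime_no_common_root) (use no_zero[of _ 1] in \<open>simp add: one\<close>)
  have top: "degree (poly p 1) = Suc n \<or> degree (poly q 1) = Suc n"
    using no_zero[of 1 0] deg le_degree by (metis le_antisym one_neq_zero prod.inject)
  \<comment> \<open>the base point \<open>(1, -1)\<close> is \<open>t = -1\<close> in the coordinate \<open>t = x/y\<close>\<close>
  have flip: "ev P (- 1) 1 = (- 1) ^ m * ev P 1 (- 1)" if "homog (int m) P" for P m
    using homog_ev_scale[OF that, of "- 1" 1 "- 1"] by simp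
  have "poly (poly p 1) (- 1) \<noteq> 0" "poly (poly q 1) (- 1) \<noteq> 0" "poly (poly r 1) (- 1) = 0"
    unfolding one using flip[OF h(1)[unfolded k]] flip[OF h(2)[unfolded k]] flip[OF h(3)[unfolded n]]
      primitive_base[OF prim] z by simp_all
  then have R: "poly r 1 = 0"
    using vanishing_slope_univariate[OF eq cop deg(1,3,5) top] by blast
  have "bvy * r = 0"
  proof (rule bipoly_eqI)
    fix x y
    show "ev (bvy * r) x y = ev 0 x y"
    proof (cases "y = 0")
      case False
      then have "ev r x y = y ^ n * ev r (x / y) 1"
        using homog_ev_scale[OF h(3)[unfolded n], of y "x / y" 1] by simp
      then show ?thesis
        unfolding one[symmetric] R by simp
    qed simp
  qed
  with r show False
    by (simp add: bvy_def)
qed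

lemma slope_sheet_zero: "V_zero \<in> V" "slope V_zero = 0" "sheet V_zero = 1"
  unfolding V_zero_def using pt_in_V[OF on_curve_zero] slope_sheet_pt[OF on_curve_zero] by simp_all

lemma sheet_cube: "v \<in> V \<Longrightarrow> sheet v ^ 3 = 1"
proof -
  assume "v \<in> V"
  then obtain p q r where v: "primitive (int (d v)) p q r" "rep v = (p, q, r)"
    using V_repE by blast
  show ?thesis
    using primitive_base[OF v(1)] by (simp add: sheet_def v(2) power_divide)
qed

lemma slope_sheet_minus:
  assumes "primitive k p q r"
  shows "slope (pt q p r) = - slope (pt p q r)" "sheet (pt q p r) * sheet (pt p q r) = 1"
proof -
  let ?e = "\<lambda>P. ev P 1 (- 1)"
  note c = primitive_on_curve[OF assms] and b = primitive_base[OF assms]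
  have "?e r * ?e q / ?e p ^ 2 = - (?e r * - (?e q ^ 3) / (?e p ^ 2 * ?e q ^ 2))"
    using b(2,3) by (simp add: field_simps power2_eq_square power3_eq_cube)
  also have "\<dots> = - (?e r * ?e p / ?e q ^ 2)"
    unfolding b(1)[symmetric] using b(2,3) by (simp add: field_simps power2_eq_square power3_eq_cube)
  finally show "slope (pt q p r) = - slope (pt p q r)"
    using slope_sheet_pt(1)[OF c] slope_sheet_pt(1)[OF on_curve_minus[OF c]] b by simp
  show "sheet (pt q p r) * sheet (pt p q r) = 1"
    using slope_sheet_pt(2)[OF c] slope_sheet_pt(2)[OF on_curve_minus[OF c]] b by simp
qed

lemma infinite_point:
  assumes "primitive k p q r" "r = 0"
  shows "k = 0" "p ^ 3 + q ^ 3 = 0"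
proof -
  note h = on_curveD[OF primitive_on_curve[OF assms(1)]]
  show eq: "p ^ 3 + q ^ 3 = 0"
    using h(6) assms(2) by simp
  have "ev p x y \<noteq> 0" if "(x, y) \<noteq> (0, 0)" for x y
  proof
    assume z: "ev p x y = 0"
    have "ev (p ^ 3 + q ^ 3) x y = 0"
      unfolding eq by simp
    with z have "ev q x y = 0" by simp
    with z that assms(1) show False
      by (auto simp: primitive_def)
  qed
  then show "k = 0"
    using form_without_zeros_degree[OF h(1)] by blast
qed

lemma trivial_kernel:
  assumes "v \<in> V" "slope v = 0" "sheet v = 1"
  shows "v = V_zero"
proof -
  obtain p q r where v: "primitive (int (d v)) p q r" "v = pt p q r" "rep v = (p, q, r)"
    using V_repE[OF assms(1)] by blast
  note c = primitive_on_curve[OF v(1)] and b = primitive_base[OF v(1)]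
  have "ev r 1 (- 1) = 0"
    using assms(2) b by (simp add: slope_def v(3))
  then have r: "r = 0"
    using vanishing_slope[OF v(1)] by blast
  have e: "ev q 1 (- 1) = - ev p 1 (- 1)"
    using assms(3) b(2) unfolding sheet_def v(3) prod.case by (rule eq_minus_of_quotient)
  have "(p + q) * (p ^ 2 - p * q + q ^ 2) = p ^ 3 + q ^ 3"
    by (simp add: power2_eq_square power3_eq_cube algebra_simps)
  then have "p + q = 0 \<or> p ^ 2 - p * q + q ^ 2 = 0"
    unfolding infinite_point(2)[OF v(1) r] by simp
  moreover have "ev (p ^ 2 - p * q + q ^ 2) 1 (- 1) \<noteq> 0"
    using e b by (simp add: power2_eq_square)
  ultimately have "q = - p"
    by (metis add_eq_0_iff ev_simps(6))
  then have "same_pt p q r 1 (- 1) 0"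
    by (simp add: same_pt_def r)
  then show ?thesis
    unfolding v(2) V_zero_def using pt_eq_iff[OF c on_curve_zero] by blast
qed

text \<open>
  The difference of the two points has slope \<open>0\<close> and sheet \<open>1\<close>, so it is zero.
\<close>

lemma slope_sheet_inj:
  assumes "v \<in> V" "w \<in> V" "slope v = slope w" "sheet v = sheet w"
  shows "v = w"
proof -
  obtain p q r where v: "primitive (int (d v)) p q r" "v = pt p q r"
    using V_repE[OF assms(1)] by blast
  obtain a b c where w: "primitive (int (d w)) a b c" "w = pt a b c"
    using V_repE[OF assms(2)] by blast
  have minus: "pt b a c \<in> V"
    by (rule pt_in_V[OF on_curve_minus[OF primitive_on_curve[OF w(1)]]])
  have "slope (V_add v (pt b a c)) = 0" "sheet (V_add v (pt b a c)) = 1"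
    using slope_sheet_add[OF assms(1) minus] slope_sheet_minus[OF w(1)] assms(3,4)
    by (simp_all add: w(2)[symmetric] mult.commute)
  then have "V_add v (pt b a c) = V_zero"
    using trivial_kernel V_add_closed[OF assms(1) minus] by blast
  then show ?thesis
    using V_add_minus_eq_zero[OF primitive_on_curve[OF v(1)] primitive_on_curve[OF w(1)]] v(2) w(2) by simp
qed

text \<open>
  All group axioms are pulled back along the injective additive map (slope, sheet).
\<close>

lemma comm_group_V: "comm_group V_group"
proof (rule comm_groupI)
  fix x y z
  assume V: "x \<in> carrier V_group" "y \<in> carrier V_group"
  then show "x \<otimes>\<^bsub>V_group\<^esub> y \<in> carrier V_group"
    by (simp add: V_group_def V_add_closed)
  show "x \<otimes>\<^bsub>V_group\<^esub> y = y \<otimes>\<^bsub>V_group\<^esub> x"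
    using V unfolding V_group_def
    by (intro slope_sheet_inj) (simp_all add: V_add_closed slope_sheet_add)
  assume "z \<in> carrier V_group"
  with V show "x \<otimes>\<^bsub>V_group\<^esub> y \<otimes>\<^bsub>V_group\<^esub> z = x \<otimes>\<^bsub>V_group\<^esub> (y \<otimes>\<^bsub>V_group\<^esub> z)"
    unfolding V_group_def
    by (intro slope_sheet_inj) (simp_all add: V_add_closed slope_sheet_add)
next
  show "\<one>\<^bsub>V_group\<^esub> \<in> carrier V_group"
    by (simp add: V_group_def slope_sheet_zero)
next
  fix x assume x: "x \<in> carrier V_group"
  then show "\<one>\<^bsub>V_group\<^esub> \<otimes>\<^bsub>V_group\<^esub> x = x"
    unfolding V_group_def
    by (intro slope_sheet_inj) (simp_all add: V_add_closed slope_sheet_add slope_sheet_zero)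
  obtain p q r where v: "primitive (int (d x)) p q r" "x = pt p q r"
    using V_repE[of x] x unfolding V_group_def partial_object.select_convs by blast
  have minus: "pt q p r \<in> V"
    by (rule pt_in_V[OF on_curve_minus[OF primitive_on_curve[OF v(1)]]])
  moreover have "V_add (pt q p r) x = V_zero"
    using x slope_sheet_minus[OF v(1)] minus unfolding V_group_def
    by (intro slope_sheet_inj) (simp_all add: V_add_closed slope_sheet_add slope_sheet_zero v(2))
  ultimately show "\<exists>y\<in>carrier V_group. y \<otimes>\<^bsub>V_group\<^esub> x = \<one>\<^bsub>V_group\<^esub>"
    unfolding V_group_def by auto
qed

section \<open>Degrees of sums and of compositions\<close>

lemma ev_law:
  "ev (law_PP cubA p q r a b c) x y =
    law_PP (x ^ 3 + y ^ 3) (ev p x y) (ev q x y) (ev r x y) (ev a x y) (ev b x y) (ev c x y)"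
  "ev (law_PQ cubA p q r a b c) x y =
    law_PQ (x ^ 3 + y ^ 3) (ev p x y) (ev q x y) (ev r x y) (ev a x y) (ev b x y) (ev c x y)"
  by (simp_all add: law_defs)

lemma is_sum_of_V_add:
  assumes "on_curve k p q r" "on_curve l a b c" "on_curve m P Q R" "V_add (pt p q r) (pt a b c) = pt P Q R"
  shows "is_sum p q r a b c P Q R"
proof -
  obtain X Y Z where sum: "on_curve (2 * k + 2 * l) X Y Z" "is_sum p q r a b c X Y Z"
    using is_sum_exists[OF assms(1,2)] by blast
  have "pt P Q R = pt X Y Z"
    using V_add_pt[OF assms(1,2) sum] assms(4) by simp
  then have eq: "same_pt P Q R X Y Z"
    using pt_eq_iff[OF assms(3) sum(1)] by blast
  show ?thesis
    unfolding is_sum_def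
  proof clarify
    fix A B C assume "(A, B, C) \<in> law_rows cubA p q r a b c"
    then have "same_pt X Y Z A B C"
      using sum(2) unfolding is_sum_def by blast
    then show "same_pt P Q R A B C"
      by (rule same_pt_trans[OF eq _ on_curveD(4)[OF sum(1)]])
  qed
qed

text \<open>
  Let \<open>S\<close> and \<open>D\<close> be primitive representatives of \<open>v + w\<close> and \<open>v - w\<close>. The addition matrix is
  proportional to the sum in its rows and to the difference in its columns, so by coprimality its
  entries are \<open>\<kappa> D\<^sub>i S\<^sub>j\<close> for a form \<open>\<kappa>\<close>. By completeness \<open>\<kappa>\<close> has no zeros, so it is constant, and
  the degrees of the two sides are \<open>2 d v + 2 d w\<close> and \<open>d (v - w) + d (v + w)\<close>.
\<close>

lemma parallelogram:
  assumes v: "primitive k p q r" and w: "primitive l a b c"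
  shows "int (d (V_add (pt p q r) (pt a b c))) + int (d (V_add (pt p q r) (pt b a c))) = 2 * k + 2 * l"
proof -
  note t = primitive_on_curve[OF v] primitive_on_curve[OF w]
  note t' = t(1) on_curve_minus[OF t(2)]
  define m n where "m = int (d (V_add (pt p q r) (pt a b c)))" and "n = int (d (V_add (pt p q r) (pt b a c)))"
  have mem: "V_add (pt p q r) (pt a b c) \<in> V" "V_add (pt p q r) (pt b a c) \<in> V"
    using V_add_closed pt_in_V t t' by blast+
  obtain P Q R where "primitive m P Q R" "V_add (pt p q r) (pt a b c) = pt P Q R"
      "rep (V_add (pt p q r) (pt a b c)) = (P, Q, R)"
    unfolding m_def by (rule V_repE[OF mem(1)])
  note S = this(1,2)
  obtain P' Q' R' where "primitive n P' Q' R'" "V_add (pt p q r) (pt b a c) = pt P' Q' R'"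
      "rep (V_add (pt p q r) (pt b a c)) = (P', Q', R')"
    unfolding n_def by (rule V_repE[OF mem(2)])
  note D = this(1,2)
  note s = primitive_on_curve[OF S(1)] and s' = primitive_on_curve[OF D(1)]
  define PP PQ QP QQ where "PP = law_PP cubA p q r a b c" and "PQ = law_PQ cubA p q r a b c"
    and "QP = law_PQ cubA p q r b a c" and "QQ = law_PP cubA q p r b a c"
  have row: "P * PQ = PP * Q" "P * QQ = QP * Q"
    using is_sum_of_V_add[OF t s S(2)] unfolding is_sum_def law_rows_def PP_def PQ_def QP_def QQ_def
    by (simp_all add: same_pt_def)
  have col: "P' * QP = PP * Q'"
    using is_sum_of_V_add[OF t' s' D(2)] unfolding is_sum_def law_rows_def PP_def PQ_def QP_def QQ_def
    by (simp add: same_pt_def law_swap)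
  have nz: "P \<noteq> 0" "P' \<noteq> 0"
    using s s' by (simp_all add: on_curve_def)
  have "P dvd PP * Q" "P dvd QP * Q"
    using row by (metis dvd_triv_left)+
  then have "P dvd PP" "P dvd QP"
    using primitive_coprime[OF S(1)] by (simp_all add: coprime_dvd_mult_left_iff)
  then obtain \<alpha> \<beta> where \<alpha>: "PP = P * \<alpha>" and \<beta>: "QP = P * \<beta>"
    by (auto elim!: dvdE)
  have "P * (P' * \<beta>) = P * (\<alpha> * Q')"
    using col unfolding \<alpha> \<beta> by (simp only: ac_simps)
  then have \<beta>': "P' * \<beta> = \<alpha> * Q'"
    using nz by simp
  then have "P' dvd \<alpha>"
    using primitive_coprime[OF D(1)] by (metis coprime_dvd_mult_left_iff dvd_triv_left)
  then obtain \<kappa> where \<kappa>: "\<alpha> = P' * \<kappa>" ..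
  have "P' * \<beta> = P' * (\<kappa> * Q')"
    unfolding \<beta>' \<kappa> by (rule mult.assoc)
  then have \<beta>'': "\<beta> = \<kappa> * Q'"
    using nz by simp
  have "P * PQ = P * (\<kappa> * P' * Q)" "P * QQ = P * (\<kappa> * Q' * Q)"
    unfolding row \<alpha> \<beta> \<kappa> \<beta>'' by (simp_all only: ac_simps)
  then have block: "PP = \<kappa> * P' * P" "PQ = \<kappa> * P' * Q" "QP = \<kappa> * Q' * P" "QQ = \<kappa> * Q' * Q"
    using nz \<alpha> \<beta> \<kappa> \<beta>'' by simp_all
  have no_zero: "ev \<kappa> x y \<noteq> 0" if xy: "(x, y) \<noteq> (0, 0)" for x y
  proof
    assume "ev \<kappa> x y = 0"
    then have "ev PP x y = 0" "ev PQ x y = 0" "ev QP x y = 0" "ev QQ x y = 0"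
      unfolding block by simp_all
    note zero = this[unfolded PP_def PQ_def QP_def QQ_def ev_law]
    have curve: "two_points (x ^ 3 + y ^ 3) (ev p x y) (ev q x y) (ev r x y) (ev a x y) (ev b x y) (ev c x y)"
      using ev_curve[OF t(1)] ev_curve[OF t(2)] by unfold_locales
    have "ev p x y \<noteq> 0 \<or> ev q x y \<noteq> 0" "ev a x y \<noteq> 0 \<or> ev b x y \<noteq> 0"
      using v w xy unfolding primitive_def by blast+
    from law_complete[OF curve this] zero show False
      by blast
  qed
  then have "\<kappa> \<noteq> 0"
    by (metis ev_simps(6) one_neq_zero prod.inject)
  then have PP: "PP \<noteq> 0"
    unfolding block using nz by simp
  have deg: "homog (2 * k + 2 * l) PP"
    unfolding PP_def using t by (auto simp: on_curve_def intro: homog_law)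
  have "\<kappa> dvd PP"
    unfolding block by (simp add: mult.assoc)
  then obtain i where i: "homog i \<kappa>"
    using homog_dvd[OF deg PP] by blast
  then have "i = 0"
    using form_without_zeros_degree no_zero by blast
  with i have "homog (0 + n + m) PP"
    unfolding block using s s' by (intro homog_mult) (auto simp: on_curve_def)
  then have "m + n = 2 * k + 2 * l"
    using homog_unique[OF _ deg PP] by fastforce
  then show ?thesis
    by (simp add: m_def n_def)
qed

text \<open>
  Forms without common zeros remain so after substitution of forms without common zeros, so no
  factor has to be cancelled and degrees multiply.
\<close>

lemma V_comp_primitive:
  assumes "v \<in> V" "w \<in> V" "rep v = (p, q, r)" "rep w = (a, b, c)"
  shows "V_comp v w = pt (bsubst p a b) (bsubst q a b) (c * bsubst r a b)"
    "primitive (int (d v) * int (d w)) (bsubst p a b) (bsubst q a b) (c * bsubst r a b)"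
proof -
  have v: "primitive (int (d v)) p q r" and w: "primitive (int (d w)) a b c"
    using V_repE[OF assms(1)] V_repE[OF assms(2)] assms(3,4) by (metis prod.inject)+
  note hv = on_curveD[OF primitive_on_curve[OF v]] and hw = on_curveD[OF primitive_on_curve[OF w]]
  show "V_comp v w = pt (bsubst p a b) (bsubst q a b) (c * bsubst r a b)"
    by (simp add: V_comp_def assms(3,4))
  let ?p = "bsubst p a b" and ?q = "bsubst q a b" and ?r = "c * bsubst r a b"
  have eq: "?p ^ 3 + ?q ^ 3 = cubA * ?r ^ 3"
    by (rule bipoly_eqI)
      (simp add: ev_curve[OF primitive_on_curve[OF v]] ev_curve[OF primitive_on_curve[OF w]] power_mult_distrib)
  have nz: "ev ?p x y \<noteq> 0 \<or> ev ?q x y \<noteq> 0" if "(x, y) \<noteq> (0, 0)" for x y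
    using v w that unfolding primitive_def by simp
  then have "?p \<noteq> 0 \<or> ?q \<noteq> 0"
    by (metis ev_simps(6) one_neq_zero prod.inject)
  then have "?p \<noteq> 0 \<and> ?q \<noteq> 0"
    by (rule nonzero_curve[OF eq])
  moreover have "homog (int (d v) * int (d w)) ?p" "homog (int (d v) * int (d w)) ?q"
    using homog_bsubst hv hw by blast+
  moreover have "homog (int (d w) - 1 + (int (d v) - 1) * int (d w)) ?r"
    using homog_mult[OF hw(3) homog_bsubst[OF hv(3) hw(1,2)]] .
  then have "homog (int (d v) * int (d w) - 1) ?r"
    by (simp add: algebra_simps)
  ultimately show "primitive (int (d v) * int (d w)) ?p ?q ?r"
    using eq nz unfolding primitive_def on_curve_def by blast
qed

lemma d_comp:
  assumes "v \<in> V" "w \<in> V"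
  shows "V_comp v w \<in> V" "d (V_comp v w) = d v * d w"
proof -
  obtain p q r where rep_v: "rep v = (p, q, r)"
    by (rule prod_cases3)
  obtain a b c where rep_w: "rep w = (a, b, c)"
    by (rule prod_cases3)
  note comp = V_comp_primitive[OF assms rep_v rep_w]
  show "V_comp v w \<in> V"
    unfolding comp(1) by (rule pt_in_V[OF primitive_on_curve[OF comp(2)]])
  have "int (d (V_comp v w)) = int (d v * d w)"
    unfolding comp(1) d_pt[OF comp(2)] by simp
  then show "d (V_comp v w) = d v * d w"
    by (simp only: of_nat_eq_iff)
qed

text \<open>
  A point of sheet \<open>1\<close> maps the base point \<open>(1, -1)\<close> to a multiple of itself, so the values of the
  composite there are those of the left factor up to scaling.
\<close>

lemma slope_sheet_comp:
  assumes "v \<in> V" "w \<in> V" "sheet w = 1"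
  shows "slope (V_comp v w) = slope v * slope w" "sheet (V_comp v w) = sheet v"
proof -
  obtain p q r where v: "primitive (int (d v)) p q r" "rep v = (p, q, r)"
    using V_repE[OF assms(1)] by blast
  obtain a b c where w: "primitive (int (d w)) a b c" "rep w = (a, b, c)"
    using V_repE[OF assms(2)] by blast
  let ?e = "\<lambda>P. ev P 1 (- 1)"
  note hv = on_curveD[OF primitive_on_curve[OF v(1)]]
  note bv = primitive_base[OF v(1)] and bw = primitive_base[OF w(1)]
  note comp = V_comp_primitive[OF assms(1,2) v(2) w(2)]
  have ab: "?e b = - ?e a"
    using assms(3) bw(2) unfolding sheet_def w(2) prod.case by (rule eq_minus_of_quotient)
  have scale: "ev P (?e a) (?e b) = ?e a ^ n * ?e P" if "homog (int n) P" for P n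
    using homog_ev_scale[OF that, of "?e a" 1 "- 1"] by (simp add: ab)
  have P: "?e (bsubst p a b) = ?e a ^ d v * ?e p" and Q: "?e (bsubst q a b) = ?e a ^ d v * ?e q"
    using scale[OF hv(1)] scale[OF hv(2)] by simp_all
  have R: "?e a * ?e (bsubst r a b) = ?e a ^ d v * ?e r"
  proof (cases "r = 0")
    case True
    then show ?thesis by (simp add: bsubst_def)
  next
    case False
    then obtain n where n: "int (d v) - 1 = int n"
      using homog_nonneg[OF hv(3)] zero_le_imp_eq_int by blast
    then have "d v = Suc n" by simp
    then show ?thesis
      using scale[OF hv(3)[unfolded n]] by simp
  qed
  have nz: "?e (bsubst p a b) \<noteq> 0"
    unfolding P using bv bw by simp
  note val = slope_sheet_pt[OF primitive_on_curve[OF comp(2)] disjI1[OF nz]]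
  have R': "?e (c * bsubst r a b) = ?e c * (?e a ^ d v * ?e r) / ?e a"
    unfolding R[symmetric] using bw by simp
  have "slope (V_comp v w) = ?e c * (?e a ^ d v * ?e r) / ?e a * (?e a ^ d v * ?e p) / (?e a ^ d v * ?e q) ^ 2"
    unfolding comp(1) val(1) R' P Q ..
  also have "\<dots> = slope v * slope w"
    unfolding slope_def v(2) w(2) prod.case ab using bv bw by (simp add: field_simps power2_eq_square)
  finally show "slope (V_comp v w) = slope v * slope w" .
  have "sheet (V_comp v w) = - (?e a ^ d v * ?e q) / (?e a ^ d v * ?e p)"
    unfolding comp(1) val(2) P Q ..
  also have "\<dots> = sheet v"
    unfolding sheet_def v(2) prod.case using bw by simp
  finally show "sheet (V_comp v w) = sheet v" .
qed

section \<open>Multiplicative quadratic forms on subrings of the complex numbers\<close>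

text \<open>
  With nonpositive discriminant the two roots are conjugate, and \<open>n\<close> is their product.
\<close>

lemma root_of_real_quadratic:
  fixes x :: complex and T n :: int
  assumes eq: "x ^ 2 - of_int T * x + of_int n = 0" and disc: "T ^ 2 \<le> 4 * n"
  shows "cmod x ^ 2 = of_int n"
proof -
  have im: "(2 * Re x - of_int T) * Im x = 0"
    using arg_cong[OF eq, of Im] by (simp add: power2_eq_square algebra_simps)
  have re: "(Re x) ^ 2 - (Im x) ^ 2 - of_int T * Re x + of_int n = 0"
    using arg_cong[OF eq, of Re] by (simp add: power2_eq_square)
  have disc': "(of_int T :: real) ^ 2 \<le> 4 * of_int n"
    using disc by (metis of_int_le_iff of_int_mult of_int_numeral of_int_power)
  have T: "2 * Re x = of_int T"
  proof (cases "Im x = 0")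
    case True
    have "(2 * Re x - of_int T) ^ 2 = 4 * ((Re x) ^ 2 - (Im x) ^ 2 - of_int T * Re x + of_int n)
        + ((of_int T) ^ 2 - 4 * of_int n)"
      using True by (simp add: power2_eq_square algebra_simps)
    then have "(2 * Re x - of_int T) ^ 2 \<le> 0"
      using re disc' by simp
    then show ?thesis by simp
  qed (use im in simp)
  have "of_int n = (Re x) ^ 2 + (Im x) ^ 2"
    using re unfolding T[symmetric] by (simp add: power2_eq_square)
  then show ?thesis
    by (simp add: cmod_power2)
qed

text \<open>
  A composition algebra over the integers whose elements are complex numbers. The slopes of the
  points of sheet \<open>1\<close>, with the degree as norm, will be an instance.
\<close>

locale multiplicative_quadratic_form =
  fixes S :: "complex set" and N :: "complex \<Rightarrow> int"
  assumes one: "1 \<in> S" and minus: "x \<in> S \<Longrightarrow> - x \<in> S"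
    and add: "x \<in> S \<Longrightarrow> y \<in> S \<Longrightarrow> x + y \<in> S" and mult: "x \<in> S \<Longrightarrow> y \<in> S \<Longrightarrow> x * y \<in> S"
    and nonneg: "x \<in> S \<Longrightarrow> 0 \<le> N x" and definite: "x \<in> S \<Longrightarrow> N x = 0 \<Longrightarrow> x = 0"
    and N_one: "N 1 = 1"
    and N_mult: "x \<in> S \<Longrightarrow> y \<in> S \<Longrightarrow> N (x * y) = N x * N y"
    and parallelogram: "x \<in> S \<Longrightarrow> y \<in> S \<Longrightarrow> N (x + y) + N (x - y) = 2 * N x + 2 * N y"
begin

lemma diff: "x \<in> S \<Longrightarrow> y \<in> S \<Longrightarrow> x - y \<in> S"
  using add[of x "- y"] minus by simp

lemma zero: "0 \<in> S"
  using diff[OF one one] by simp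

lemma N_zero: "N 0 = 0"
  using parallelogram[OF zero zero] by simp

lemma N_minus: "x \<in> S \<Longrightarrow> N (- x) = N x"
  using parallelogram[OF zero, of x] by (simp add: N_zero)

text \<open>
  The theorem of Jordan and von Neumann: the parallelogram law makes the polar form
  \<open>N (x + y) - N x - N y\<close> biadditive.
\<close>

lemma N_three_terms:
  assumes "x \<in> S" "y \<in> S" "z \<in> S"
  shows "N (x + y + z) = N (x + y) + N (y + z) + N (x + z) - N x - N y - N z"
proof -
  have "N (x + y + z) + N (x + z - y) = 2 * N (x + z) + 2 * N y"
    using parallelogram[of "x + z" y] add assms by (simp add: algebra_simps)
  moreover have "N (x + y + z) + N (x + y - z) = 2 * N (x + y) + 2 * N z"
    using parallelogram[of "x + y" z] add assms by simp
  moreover have "N (x + z - y) + N (x + y - z) = 2 * N x + 2 * N (z - y)"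
    using parallelogram[of x "z - y"] diff assms by (simp add: algebra_simps)
  moreover have "N (y + z) + N (z - y) = 2 * N y + 2 * N z"
    using parallelogram[of z y] assms by (simp add: add.commute)
  ultimately show ?thesis
    by linarith
qed

lemma N_add_nat_multiple:
  assumes x: "x \<in> S" and y: "y \<in> S"
  shows "y + of_nat k * x \<in> S \<and> N (y + of_nat k * x) = N y + int k * (N (x + y) - N x - N y) + int k ^ 2 * N x"
proof (induction k rule: induct_nat_012)
  case 0
  then show ?case using y by simp
next
  case 1
  then show ?case using add[OF y x] by (simp add: add.commute)
next
  case (ge2 k)
  let ?y = "y + of_nat (Suc k) * x"
  have "?y + x \<in> S"
    using ge2(2) add x by blast
  moreover have "N (?y + x) + N (?y - x) = 2 * N ?y + 2 * N x"
    using parallelogram[of ?y x] ge2(2) x by blast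
  moreover have "?y + x = y + of_nat (Suc (Suc k)) * x" "?y - x = y + of_nat k * x"
    by (simp_all add: algebra_simps)
  ultimately show ?case
    using ge2 by (simp add: power2_eq_square algebra_simps)
qed

lemma N_add_int_multiple:
  assumes x: "x \<in> S" and y: "y \<in> S"
  shows "y + of_int k * x \<in> S" "N (y + of_int k * x) = N y + k * (N (x + y) - N x - N y) + k ^ 2 * N x"
proof -
  have "N (y - x) = 2 * N x + 2 * N y - N (x + y)"
    using parallelogram[OF y x] by (simp add: add.commute)
  then have flip: "N (- x + y) - N x - N y = - (N (x + y) - N x - N y)"
    by simp
  have "y + of_int k * x \<in> S \<and> N (y + of_int k * x) = N y + k * (N (x + y) - N x - N y) + k ^ 2 * N x"
  proof (cases k)
    case (nonneg n)
    then show ?thesis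
      using N_add_nat_multiple[OF x y, of n] by simp
  next
    case (neg n)
    have 1: "y + of_nat (Suc n) * (- x) = y + of_int k * x"
      by (simp add: neg algebra_simps)
    have 2: "int (Suc n) * - (N (x + y) - N x - N y) = k * (N (x + y) - N x - N y)" "int (Suc n) ^ 2 = k ^ 2"
      unfolding neg by (simp_all add: power2_eq_square algebra_simps)
    show ?thesis
      using N_add_nat_multiple[OF minus[OF x] y, of "Suc n"] unfolding N_minus[OF x] flip 1 2 .
  qed
  then show "y + of_int k * x \<in> S" "N (y + of_int k * x) = N y + k * (N (x + y) - N x - N y) + k ^ 2 * N x"
    by blast+
qed

text \<open>
  With the integers \<open>n = N x\<close> and \<open>T = N (x + 1) - N x - 1\<close> (norm and trace) the element
  \<open>x\<^sup>2 - T x + n\<close> has norm zero, as in every composition algebra, so it is zero. As \<open>N\<close> is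
  nonnegative at \<open>2 x - T\<close>, the discriminant \<open>T\<^sup>2 - 4 n\<close> is nonpositive.
\<close>

theorem form_is_norm:
  assumes x: "x \<in> S"
  shows "of_int (N x) = cmod x ^ 2"
proof -
  define n T where "n = N x" and "T = N (x + 1) - N x - 1"
  note x1 = add[OF x one] and xx = mult[OF x x]
  have a: "N (x ^ 2) = n ^ 2"
    using N_mult[OF x x] by (simp add: n_def power2_eq_square)
  have b: "N (x + 1) = n + 1 + T"
    by (simp add: n_def T_def)
  have c: "N (x ^ 2 + x) = n * (n + 1 + T)"
  proof -
    have "x ^ 2 + x = x * (x + 1)"
      by (simp add: power2_eq_square algebra_simps)
    then show ?thesis
      using N_mult[OF x x1] unfolding b n_def[symmetric] by (simp only:)
  qed
  have sq: "x ^ 2 \<in> S" "x ^ 2 + 1 \<in> S"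
    using xx add[OF xx one] by (simp_all add: power2_eq_square)
  have e: "N (x ^ 2 + 1 + x) = n * T + T + n + N (x ^ 2 + 1)"
    using N_three_terms[OF sq(1) one x] a b c N_one by (simp add: n_def[symmetric] power2_eq_square algebra_simps)
  have "N ((x + 1) ^ 2) = (n + 1 + T) ^ 2"
    using N_mult[OF x1 x1] b by (simp add: power2_eq_square)
  moreover have "N ((x + 1) ^ 2) = N (x ^ 2 + 1) + 2 * (n * T + T) + 4 * n"
    using N_add_int_multiple(2)[OF x sq(2), of 2] e
    by (simp add: n_def[symmetric] power2_eq_square algebra_simps)
  ultimately have f: "N (x ^ 2 + 1) = n ^ 2 - 2 * n + 1 + T ^ 2"
    by (simp add: power2_eq_square algebra_simps)
  define y where "y = x ^ 2 + of_int (- T) * x"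
  have y: "y \<in> S" "N y = n ^ 2"
    using N_add_int_multiple[OF x sq(1), of "- T"] a c
    by (simp_all add: y_def n_def[symmetric] power2_eq_square algebra_simps)
  have y1: "N (1 + y) = n ^ 2 - 2 * n + 1"
    using N_add_int_multiple(2)[OF x sq(2), of "- T"] e f
    by (simp add: y_def n_def[symmetric] power2_eq_square algebra_simps)
  have "N (y + of_int n * 1) = 0"
    unfolding N_add_int_multiple(2)[OF one y(1), of n] y(2) N_one y1
    by (simp add: power2_eq_square algebra_simps)
  then have "y + of_int n * 1 = 0"
    using definite N_add_int_multiple(1)[OF one y(1)] by blast
  then have root: "x ^ 2 - of_int T * x + of_int n = 0"
    by (simp add: y_def)
  have "x + x \<in> S" "N (x + x) = 4 * n"
    using add[OF x x] parallelogram[OF x x] by (simp_all add: N_zero n_def)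
  moreover have "N (1 + (x + x)) = 1 + 2 * T + 4 * n"
    using N_add_int_multiple(2)[OF x one, of 2] b N_one by (simp add: n_def[symmetric] algebra_simps)
  ultimately have "N (x + x + of_int (- T) * 1) = 4 * n - T ^ 2" "x + x + of_int (- T) * 1 \<in> S"
    using N_add_int_multiple[OF one, of "x + x" "- T"] N_one by (simp_all add: power2_eq_square algebra_simps)
  then have "T ^ 2 \<le> 4 * n"
    using nonneg[of "x + x + of_int (- T) * 1"] by simp
  then show ?thesis
    using root_of_real_quadratic[OF root] by (simp add: n_def)
qed

end

section \<open>Eisenstein integers\<close>

lemma omega_cis: "omega = cis (2 * pi / 3)"
  by (simp add: omega_def cis_conv_exp mult.commute)

lemma omega_Re_Im: "Re omega = - 1 / 2" "Im omega = sqrt 3 / 2"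
  by (simp_all add: omega_cis cos_120 sin_120)

lemma cmod_omega: "cmod omega = 1"
  by (simp add: omega_cis)

lemma omega_cube: "omega ^ 3 = 1"
  by (simp add: omega_cis DeMoivre)

lemma cnj_omega: "cnj omega = omega ^ 2"
proof -
  have "omega ^ 2 * omega = cnj omega * omega"
    using omega_cube cmod_omega by (simp add: power3_eq_cube power2_eq_square mult.assoc complex_norm_square[symmetric] mult.commute[of "cnj omega"])
  moreover have "omega \<noteq> 0"
    using cmod_omega by auto
  ultimately show ?thesis
    by simp
qed

lemma omega_square: "omega ^ 2 = - 1 - omega"
  unfolding cnj_omega[symmetric] by (simp add: complex_eq_iff omega_Re_Im)

lemma eisenstein_norm:
  fixes a b :: real
  shows "cmod (of_real a + of_real b * cnj omega) ^ 2 = a ^ 2 - a * b + b ^ 2"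
proof -
  have "cmod (of_real a + of_real b * cnj omega) ^ 2 = (a - b / 2) ^ 2 + (b * sqrt 3 / 2) ^ 2"
    by (simp add: cmod_power2 omega_Re_Im)
  also have "\<dots> = a ^ 2 - a * b + b ^ 2"
    by (simp add: power_mult_distrib power_divide) (simp add: power2_eq_square field_simps)
  finally show ?thesis .
qed

lemma eisenstein_eq_iff:
  "of_int m + of_int n * cnj omega = of_int m' + of_int n' * cnj omega \<longleftrightarrow> m = m' \<and> n = n'"
  by (auto simp: complex_eq_iff omega_Re_Im)

text \<open>
  Rounding the coordinates with respect to \<open>1\<close> and the conjugate of \<open>\<omega>\<close> leaves a remainder of norm at
  most \<open>3/4\<close>.
\<close>

lemma near_eisenstein_integer:
  obtains m n :: int where "cmod (z - (of_int m + of_int n * cnj omega)) < 1"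
proof -
  \<comment> \<open>coordinates of \<open>z\<close> in the basis \<open>1\<close>, \<open>cnj omega\<close> with \<open>Re omega = - 1/2\<close>\<close>
  define b a where "b = - 2 * Im z / sqrt 3" and "a = Re z + b / 2"
  have z: "z = of_real a + of_real b * cnj omega"
    by (simp add: complex_eq_iff omega_Re_Im a_def b_def)
  define s t where "s = a - of_int (round a)" and "t = b - of_int (round b)"
  have "\<bar>s\<bar> \<le> 1 / 2" "\<bar>t\<bar> \<le> 1 / 2"
    using of_int_round_abs_le[of a] of_int_round_abs_le[of b] by (simp_all add: s_def t_def abs_minus_commute)
  then have "s ^ 2 \<le> (1 / 2) ^ 2" "t ^ 2 \<le> (1 / 2) ^ 2"
    by (simp_all add: abs_le_square_iff[symmetric])
  moreover have "\<bar>s * t\<bar> \<le> 1 / 2 * (1 / 2)"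
    unfolding abs_mult by (rule mult_mono) (use \<open>\<bar>s\<bar> \<le> 1 / 2\<close> \<open>\<bar>t\<bar> \<le> 1 / 2\<close> in auto)
  ultimately have "s ^ 2 - s * t + t ^ 2 < 1"
    by (simp add: power2_eq_square)
  moreover have "z - (of_int (round a) + of_int (round b) * cnj omega) = of_real s + of_real t * cnj omega"
    by (simp add: z s_def t_def algebra_simps)
  ultimately have "cmod (z - (of_int (round a) + of_int (round b) * cnj omega)) ^ 2 < 1"
    using eisenstein_norm by metis
  then have "cmod (z - (of_int (round a) + of_int (round b) * cnj omega)) < 1"
    by (simp add: power_less_one_iff)
  then show thesis
    by (rule that)
qed

section \<open>The structure of the group of points\<close>

lemma V_group_simps [simp]:
  "carrier V_group = V" "v \<otimes>\<^bsub>V_group\<^esub> w = V_add v w" "\<one>\<^bsub>V_group\<^esub> = V_zero"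
  by (simp_all add: V_group_def)

interpretation V: comm_group V_group
  by (rule comm_group_V)

lemma opposite_exists:
  assumes "w \<in> V"
  obtains w' where "w' \<in> V" "slope w' = - slope w" "sheet w' * sheet w = 1"
    "\<And>v. v \<in> V \<Longrightarrow> int (d (V_add v w)) + int (d (V_add v w')) = 2 * int (d v) + 2 * int (d w)"
proof -
  obtain a b c where w: "primitive (int (d w)) a b c" "w = pt a b c"
    using V_repE[OF assms] by blast
  show thesis
  proof
    show "pt b a c \<in> V"
      by (rule pt_in_V[OF on_curve_minus[OF primitive_on_curve[OF w(1)]]])
    show "slope (pt b a c) = - slope w" "sheet (pt b a c) * sheet w = 1"
      using slope_sheet_minus[OF w(1)] w(2) by simp_all
    fix v assume "v \<in> V"
    then obtain p q r where v: "primitive (int (d v)) p q r" "v = pt p q r"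
      using V_repE by blast
    show "int (d (V_add v w)) + int (d (V_add v (pt b a c))) = 2 * int (d v) + 2 * int (d w)"
      using parallelogram[OF v(1) w(1)] v(2) w(2) by simp
  qed
qed

lemma infinite_point_in_V:
  assumes "z ^ 3 = 1"
  shows "pt 1 (- bconst z) 0 \<in> V" "slope (pt 1 (- bconst z) 0) = 0" "sheet (pt 1 (- bconst z) 0) = z"
proof -
  have "1 ^ 3 + (- bconst z) ^ 3 = cubA * 0 ^ 3"
    by (rule bipoly_eqI) (simp add: assms)
  moreover have "bconst z \<noteq> 0"
    using assms by (auto simp: bconst_def)
  ultimately have c: "on_curve 0 1 (- bconst z) 0"
    by (auto simp: on_curve_def homog_one intro: homog_minus homog_const)
  then show "pt 1 (- bconst z) 0 \<in> V"
    by (rule pt_in_V)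
  show "slope (pt 1 (- bconst z) 0) = 0" "sheet (pt 1 (- bconst z) 0) = z"
    using slope_sheet_pt[OF c] by simp_all
qed

lemma affine_point:
  assumes "z ^ 3 = 1"
  defines "v \<equiv> pt (bconst z * bvx) (bconst z * bvy) 1"
  shows "v \<in> V" "slope v = z ^ 2" "sheet v = 1" "d v = 1"
proof -
  have z: "z \<noteq> 0"
    using assms by auto
  have eq: "(bconst z * bvx) ^ 3 + (bconst z * bvy) ^ 3 = cubA * 1 ^ 3"
    by (rule bipoly_eqI) (simp add: assms power_mult_distrib)
  have h: "homog 1 (bconst z * bvx)" "homog 1 (bconst z * bvy)"
    using homog_mult[OF homog_const homog_x] homog_mult[OF homog_const homog_y] by simp_all
  have "ev (bconst z * bvx) 1 0 \<noteq> ev 0 1 0" "ev (bconst z * bvy) 0 1 \<noteq> ev 0 0 1"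
    using z by simp_all
  then have "bconst z * bvx \<noteq> 0" "bconst z * bvy \<noteq> 0"
    by metis+
  with eq h have c: "on_curve 1 (bconst z * bvx) (bconst z * bvy) 1"
    by (simp add: on_curve_def homog_one)
  then have prim: "primitive 1 (bconst z * bvx) (bconst z * bvy) 1"
    using z by (auto simp: primitive_def)
  show "v \<in> V"
    unfolding v_def by (rule pt_in_V[OF c])
  have nz: "ev (bconst z * bvx) 1 (- 1) \<noteq> 0"
    using z by simp
  have "z ^ 2 * z ^ 2 = z ^ 3 * z"
    by (simp add: power2_eq_square power3_eq_cube ac_simps)
  then have "z / z ^ 2 = z ^ 2"
    using z by (simp add: assms(1) nonzero_divide_eq_eq)
  then show "slope v = z ^ 2" "sheet v = 1"
    unfolding v_def slope_sheet_pt[OF c disjI1[OF nz]] using z by simp_all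
  show "d v = 1"
    using d_pt[OF prim] by (simp add: v_def)
qed

lemma h1_eq: "h1 = pt (bconst 1 * bvx) (bconst 1 * bvy) 1"
  by (simp add: h1_def bconst_def one_pCons[symmetric])

lemma generators:
  "h0 \<in> V" "slope h0 = 0" "sheet h0 = omega"
  "h1 \<in> V" "slope h1 = 1" "sheet h1 = 1" "d h1 = 1"
  "h2 \<in> V" "slope h2 = cnj omega" "sheet h2 = 1"
  using infinite_point_in_V[OF omega_cube] affine_point[OF omega_cube] affine_point[of 1]
  unfolding h0_def h1_eq h2_def cnj_omega by simp_all

text \<open>
  A complement of the torsion subgroup; the slope is injective on it, and it is closed under
  composition.
\<close>

definition identity_component :: "point set" where
  "identity_component = {v \<in> V. sheet v = 1}"

text \<open>
  The degree, transported along the injective map \<open>slope\<close> so that it becomes a function on a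
  subring of \<open>\<complex>\<close>.
\<close>

definition degree_of_slope :: "complex \<Rightarrow> int" where
  "degree_of_slope x = int (d (THE v. v \<in> identity_component \<and> slope v = x))"

lemma degree_of_slope:
  assumes "v \<in> identity_component"
  shows "degree_of_slope (slope v) = int (d v)"
proof -
  have "(THE w. w \<in> identity_component \<and> slope w = slope v) = v"
    using assms slope_sheet_inj unfolding identity_component_def by (intro the_equality) auto
  then show ?thesis
    by (simp add: degree_of_slope_def)
qed

interpretation slopes: multiplicative_quadratic_form "slope ` identity_component" degree_of_slope
proof
  have h1: "h1 \<in> identity_component"
    using generators by (simp add: identity_component_def)
  show "1 \<in> slope ` identity_component"
    using h1 generators(5) by (metis imageI)
  show "degree_of_slope 1 = 1"
    using degree_of_slope[OF h1] generators by simp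
  fix x assume "x \<in> slope ` identity_component"
  then obtain v where v: "v \<in> V" "sheet v = 1" "x = slope v" "v \<in> identity_component"
    by (auto simp: identity_component_def)
  show "0 \<le> degree_of_slope x"
    by (simp add: degree_of_slope_def)
  obtain v' where v': "v' \<in> V" "slope v' = - slope v" "sheet v' * sheet v = 1"
    using opposite_exists[OF v(1)] by metis
  then show "- x \<in> slope ` identity_component"
    unfolding identity_component_def using v by force
  show "x = 0" if "degree_of_slope x = 0"
  proof -
    have "d v = 0"
      using that degree_of_slope[OF v(4)] v(3) by simp
    moreover obtain p q r where rep: "primitive (int (d v)) p q r" "rep v = (p, q, r)"
      using V_repE[OF v(1)] by blast
    ultimately have "homog (- 1) r"
      using on_curveD(3)[OF primitive_on_curve[OF rep(1)]] by simp
    then have "r = 0"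
      using homog_nonneg by fastforce
    then show ?thesis
      by (simp add: v(3) slope_def rep(2))
  qed
  fix y assume "y \<in> slope ` identity_component"
  then obtain w where w: "w \<in> V" "sheet w = 1" "y = slope w" "w \<in> identity_component"
    by (auto simp: identity_component_def)
  have sum: "V_add v w \<in> identity_component"
    using v w by (simp add: identity_component_def V_add_closed slope_sheet_add)
  then show "x + y \<in> slope ` identity_component"
    using slope_sheet_add(1)[OF v(1) w(1)] v(3) w(3) by (metis imageI)
  have comp: "V_comp v w \<in> identity_component"
    using v w by (simp add: identity_component_def d_comp slope_sheet_comp)
  then show "x * y \<in> slope ` identity_component"
    using slope_sheet_comp(1)[OF v(1) w(1,2)] v(3) w(3) by (metis imageI)
  show "degree_of_slope (x * y) = degree_of_slope x * degree_of_slope y"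
    using degree_of_slope[OF comp] slope_sheet_comp(1)[OF v(1) w(1,2)] d_comp(2)[OF v(1) w(1)]
      degree_of_slope[OF v(4)] degree_of_slope[OF w(4)] v(3) w(3) by simp
  obtain w' where w': "w' \<in> V" "slope w' = - slope w" "sheet w' * sheet w = 1"
    "int (d (V_add v w)) + int (d (V_add v w')) = 2 * int (d v) + 2 * int (d w)"
    using opposite_exists[OF w(1)] v(1) by metis
  have diff: "V_add v w' \<in> identity_component" "slope (V_add v w') = x - y"
    using v w w' by (simp_all add: identity_component_def V_add_closed slope_sheet_add)
  show "degree_of_slope (x + y) + degree_of_slope (x - y) = 2 * degree_of_slope x + 2 * degree_of_slope y"
    using degree_of_slope[OF sum] degree_of_slope[OF diff(1)] diff(2) slope_sheet_add(1)[OF v(1) w(1)]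
      degree_of_slope[OF v(4)] degree_of_slope[OF w(4)] v(3) w(3) w'(4) by simp
qed

lemma d_zero: "d V_zero = 0"
proof -
  have "primitive 0 1 (- 1) 0"
    using on_curve_zero by (simp add: primitive_def)
  then show ?thesis
    using d_pt by (fastforce simp: V_zero_def)
qed

lemma d_triple:
  assumes "v \<in> V"
  shows "d (V_add (V_add v v) v) = 9 * d v"
proof -
  obtain v' where v': "v' \<in> V" "slope v' = - slope v" "sheet v' * sheet v = 1"
    and par: "\<And>u. u \<in> V \<Longrightarrow> int (d (V_add u v)) + int (d (V_add u v')) = 2 * int (d u) + 2 * int (d v)"
    using opposite_exists[OF assms] by metis
  have vv: "V_add v v \<in> V"
    using assms V_add_closed by blast
  have "V_add v v' = V_zero"
    using assms v' by (intro slope_sheet_inj)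
      (simp_all add: V_add_closed slope_sheet_add slope_sheet_zero mult.commute)
  moreover have "V_add (V_add v v) v' = v"
    using assms v' vv by (intro slope_sheet_inj)
      (simp_all add: V_add_closed slope_sheet_add mult.assoc mult.commute[of "sheet v" "sheet v'"])
  ultimately show ?thesis
    using par[OF assms] par[OF vv] by (simp add: d_zero)
qed

text \<open>
  On points of sheet \<open>1\<close> this is \<open>form_is_norm\<close>. Tripling brings every point to sheet \<open>1\<close> and
  multiplies both sides by \<open>9\<close>.
\<close>

lemma d_eq_norm_slope:
  assumes v: "v \<in> V"
  shows "real (d v) = cmod (slope v) ^ 2"
proof -
  define u where "u = V_add (V_add v v) v"
  have u: "u \<in> V" "slope u = 3 * slope v" "sheet u = 1"
    using v sheet_cube[OF v] by (simp_all add: u_def V_add_closed slope_sheet_add power3_eq_cube)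
  then have mem: "u \<in> identity_component"
    by (simp add: identity_component_def)
  have "real (d u) = cmod (slope u) ^ 2"
    using slopes.form_is_norm[OF imageI[OF mem, of slope]] unfolding degree_of_slope[OF mem] by simp
  then show ?thesis
    using d_triple[OF v] unfolding u(2) by (simp add: u_def norm_mult power_mult_distrib)
qed

lemma V_pow_closed: "v \<in> V \<Longrightarrow> v [^]\<^bsub>V_group\<^esub> (n::int) \<in> V"
  using V.int_pow_closed by simp

lemma slope_sheet_nat_pow:
  assumes "v \<in> V"
  shows "slope (v [^]\<^bsub>V_group\<^esub> (n::nat)) = of_nat n * slope v \<and> sheet (v [^]\<^bsub>V_group\<^esub> n) = sheet v ^ n"
proof (induction n)
  case 0
  then show ?case by (simp add: slope_sheet_zero)
next
  case (Suc n)
  have "v [^]\<^bsub>V_group\<^esub> n \<in> V"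
    using V.nat_pow_closed assms by simp
  with Suc assms show ?case
    by (simp add: slope_sheet_add algebra_simps)
qed

lemma slope_sheet_inv:
  assumes "v \<in> V"
  shows "slope (inv\<^bsub>V_group\<^esub> v) = - slope v" "sheet (inv\<^bsub>V_group\<^esub> v) * sheet v = 1"
proof -
  have "inv\<^bsub>V_group\<^esub> v \<in> V" "V_add (inv\<^bsub>V_group\<^esub> v) v = V_zero"
    using V.inv_closed[of v] V.l_inv[of v] assms by simp_all
  then have "slope (inv\<^bsub>V_group\<^esub> v) + slope v = 0" "sheet (inv\<^bsub>V_group\<^esub> v) * sheet v = 1"
    using slope_sheet_add[of "inv\<^bsub>V_group\<^esub> v" v] assms slope_sheet_zero by simp_all
  then show "slope (inv\<^bsub>V_group\<^esub> v) = - slope v" "sheet (inv\<^bsub>V_group\<^esub> v) * sheet v = 1"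
    by (simp_all add: eq_neg_iff_add_eq_0)
qed

lemma slope_int_pow:
  assumes "v \<in> V"
  shows "slope (v [^]\<^bsub>V_group\<^esub> (n::int)) = of_int n * slope v"
proof (cases n)
  case (nonneg k)
  then show ?thesis
    using slope_sheet_nat_pow[OF assms] by (simp add: int_pow_int)
next
  case (neg k)
  have "v [^]\<^bsub>V_group\<^esub> Suc k \<in> V"
    using V.nat_pow_closed[of v "Suc k"] assms by (simp del: Group.nat_pow_Suc)
  then show ?thesis
    using slope_sheet_nat_pow[OF assms, of "Suc k"] slope_sheet_inv(1) V.int_pow_neg_int[of v "Suc k"] assms
    unfolding neg by (simp add: algebra_simps del: Group.nat_pow_Suc)
qed

lemma sheet_int_pow:
  assumes "v \<in> V" "sheet v = 1"
  shows "sheet (v [^]\<^bsub>V_group\<^esub> (n::int)) = 1"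
proof (cases n)
  case (nonneg k)
  then show ?thesis
    using slope_sheet_nat_pow[OF assms(1)] assms(2) by (simp add: int_pow_int)
next
  case (neg k)
  have "v [^]\<^bsub>V_group\<^esub> Suc k \<in> V"
    using V.nat_pow_closed[of v "Suc k"] assms by (simp del: Group.nat_pow_Suc)
  then show ?thesis
    using slope_sheet_nat_pow[OF assms(1), of "Suc k"] slope_sheet_inv(2) V.int_pow_neg_int[of v "Suc k"] assms
    unfolding neg by (fastforce simp del: Group.nat_pow_Suc)
qed

lemma V_lin_props:
  "V_lin m n \<in> V" "slope (V_lin m n) = of_int m + of_int n * cnj omega" "sheet (V_lin m n) = 1"
  using generators V_pow_closed slope_int_pow sheet_int_pow
  by (simp_all add: V_lin_def V_add_closed slope_sheet_add)

lemma h0_pow_props: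
  assumes "0 \<le> t"
  shows "h0 [^]\<^bsub>V_group\<^esub> (t::int) \<in> V" "slope (h0 [^]\<^bsub>V_group\<^esub> t) = 0"
    "sheet (h0 [^]\<^bsub>V_group\<^esub> t) = omega ^ nat t"
proof -
  obtain k where t: "t = int k"
    using assms zero_le_imp_eq_int by blast
  show "h0 [^]\<^bsub>V_group\<^esub> (t::int) \<in> V" "slope (h0 [^]\<^bsub>V_group\<^esub> t) = 0"
    "sheet (h0 [^]\<^bsub>V_group\<^esub> t) = omega ^ nat t"
    using generators(1-3) V.nat_pow_closed[of h0 k] slope_sheet_nat_pow[of h0 k] by (simp_all add: t int_pow_int)
qed

definition combination :: "int \<times> int \<times> int \<Rightarrow> point" where
  "combination = (\<lambda>(m, n, t). V_lin m n \<otimes>\<^bsub>V_group\<^esub> (h0 [^]\<^bsub>V_group\<^esub> t))"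

lemma combination_props:
  assumes "0 \<le> t"
  shows "combination (m, n, t) \<in> V" "slope (combination (m, n, t)) = of_int m + of_int n * cnj omega"
    "sheet (combination (m, n, t)) = omega ^ nat t"
  using V_lin_props[of m n] h0_pow_props[OF assms] by (simp_all add: combination_def V_add_closed slope_sheet_add)

lemma omega_pow_mod: "omega ^ (k mod 3) = omega ^ k"
proof -
  have "omega ^ k = omega ^ (3 * (k div 3) + k mod 3)"
    by simp
  then show ?thesis
    unfolding power_add power_mult omega_cube by simp
qed

lemma omega_neq_one: "omega \<noteq> 1" "omega ^ 2 \<noteq> 1" "omega ^ 2 \<noteq> omega"
  unfolding cnj_omega[symmetric] by (auto simp: complex_eq_iff omega_Re_Im)

lemma omega_pow_inj:
  assumes "t \<in> {0..<3::int}" "t' \<in> {0..<3}" "omega ^ nat t = omega ^ nat t'"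
  shows "t = t'"
proof -
  have "t = 0 \<or> t = 1 \<or> t = 2" "t' = 0 \<or> t' = 1 \<or> t' = 2"
    using assms(1,2) by auto
  then show ?thesis
    using assms(3) omega_neq_one omega_neq_one[symmetric] by (elim disjE) simp_all
qed

lemma cube_root_of_unity:
  assumes "z ^ 3 = 1"
  shows "\<exists>t \<in> {0..<3::int}. z = omega ^ nat t"
proof -
  have "(z - 1) * (z - omega) * (z - omega ^ 2) = z ^ 3 - (1 + omega + omega ^ 2) * z ^ 2
      + (omega + omega ^ 2 + omega ^ 3) * z - omega ^ 3"
    by (simp add: power2_eq_square power3_eq_cube algebra_simps)
  also have "\<dots> = 0"
    unfolding omega_cube assms omega_square by simp
  finally have "z = omega ^ nat 0 \<or> z = omega ^ nat 1 \<or> z = omega ^ nat 2"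
    by auto
  moreover have "0 \<in> {0..<3::int}" "1 \<in> {0..<3::int}" "2 \<in> {0..<3::int}"
    by simp_all
  ultimately show ?thesis
    by blast
qed

text \<open>
  Euclidean division by \<open>1\<close>: after subtracting the combination of \<open>h1\<close> and \<open>h2\<close> with the nearest
  slope, the degree is an integer less than \<open>1\<close>.
\<close>

lemma combination_surj:
  assumes v: "v \<in> V"
  obtains m n t where "t \<in> {0..<3}" "v = combination (m, n, t)"
proof -
  obtain m n :: int where near: "cmod (slope v - (of_int m + of_int n * cnj omega)) < 1"
    by (rule near_eisenstein_integer)
  define w where "w = V_add v (V_lin (- m) (- n))"
  have w: "w \<in> V" "slope w = slope v - (of_int m + of_int n * cnj omega)"
    using v V_lin_props[of "- m" "- n"] by (simp_all add: w_def V_add_closed slope_sheet_add)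
  have "real (d w) < 1"
    unfolding d_eq_norm_slope[OF w(1)] w(2) using near by (simp add: power_less_one_iff)
  then have "d w = 0"
    by simp
  then have "cmod (slope w) ^ 2 = 0"
    using d_eq_norm_slope[OF w(1)] by simp
  then have s: "slope v = of_int m + of_int n * cnj omega"
    using w(2) by simp
  obtain t where t: "t \<in> {0..<3::int}" "sheet v = omega ^ nat t"
    using cube_root_of_unity[OF sheet_cube[OF v]] by blast
  then have "v = combination (m, n, t)"
    using combination_props[of t m n] s v by (intro slope_sheet_inj) simp_all
  with t show thesis
    using that by blast
qed

lemma combination_inj:
  assumes "t \<in> {0..<3}" "t' \<in> {0..<3}" "combination (m, n, t) = combination (m', n', t')"
  shows "m = m' \<and> n = n' \<and> t = t'"
proof -
  have "slope (combination (m, n, t)) = slope (combination (m', n', t'))"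
    "sheet (combination (m, n, t)) = sheet (combination (m', n', t'))"
    using assms(3) by simp_all
  then have "of_int m + of_int n * cnj omega = of_int m' + of_int n' * cnj omega" "omega ^ nat t = omega ^ nat t'"
    using assms(1,2) by (simp_all add: combination_props)
  then show ?thesis
    using eisenstein_eq_iff omega_pow_inj[OF assms(1,2)] by blast
qed

lemma combination_iso:
  "combination \<in> iso (integer_group \<times>\<times> integer_group \<times>\<times> integer_mod_group 3) V_group"
proof -
  let ?G = "integer_group \<times>\<times> integer_group \<times>\<times> integer_mod_group 3"
  have carrier: "carrier ?G = UNIV \<times> UNIV \<times> {0..<3}"
    by (simp add: DirProd_def integer_group_def carrier_integer_mod_group)
  have "combination \<in> hom ?G V_group"
  proof (rule homI)
    fix x assume "x \<in> carrier ?G"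
    then obtain m n t where x: "x = (m, n, t)" "t \<in> {0..<3}"
      unfolding carrier by auto
    show "combination x \<in> carrier V_group"
      using x combination_props by simp
    fix y assume "y \<in> carrier ?G"
    then obtain m' n' t' where y: "y = (m', n', t')" "t' \<in> {0..<3}"
      unfolding carrier by auto
    have prod: "x \<otimes>\<^bsub>?G\<^esub> y = (m + m', n + n', (t + t') mod 3)"
      by (simp add: x y DirProd_def integer_group_def mult_integer_mod_group)
    have "omega ^ nat ((t + t') mod 3) = omega ^ nat t * omega ^ nat t'"
    proof -
      have "nat ((t + t') mod 3) = (nat t + nat t') mod 3"
        using x(2) y(2) by (simp add: nat_mod_distrib nat_add_distrib)
      then show ?thesis
        by (simp only: omega_pow_mod power_add)
    qed
    then show "combination (x \<otimes>\<^bsub>?G\<^esub> y) = combination x \<otimes>\<^bsub>V_group\<^esub> combination y"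
      unfolding prod unfolding x(1) y(1) using x(2) y(2) combination_props
      by (intro slope_sheet_inj) (simp_all add: V_add_closed slope_sheet_add algebra_simps)
  qed
  moreover have "bij_betw combination (carrier ?G) (carrier V_group)"
    unfolding carrier bij_betw_def
  proof
    show "inj_on combination (UNIV \<times> UNIV \<times> {0..<3})"
      by (rule inj_onI) (use combination_inj in auto)
    show "combination ` (UNIV \<times> UNIV \<times> {0..<3}) = carrier V_group"
    proof
      show "combination ` (UNIV \<times> UNIV \<times> {0..<3}) \<subseteq> carrier V_group"
        using combination_props by auto
      show "carrier V_group \<subseteq> combination ` (UNIV \<times> UNIV \<times> {0..<3})"
      proof
        fix v assume "v \<in> carrier V_group"
        then have "v \<in> V" by simp
        then obtain m n t where "t \<in> {0..<3}" "v = combination (m, n, t)"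
          by (rule combination_surj)
        then show "v \<in> combination ` (UNIV \<times> UNIV \<times> {0..<3})"
          by auto
      qed
    qed
  qed
  ultimately show ?thesis
    by (simp add: iso_def)
qed

lemma V_isomorphic: "V_group \<cong> integer_group \<times>\<times> integer_group \<times>\<times> integer_mod_group 3"
proof -
  have "Group.group (integer_group \<times>\<times> integer_group \<times>\<times> integer_mod_group 3)"
    by (intro DirProd_group group_integer_group group_integer_mod_group)
  then show ?thesis
    using combination_iso group.iso_sym unfolding is_iso_def by blast
qed

lemma order_generators:
  "group.ord V_group h1 = 0" "group.ord V_group h2 = 0" "group.ord V_group h0 = 3"
proof -
  have inf: "group.ord V_group v = 0" if "v \<in> V" "slope v \<noteq> 0" for v
  proof -
    have "v [^]\<^bsub>V_group\<^esub> int (V.ord v) = \<one>\<^bsub>V_group\<^esub>"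
      using V.int_pow_eq_id[of v "int (V.ord v)"] that by simp
    then have "of_nat (V.ord v) * slope v = 0"
      using slope_int_pow[OF that(1), of "int (V.ord v)"] slope_sheet_zero by simp
    with that show ?thesis by simp
  qed
  have "omega \<noteq> 0"
    using cmod_omega by auto
  then show "group.ord V_group h1 = 0" "group.ord V_group h2 = 0"
    using generators by (simp_all add: inf)
  have dvd: "V.ord h0 dvd k \<longleftrightarrow> omega ^ k = 1" for k
  proof -
    have "V.ord h0 dvd k \<longleftrightarrow> h0 [^]\<^bsub>V_group\<^esub> k = V_zero"
      using V.pow_eq_id[of h0 k] generators by simp
    also have "\<dots> \<longleftrightarrow> omega ^ k = 1"
    proof
      assume "h0 [^]\<^bsub>V_group\<^esub> k = V_zero"
      then show "omega ^ k = 1"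
        using slope_sheet_nat_pow[OF generators(1), of k] generators slope_sheet_zero by simp
    next
      assume "omega ^ k = 1"
      then show "h0 [^]\<^bsub>V_group\<^esub> k = V_zero"
        using slope_sheet_nat_pow[OF generators(1), of k] generators slope_sheet_zero V.nat_pow_closed[of h0 k]
        by (intro slope_sheet_inj) simp_all
    qed
    finally show ?thesis .
  qed
  have "V.ord h0 dvd 3" "\<not> V.ord h0 dvd 1"
    using dvd[of 3] dvd[of 1] omega_cube omega_neq_one by simp_all
  moreover from this have "V.ord h0 \<le> 3"
    by (simp add: dvd_imp_le)
  then have "V.ord h0 = 0 \<or> V.ord h0 = 1 \<or> V.ord h0 = 2 \<or> V.ord h0 = 3"
    by arith
  ultimately show "group.ord V_group h0 = 3"
    by (elim disjE) simp_all
qed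

lemma d_combination:
  assumes "0 \<le> t"
  shows "int (d (combination (m, n, t))) = m ^ 2 - m * n + n ^ 2"
proof -
  have "real (d (combination (m, n, t))) = cmod (of_real (of_int m) + of_real (of_int n) * cnj omega) ^ 2"
    using d_eq_norm_slope combination_props[OF assms] by simp
  also have "\<dots> = of_int (m ^ 2 - m * n + n ^ 2)"
    unfolding eisenstein_norm by simp
  finally have "real_of_int (int (d (combination (m, n, t)))) = of_int (m ^ 2 - m * n + n ^ 2)"
    by simp
  then show ?thesis
    by (simp only: of_int_eq_iff)
qed

lemma V1_eq: "V1 = identity_component"
proof
  show "V1 \<subseteq> identity_component"
    using V_lin_props by (auto simp: V1_def identity_component_def)
  show "identity_component \<subseteq> V1"
  proof
    fix v assume "v \<in> identity_component"
    then have v: "v \<in> V" "sheet v = 1"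
      by (simp_all add: identity_component_def)
    obtain m n t where c: "t \<in> {0..<3}" "v = combination (m, n, t)"
      using combination_surj[OF v(1)] .
    then have "slope v = slope (V_lin m n)"
      using combination_props V_lin_props by simp
    then have "v = V_lin m n"
      using v V_lin_props by (intro slope_sheet_inj) simp_all
    then show "v \<in> V1"
      by (auto simp: V1_def)
  qed
qed

lemma V1_iff: "v \<in> V1 \<longleftrightarrow> v \<in> V \<and> sheet v = 1"
  by (simp add: V1_eq identity_component_def)

lemma V1_eqI: "v \<in> V1 \<Longrightarrow> w \<in> V1 \<Longrightarrow> slope v = slope w \<Longrightarrow> v = w"
  using slope_sheet_inj by (simp add: V1_iff)

lemma V1_closed:
  "v \<in> V1 \<Longrightarrow> w \<in> V1 \<Longrightarrow> V_add v w \<in> V1" "v \<in> V1 \<Longrightarrow> w \<in> V1 \<Longrightarrow> V_comp v w \<in> V1"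
  "V_zero \<in> V1" "h1 \<in> V1" "v \<in> V1 \<Longrightarrow> inv\<^bsub>V_group\<^esub> v \<in> V1"
  using generators slope_sheet_inv(2)[of v] V.inv_closed[of v]
  by (auto simp: V1_iff V_add_closed slope_sheet_add d_comp slope_sheet_comp slope_sheet_zero)

lemma V1_slope:
  "v \<in> V1 \<Longrightarrow> w \<in> V1 \<Longrightarrow> slope (V_add v w) = slope v + slope w"
  "v \<in> V1 \<Longrightarrow> w \<in> V1 \<Longrightarrow> slope (V_comp v w) = slope v * slope w"
  by (simp_all add: V1_iff slope_sheet_add slope_sheet_comp)

lemma subgroup_V1: "subgroup V1 V_group"
  by (rule V.subgroupI) (use V1_closed in \<open>auto simp: V1_iff\<close>)

lemma V1_ring_simps [simp]:
  "carrier V1_ring = V1" "v \<otimes>\<^bsub>V1_ring\<^esub> w = V_comp v w" "\<one>\<^bsub>V1_ring\<^esub> = h1"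
  "v \<oplus>\<^bsub>V1_ring\<^esub> w = V_add v w" "\<zero>\<^bsub>V1_ring\<^esub> = V_zero"
  by (simp_all add: V1_ring_def)

lemma ring_V1: "ring V1_ring"
proof (rule ringI)
  show "abelian_group V1_ring"
  proof (rule abelian_groupI)
    fix v assume "v \<in> carrier V1_ring"
    then show "\<exists>w\<in>carrier V1_ring. w \<oplus>\<^bsub>V1_ring\<^esub> v = \<zero>\<^bsub>V1_ring\<^esub>"
      using V1_closed(5) V.l_inv[of v] by (auto simp: V1_iff)
  qed ((rule V1_eqI)?; simp add: V1_closed V1_slope slope_sheet_zero)+
  show "Group.monoid V1_ring"
    by (rule monoidI) ((rule V1_eqI)?; simp add: V1_closed V1_slope generators)+
qed ((rule V1_eqI)?; simp add: V1_closed V1_slope algebra_simps)+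

lemma V1_ring_iso:
  "\<exists>R \<in> ring_iso V1_ring Eisenstein_ring. \<forall>m n. R (V_lin m n) = of_int m + of_int n * omega"
proof
  let ?R = "\<lambda>v. cnj (slope v)"
  show lin: "\<forall>m n. ?R (V_lin m n) = of_int m + of_int n * omega"
    by (simp add: V_lin_props)
  have "?R ` V1 = {?R (V_lin m n) | m n. True}"
    unfolding V1_def by blast
  then have img: "?R ` V1 = carrier Eisenstein_ring"
    using lin by (simp add: Eisenstein_ring_def)
  have "inj_on ?R V1"
    by (rule inj_onI) (simp add: V1_eqI)
  moreover have "?R \<in> ring_hom V1_ring Eisenstein_ring"
  proof (rule ring_hom_memI)
    fix v assume "v \<in> carrier V1_ring"
    then show "?R v \<in> carrier Eisenstein_ring"
      using img by auto
  qed (simp_all add: V1_slope generators Eisenstein_ring_def)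
  ultimately show "?R \<in> ring_iso V1_ring Eisenstein_ring"
    using img by (simp add: ring_iso_def bij_betw_def)
qed

theorem theorem1p1:
  shows "comm_group V_group
    \<and> V_group \<cong> integer_group \<times>\<times> integer_group \<times>\<times> integer_mod_group 3
    \<and> (\<lambda>(m, n, t). V_lin m n \<otimes>\<^bsub>V_group\<^esub> (h0 [^]\<^bsub>V_group\<^esub> t))
        \<in> iso (integer_group \<times>\<times> integer_group \<times>\<times> integer_mod_group 3) V_group
    \<and> group.ord V_group h1 = 0 \<and> group.ord V_group h2 = 0 \<and> group.ord V_group h0 = 3
    \<and> (\<forall>m n. \<forall>t \<in> {0, 1, 2::int}.
         int (d (V_lin m n \<otimes>\<^bsub>V_group\<^esub> (h0 [^]\<^bsub>V_group\<^esub> t))) = m ^ 2 - m * n + n ^ 2)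
    \<and> subgroup V1 V_group
    \<and> ring V1_ring
    \<and> (\<exists>R \<in> ring_iso V1_ring Eisenstein_ring. \<forall>m n. R (V_lin m n) = of_int m + of_int n * omega)"
proof (intro conjI)
  show "\<forall>m n. \<forall>t \<in> {0, 1, 2::int}.
      int (d (V_lin m n \<otimes>\<^bsub>V_group\<^esub> (h0 [^]\<^bsub>V_group\<^esub> t))) = m ^ 2 - m * n + n ^ 2"
  proof (intro allI ballI)
    fix m n t :: int assume "t \<in> {0, 1, 2}"
    then have "0 \<le> t" by auto
    then show "int (d (V_lin m n \<otimes>\<^bsub>V_group\<^esub> (h0 [^]\<^bsub>V_group\<^esub> t))) = m ^ 2 - m * n + n ^ 2"
      using d_combination[of t m n] by (simp only: combination_def prod.case)
  qed
qed (rule comm_group_V V_isomorphic combination_iso[unfolded combination_def] order_generators subgroup_V1 ring_V1 V1_ring_iso)+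

end
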